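(* Let $d\ge 2$ be an integer. If $\gamma\in\mathbb{C}$ is a parabolic parameter for the family $f_c(z)=z^d+c$, then $\gamma\in\overline{\mathbb{Q}}$ and $$H(\gamma)\le (2d^d)^{1/(d-1)}.$$
   Context: For $\gamma\in\mathbb{C}$ let $f_\gamma(z)=z^d+\gamma$. A periodic point $\alpha\in\mathbb{C}$ of $f_\gamma$ of period $m$ is parabolic if its multiplier $(f_\gamma^{\circ m})'(\alpha)$ is a root of unity. The parameter $\gamma$ is a parabolic parameter if $f_\gamma$ has a parabolic periodic point in $\mathbb{C}$. $H$ is the absolute multiplicative height: for a number field $K$ and $a\in K$, $H(a)=\left(\prod_{v\in M_K}\max\{1,\|a\|_v\}\right)^{1/[K:\mathbb{Q}]}$, where $M_K$ is the set of absolute values on $K$ extending the standard $p$-adic and archimedean absolute values on $\mathbb{Q}$ and $\|a\|_v=|a|_v^{n_v}$ with $n_v$ the local degree at $v$; this does not depend on the choice of $K\ni a$. *)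

theory Defs
  imports
    "HOL-Algebra.Algebraic_Closure_Type"
    "HOL-Algebra.Embedded_Algebras"
    "HOL-Algebra.QuotRing"
    "HOL-Analysis.Analysis"
begin

section \<open>Parabolic parameters of the unicritical family\<close>

definition unicritical :: "nat \<Rightarrow> complex \<Rightarrow> complex \<Rightarrow> complex" where
  "unicritical d c z = z ^ d + c"

text \<open>The period \<open>m\<close> is any positive \<open>m\<close> with \<open>f\<^sup>m \<alpha> = \<alpha>\<close>, not necessarily the least one.
  The multiplier for a multiple of the least period is a power of the multiplier for the least
  period, so being parabolic does not depend on the choice of \<open>m\<close>.\<close>

definition periodic_point :: "(complex \<Rightarrow> complex) \<Rightarrow> nat \<Rightarrow> complex \<Rightarrow> bool" where
  "periodic_point f m \<alpha> \<longleftrightarrow> m > 0 \<and> (f ^^ m) \<alpha> = \<alpha>"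

definition multiplier :: "(complex \<Rightarrow> complex) \<Rightarrow> nat \<Rightarrow> complex \<Rightarrow> complex" where
  "multiplier f m \<alpha> = deriv (f ^^ m) \<alpha>"

definition root_of_unity :: "complex \<Rightarrow> bool" where
  "root_of_unity w \<longleftrightarrow> (\<exists>n>0. w ^ n = 1)"

definition parabolic_parameter :: "nat \<Rightarrow> complex \<Rightarrow> bool" where
  "parabolic_parameter d \<gamma> \<longleftrightarrow>
     (\<exists>m \<alpha>. periodic_point (unicritical d \<gamma>) m \<alpha> \<and>
            root_of_unity (multiplier (unicritical d \<gamma>) m \<alpha>))"

section \<open>Number fields and their absolute values\<close>

abbreviation complex_ring :: "complex ring" where
  "complex_ring \<equiv> ring_of_type_algebra"

text \<open>Number fields are taken inside the complex numbers.\<close>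

definition number_field :: "complex set \<Rightarrow> bool" where
  "number_field K \<longleftrightarrow> subfield K complex_ring \<and> ring.finite_dimension complex_ring \<rat> K"

definition field_degree :: "complex set \<Rightarrow> nat" where
  "field_degree K = ring.dim complex_ring \<rat> K"

definition absolute_value_on :: "complex set \<Rightarrow> (complex \<Rightarrow> real) \<Rightarrow> bool" where
  "absolute_value_on K v \<longleftrightarrow>
     (\<forall>x\<in>K. 0 \<le> v x) \<and>
     (\<forall>x\<in>K. v x = 0 \<longleftrightarrow> x = 0) \<and>
     (\<forall>x\<in>K. \<forall>y\<in>K. v (x * y) = v x * v y) \<and>
     (\<forall>x\<in>K. \<forall>y\<in>K. v (x + y) \<le> v x + v y)"

definition padic_abs :: "nat \<Rightarrow> rat \<Rightarrow> real" where
  "padic_abs p x =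
     (if x = 0 then 0
      else real p powi (int (multiplicity (int p) (snd (quotient_of x))) -
                        int (multiplicity (int p) (fst (quotient_of x)))))"

text \<open>The condition \<open>v \<in> extensional K\<close> fixes the irrelevant values of \<open>v\<close> outside \<open>K\<close>, so that
  two elements of \<open>places K\<close> are equal iff they agree as functions on \<open>K\<close>.\<close>

definition places :: "complex set \<Rightarrow> (complex \<Rightarrow> real) set" where
  "places K = {v \<in> extensional K. absolute_value_on K v \<and>
     ((\<forall>q::rat. v (of_rat q) = \<bar>of_rat q\<bar>) \<or>
      (\<exists>p. prime p \<and> (\<forall>q::rat. v (of_rat q) = padic_abs p q)))}"

section \<open>Completions and local degrees\<close>

text \<open>The completion \<open>K\<^sub>v\<close> is the ring of \<open>v\<close>-Cauchy sequences in \<open>K\<close> modulo the ideal of null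
  sequences.\<close>

definition cauchy_ring :: "complex set \<Rightarrow> (complex \<Rightarrow> real) \<Rightarrow> (nat \<Rightarrow> complex) ring" where
  "cauchy_ring K v =
     \<lparr> carrier = {s. range s \<subseteq> K \<and> (\<forall>e>0. \<exists>N. \<forall>m\<ge>N. \<forall>n\<ge>N. v (s m - s n) < e)},
       monoid.mult = (\<lambda>s t n. s n * t n),
       one = (\<lambda>n. 1),
       ring.zero = (\<lambda>n. 0),
       add = (\<lambda>s t n. s n + t n) \<rparr>"

definition null_ideal :: "complex set \<Rightarrow> (complex \<Rightarrow> real) \<Rightarrow> (nat \<Rightarrow> complex) set" where
  "null_ideal K v = {s. range s \<subseteq> K \<and> (\<lambda>n. v (s n)) \<longlonglongrightarrow> 0}"

definition completion :: "complex set \<Rightarrow> (complex \<Rightarrow> real) \<Rightarrow> (nat \<Rightarrow> complex) set ring" where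
  "completion K v = cauchy_ring K v Quot null_ideal K v"

text \<open>The copy of \<open>\<rat>\<^sub>v\<close> inside \<open>K\<^sub>v\<close>: the classes of the Cauchy sequences of rational numbers.\<close>

definition rat_completion ::
  "complex set \<Rightarrow> (complex \<Rightarrow> real) \<Rightarrow> (nat \<Rightarrow> complex) set set" where
  "rat_completion K v =
     (\<lambda>s. null_ideal K v +>\<^bsub>cauchy_ring K v\<^esub> s) ` {s \<in> carrier (cauchy_ring K v). range s \<subseteq> \<rat>}"

definition local_degree :: "complex set \<Rightarrow> (complex \<Rightarrow> real) \<Rightarrow> nat" where
  "local_degree K v = ring.dim (completion K v) (rat_completion K v) (carrier (completion K v))"

section \<open>The absolute multiplicative height\<close>

definition normalized_abs :: "complex set \<Rightarrow> (complex \<Rightarrow> real) \<Rightarrow> complex \<Rightarrow> real" where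
  "normalized_abs K v a = v a ^ local_degree K v"

text \<open>The product over all places is written as the product over those with a factor different
  from 1; for \<open>a\<close> in a number field \<open>K\<close> there are only finitely many of them.\<close>

definition mult_height :: "complex set \<Rightarrow> complex \<Rightarrow> real" where
  "mult_height K a =
     (\<Prod>v\<in>{v \<in> places K. max 1 (normalized_abs K v a) \<noteq> 1}. max 1 (normalized_abs K v a))
       powr (1 / real (field_degree K))"

end

theory Submission
  imports Defs "HOL-Complex_Analysis.Complex_Analysis" "Jordan_Normal_Form.Char_Poly"
begin

text \<open>
  A parabolic parameter \<open>\<gamma>\<close> has a cycle \<open>\<alpha> 0, \<dots>, \<alpha> (m - 1)\<close> of multiplier \<open>1\<close>, if cycles are
  traversed several times. Let \<open>K\<close> be a number field that contains \<open>\<gamma>\<close>. The height is bounded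
  place by place: \<open>v \<gamma> ^ (d - 1)\<close> is at most \<open>2\<close> at the archimedean places and at most
  \<open>v d ^ (- d)\<close> at the others, and the local degrees at the places above one place of \<open>\<rat>\<close> add up
  to at most \<open>[K : \<rat>]\<close>. The product of the local bounds is \<open>(2 d ^ d) ^ [K : \<rat>]\<close>.

  At the archimedean places the bound comes from complex dynamics: if \<open>\<bar>c\<bar> ^ (d - 1) > 2\<close>, then the
  inverse branches along a cycle map the disc of radius \<open>\<bar>c\<bar>\<close> to a smaller disc, so every cycle is
  repelling (\<open>repelling_if_large\<close>). The parameters with a cycle of length \<open>m\<close> and multiplier \<open>1\<close>
  are the roots of a nonzero polynomial over \<open>\<rat>\<close> (\<open>parabolic_polynomial\<close>). This proves that \<open>\<gamma>\<close> is
  algebraic, and a common bound for the complex roots of a rational polynomial is also a bound for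
  each archimedean absolute value of a root (\<open>archimedean_le_root_bound\<close>).

  At a non-archimedean place the product of the \<open>d \<alpha> i ^ (d - 1)\<close> is \<open>1\<close>. For \<open>v \<gamma> > 1\<close> the quotients
  \<open>\<alpha> i / \<gamma>\<close> are topologically nilpotent, so \<open>\<alpha> i ^ d = - \<gamma> (1 - \<alpha> (i + 1) / \<gamma>)\<close> behaves like
  \<open>- \<gamma>\<close>, and the value of the multiplier determines \<open>v \<gamma>\<close>. The points \<open>\<alpha> i\<close> are outside \<open>K\<close> in
  general; instead of extending \<open>v\<close>, the proof applies Nakayama's lemma to the module that they
  generate over the valuation ring (\<open>parabolic_bound\<close>).

  The inequality for the local degrees (\<open>sum_local_degree_le\<close>) rests on weak approximation and on
  the fact that a basis of \<open>K\<close> over \<open>\<rat>\<close> spans the product of the completions over the completion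
  of \<open>\<rat>\<close>, which is the closedness of finite-dimensional subspaces (\<open>asymptotic_coordinates\<close>).
  The product of the completions is represented by simultaneous Cauchy sequences in \<open>K\<close>.
\<close>

section \<open>Absolute values on subfields of the complex numbers\<close>

locale complex_subfield =
  fixes K :: "complex set"
  assumes zero_mem [simp, intro]: "0 \<in> K"
    and one_mem [simp, intro]: "1 \<in> K"
    and add_mem [intro]: "x \<in> K \<Longrightarrow> y \<in> K \<Longrightarrow> x + y \<in> K"
    and uminus_mem [intro]: "x \<in> K \<Longrightarrow> - x \<in> K"
    and mult_mem [intro]: "x \<in> K \<Longrightarrow> y \<in> K \<Longrightarrow> x * y \<in> K"
    and inverse_mem [intro]: "x \<in> K \<Longrightarrow> inverse x \<in> K"
begin

lemma diff_mem [intro]: "x \<in> K \<Longrightarrow> y \<in> K \<Longrightarrow> x - y \<in> K"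
  using add_mem[of x "- y"] uminus_mem[of y] by simp

lemma divide_mem [intro]: "x \<in> K \<Longrightarrow> y \<in> K \<Longrightarrow> x / y \<in> K"
  by (simp add: divide_inverse inverse_mem mult_mem)

lemma power_mem [intro]: "x \<in> K \<Longrightarrow> x ^ n \<in> K"
  by (induction n) auto

lemma sum_mem [intro]: "(\<And>i. i \<in> A \<Longrightarrow> f i \<in> K) \<Longrightarrow> sum f A \<in> K"
  by (induction A rule: infinite_finite_induct) auto

lemma of_nat_mem [simp, intro]: "of_nat n \<in> K"
  by (induction n) auto

lemma of_int_mem [simp, intro]: "of_int n \<in> K"
  by (cases n rule: int_cases2) auto

lemma of_rat_mem [simp, intro]: "of_rat q \<in> K"
  by (cases q) (auto simp: of_rat_rat)

lemma Rats_mem: "x \<in> \<rat> \<Longrightarrow> x \<in> K"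
  by (auto elim: Rats_cases)

end

locale valued_field = complex_subfield K for K +
  fixes v :: "complex \<Rightarrow> real"
  assumes abs_val: "absolute_value_on K v"
begin

lemma v_nonneg [simp]: "x \<in> K \<Longrightarrow> 0 \<le> v x"
  and v_eq_0_iff: "x \<in> K \<Longrightarrow> v x = 0 \<longleftrightarrow> x = 0"
  and v_mult: "x \<in> K \<Longrightarrow> y \<in> K \<Longrightarrow> v (x * y) = v x * v y"
  and v_add_le: "x \<in> K \<Longrightarrow> y \<in> K \<Longrightarrow> v (x + y) \<le> v x + v y"
  using abs_val by (auto simp: absolute_value_on_def)

lemma v_0 [simp]: "v 0 = 0"
  by (simp add: v_eq_0_iff)

lemma v_1 [simp]: "v 1 = 1"
  using v_mult[of 1 1] v_eq_0_iff[of 1] by simp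

lemma v_pos: "x \<in> K \<Longrightarrow> x \<noteq> 0 \<Longrightarrow> 0 < v x"
  using v_nonneg[of x] v_eq_0_iff[of x] by linarith

lemma v_power: "x \<in> K \<Longrightarrow> v (x ^ n) = v x ^ n"
  by (induction n) (auto simp: v_mult power_mem)

lemma v_minus: assumes "x \<in> K" shows "v (- x) = v x"
proof -
  have "v (-1) ^ 2 = 1" using v_power[of "-1" 2] by (auto simp: uminus_mem)
  moreover have "v (-1) \<ge> 0" by (simp add: uminus_mem)
  ultimately have "v (-1) = 1" by (simp add: power2_eq_1_iff)
  thus ?thesis using v_mult[of "-1" x] assms by (auto simp: uminus_mem)
qed

lemma v_diff_le: "x \<in> K \<Longrightarrow> y \<in> K \<Longrightarrow> v (x - y) \<le> v x + v y"
  using v_add_le[of x "- y"] v_minus[of y] by (simp add: uminus_mem)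

lemma v_diff_commute: "x \<in> K \<Longrightarrow> y \<in> K \<Longrightarrow> v (x - y) = v (y - x)"
  using v_minus[of "x - y"] by (simp add: diff_mem)

lemma v_inverse: "x \<in> K \<Longrightarrow> v (inverse x) = inverse (v x)"
  using v_mult[of x "inverse x"] by (cases "x = 0") (auto simp: inverse_mem field_simps v_eq_0_iff)

lemma v_divide: "x \<in> K \<Longrightarrow> y \<in> K \<Longrightarrow> v (x / y) = v x / v y"
  by (simp add: divide_inverse v_mult v_inverse inverse_mem)

lemma v_sum_le: "(\<And>i. i \<in> A \<Longrightarrow> f i \<in> K) \<Longrightarrow> v (sum f A) \<le> (\<Sum>i\<in>A. v (f i))"
proof (induction A rule: infinite_finite_induct)
  case (insert x F)
  have "v (f x + sum f F) \<le> v (f x) + v (sum f F)"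
    using insert.prems by (intro v_add_le sum_mem) auto
  thus ?case using insert by force
qed auto

end

section \<open>Weak approximation\<close>

text \<open>Two different absolute values with the same nontrivial restriction to \<open>\<rat>\<close> are not powers
  of each other, so the usual appeal to inequivalence can be made explicit: from an element where they
  differ, a high power times a suitable power of one fixed rational number separates them.\<close>

lemma separating_element_aux:
  assumes "valued_field K v" "valued_field K v'"
    and same: "\<And>q. q \<in> \<rat> \<Longrightarrow> v q = w q" "\<And>q. q \<in> \<rat> \<Longrightarrow> v' q = w q"
    and nontriv: "q0 \<in> \<rat>" "w q0 > 1"
    and x: "x \<in> K" "x \<noteq> 0" "v x < v' x"
  shows "\<exists>y\<in>K. v y < 1 \<and> v' y > 1"
proof -
  interpret v: valued_field K v by fact
  interpret v': valued_field K v' by fact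
  let ?c = "ln (w q0)" and ?a = "ln (v x)" and ?b = "ln (v' x)"
  have c: "?c > 0" using nontriv by simp
  have pos: "v x > 0" "v' x > 0" using x v.v_pos v'.v_pos by auto
  have ab: "?a < ?b" using pos x by simp
  obtain n :: nat where n: "?c < of_nat n * (?b - ?a)"
    using ab reals_Archimedean3[of "?b - ?a"] by auto
  \<comment> \<open>For large \<open>n\<close> the values of \<open>x ^ n\<close> lie on the two sides of the value of \<open>q0 ^ k\<close>.\<close>
  define k where "k = \<lfloor>of_nat n * ?a / ?c\<rfloor> + 1"
  have k1: "of_nat n * ?a < k * ?c"
  proof -
    have "of_nat n * ?a / ?c < k" unfolding k_def by linarith
    thus ?thesis using c by (simp add: field_simps)
  qed
  have k2: "k * ?c < of_nat n * ?b"
  proof -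
    have "k * ?c \<le> (of_nat n * ?a / ?c + 1) * ?c"
      unfolding k_def using c by (intro mult_right_mono) auto
    also have "\<dots> = of_nat n * ?a + ?c" using c by (simp add: field_simps)
    also have "\<dots> < of_nat n * ?b" using n by (simp add: algebra_simps)
    finally show ?thesis .
  qed
  define r where "r = q0 powi k"
  have q0K: "q0 \<in> K" using nontriv v.Rats_mem by auto
  hence rK: "r \<in> K" unfolding r_def power_int_def by (auto simp: v.power_mem v.inverse_mem)
  have q0: "q0 \<noteq> 0" using nontriv same(1)[of q0] by auto
  have "v r = v q0 powi k" "v' r = v' q0 powi k"
    unfolding r_def power_int_def
    by (auto simp: q0K v.v_power v.v_inverse v.inverse_mem v'.v_power v'.v_inverse)
  hence vr: "v r = w q0 powi k" "v' r = w q0 powi k"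
    using same nontriv by auto
  have wk: "w q0 powi k = exp (k * ?c)"
    using nontriv by (simp add: exp_powr_real flip: powr_real_of_int')
      (simp add: powr_def)
  have "r \<noteq> 0" using q0 by (simp add: r_def)
  let ?y = "x ^ n / r"
  have "v ?y = exp (of_nat n * ?a - k * ?c)"
    using x rK pos by (simp add: v.v_divide v.v_power v.power_mem vr wk exp_diff exp_of_nat_mult)
  moreover have "v' ?y = exp (of_nat n * ?b - k * ?c)"
    using x rK pos by (simp add: v'.v_divide v'.v_power v.power_mem vr wk exp_diff exp_of_nat_mult)
  moreover have "?y \<in> K" using x rK by auto
  ultimately show ?thesis using k1 k2 by (intro bexI[of _ ?y]) auto
qed

lemma separating_element:
  assumes "valued_field K v" "valued_field K v'"
    and same: "\<And>q. q \<in> \<rat> \<Longrightarrow> v q = w q" "\<And>q. q \<in> \<rat> \<Longrightarrow> v' q = w q"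
    and nontriv: "q0 \<in> \<rat>" "w q0 > 1"
    and ne: "\<exists>x\<in>K. v x \<noteq> v' x"
  shows "\<exists>y\<in>K. v y < 1 \<and> v' y > 1"
proof -
  interpret v: valued_field K v by fact
  interpret v': valued_field K v' by fact
  from ne obtain x where x: "x \<in> K" "v x \<noteq> v' x" by auto
  have x0: "x \<noteq> 0" using x by auto
  show ?thesis
  proof (cases "v x < v' x")
    case True
    thus ?thesis using separating_element_aux[OF assms(1,2) same nontriv] x x0 by auto
  next
    case False
    hence "v (inverse x) < v' (inverse x)"
      using x x0 v.v_pos[of x] v'.v_pos[of x] by (auto simp: v.v_inverse v'.v_inverse)
    thus ?thesis
      using separating_element_aux[OF assms(1,2) same nontriv, of "inverse x"] x x0 v.inverse_mem
      by auto
  qed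
qed

text \<open>The powers of \<open>y\<close> are sent to \<open>1\<close> or to \<open>0\<close> by \<open>t \<mapsto> t / (1 + t)\<close>, according to whether
  \<open>y\<close> is large or small; this switch is the engine of weak approximation.\<close>

context valued_field
begin

lemma switch_large:
  assumes "y \<in> K" "v y > 1"
  shows "(\<lambda>n. v (y ^ n / (1 + y ^ n) - 1)) \<longlonglongrightarrow> 0"
proof (rule tendsto_sandwich[OF _ _ tendsto_const])
  define a where "a = v y"
  have a: "a > 1" using assms(2) by (simp add: a_def)
  show "(\<lambda>n. 1 / (v y ^ n - 1)) \<longlonglongrightarrow> 0"
    unfolding a_def[symmetric] using a by real_asymp
  have "eventually (\<lambda>n. v y ^ n > 1) sequentially"
    unfolding a_def[symmetric] using a by real_asymp
  thus "\<forall>\<^sub>F n in sequentially. v (y ^ n / (1 + y ^ n) - 1) \<le> 1 / (v y ^ n - 1)"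
  proof eventually_elim
    case (elim n)
    have mem: "y ^ n \<in> K" "1 + y ^ n \<in> K" using assms(1) by auto
    have le: "v y ^ n - 1 \<le> v (1 + y ^ n)"
      using v_diff_le[of "1 + y ^ n" 1] mem assms(1) by (simp add: v_power)
    hence "1 + y ^ n \<noteq> 0" using elim by (metis diff_gt_0_iff_gt not_le v_0)
    hence "y ^ n / (1 + y ^ n) - 1 = - (1 / (1 + y ^ n))" by (simp add: field_simps)
    hence "v (y ^ n / (1 + y ^ n) - 1) = 1 / v (1 + y ^ n)"
      using mem by (simp add: v_minus divide_mem v_divide)
    thus ?case using le elim by (simp add: frac_le)
  qed
qed (use assms in \<open>auto intro!: always_eventually v_nonneg\<close>)

lemma switch_small:
  assumes "y \<in> K" "v y < 1"
  shows "(\<lambda>n. v (y ^ n / (1 + y ^ n))) \<longlonglongrightarrow> 0"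
proof (rule tendsto_sandwich[OF _ _ tendsto_const])
  have lim: "(\<lambda>n. v y ^ n) \<longlonglongrightarrow> 0"
    using assms by (intro LIMSEQ_realpow_zero) auto
  show "(\<lambda>n. v y ^ n / (1 - v y ^ n)) \<longlonglongrightarrow> 0"
    using tendsto_divide[OF lim tendsto_diff[OF tendsto_const[of 1] lim]] by simp
  have "eventually (\<lambda>n. v y ^ n < 1) sequentially"
    using lim by (rule order_tendstoD) simp
  thus "\<forall>\<^sub>F n in sequentially. v (y ^ n / (1 + y ^ n)) \<le> v y ^ n / (1 - v y ^ n)"
  proof eventually_elim
    case (elim n)
    have mem: "y ^ n \<in> K" "1 + y ^ n \<in> K" using assms(1) by auto
    have le: "1 - v y ^ n \<le> v (1 + y ^ n)"
      using v_diff_le[of "1 + y ^ n" "y ^ n"] mem assms(1) by (simp add: v_power)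
    thus ?case using elim mem assms(1) by (simp add: v_divide v_power frac_le)
  qed
qed (use assms in \<open>auto intro!: always_eventually v_nonneg\<close>)

end

text \<open>Finitely many different absolute values on \<open>K\<close> with a common nontrivial restriction \<open>w\<close>
  to \<open>\<rat>\<close>. An element \<open>q0\<close> of value larger than \<open>1\<close> witnesses the nontriviality, which
  prevents two elements of \<open>T\<close> from being powers of each other.\<close>

locale coherent_values = complex_subfield K for K +
  fixes w :: "complex \<Rightarrow> real" and q0 :: complex and T :: "(complex \<Rightarrow> real) set"
  assumes finite_T: "finite T"
    and T_valued: "v \<in> T \<Longrightarrow> valued_field K v"
    and T_restrict: "v \<in> T \<Longrightarrow> q \<in> \<rat> \<Longrightarrow> v q = w q"
    and T_distinct: "u \<in> T \<Longrightarrow> v \<in> T \<Longrightarrow> u \<noteq> v \<Longrightarrow> \<exists>x\<in>K. u x \<noteq> v x"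
    and w_valued: "valued_field \<rat> w"
    and nontrivial: "q0 \<in> \<rat>" "w q0 > 1"
begin

text \<open>Induction on the set of small places: an element \<open>y\<close> that serves for \<open>S\<close> is corrected at a
  further place \<open>u\<close> by an element \<open>z\<close> that separates \<open>v\<close> from \<open>u\<close>. If \<open>y\<close> is not large at \<open>u\<close>,
  then a high power of \<open>y\<close> outweighs the values of \<open>z\<close> in \<open>S\<close>; otherwise the switched powers of
  \<open>y\<close> do, without changing the values at \<open>u\<close> and \<open>v\<close> in the limit.\<close>

lemma dominant_element:
  assumes v: "v \<in> T" and S: "S \<subseteq> T - {v}"
  shows "\<exists>y\<in>K. v y > 1 \<and> (\<forall>u\<in>S. u y < 1)"
proof -
  interpret v: valued_field K v using T_valued v .
  have "finite S" using S finite_T finite_subset by auto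
  thus ?thesis using S
  proof (induction S)
    case empty
    show ?case using nontrivial T_restrict[OF v, of q0] Rats_mem by (intro bexI[of _ q0]) auto
  next
    case (insert u S)
    then obtain y where y: "y \<in> K" "v y > 1" "\<forall>u\<in>S. u y < 1" by auto
    have u: "u \<in> T" "u \<noteq> v" using insert by auto
    interpret u: valued_field K u using T_valued u by auto
    obtain z where z: "z \<in> K" "u z < 1" "v z > 1"
      using separating_element[OF T_valued[OF u(1)] T_valued[OF v] T_restrict[OF u(1)]
          T_restrict[OF v] nontrivial] T_distinct[OF u(1) v u(2)] by auto
    show ?case
    proof (cases "u y \<le> 1")
      case True
      have "\<forall>\<^sub>F n in sequentially. \<forall>s\<in>S. s (y ^ n * z) < 1"
      proof (intro eventually_ball_finite ballI)
        fix s assume s: "s \<in> S"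
        then interpret s: valued_field K s using T_valued insert.prems by auto
        have "(\<lambda>n. s y ^ n * s z) \<longlonglongrightarrow> 0 * s z"
          using y s by (intro tendsto_mult LIMSEQ_realpow_zero tendsto_const) auto
        hence "\<forall>\<^sub>F n in sequentially. s y ^ n * s z < 1" by (intro order_tendstoD) auto
        thus "\<forall>\<^sub>F n in sequentially. s (y ^ n * z) < 1"
          using y z by (simp add: s.v_mult s.v_power power_mem)
      qed (use insert in auto)
      then obtain n where n: "\<forall>s\<in>S. s (y ^ n * z) < 1"
        by (auto simp: eventually_sequentially)
      have "u y ^ n * u z \<le> 1 * u z"
        using True y z by (intro mult_right_mono power_le_one) auto
      hence "u (y ^ n * z) < 1"
        using y z by (simp add: u.v_mult u.v_power power_mem)
      moreover have "1 * v z \<le> v y ^ n * v z"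
        using y z by (intro mult_right_mono one_le_power) auto
      hence "v y ^ n * v z > 1" using z by linarith
      hence "v (y ^ n * z) > 1"
        using y z by (simp add: v.v_mult v.v_power power_mem)
      ultimately show ?thesis using n y z by (intro bexI[of _ "y ^ n * z"]) auto
    next
      case False
      define t where "t n = y ^ n / (1 + y ^ n)" for n
      have tK: "t n \<in> K" for n using y by (auto simp: t_def)
      have small: "\<forall>\<^sub>F n in sequentially. \<forall>s\<in>S. s (t n * z) < 1"
      proof (intro eventually_ball_finite ballI)
        fix s assume s: "s \<in> S"
        then interpret s: valued_field K s using T_valued insert.prems by auto
        have "(\<lambda>n. s (t n)) \<longlonglongrightarrow> 0"
          unfolding t_def using y s by (intro s.switch_small) auto
        hence "(\<lambda>n. s (t n) * s z) \<longlonglongrightarrow> 0 * s z"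
          by (intro tendsto_mult tendsto_const)
        hence "\<forall>\<^sub>F n in sequentially. s (t n) * s z < 1" by (intro order_tendstoD) auto
        thus "\<forall>\<^sub>F n in sequentially. s (t n * z) < 1"
          using tK z by (simp add: s.v_mult)
      qed (use insert in auto)
      have lim: "(\<lambda>n. r (t n * z)) \<longlonglongrightarrow> r z" if r: "valued_field K r" "r y > 1" for r
      proof -
        interpret r: valued_field K r by fact
        have "(\<lambda>n. r (t n - 1)) \<longlonglongrightarrow> 0"
          unfolding t_def using r.switch_large[OF y(1) r(2)] .
        moreover have "norm (r (t n) - 1) \<le> r (t n - 1)" for n
          using r.v_add_le[of "t n - 1" 1] r.v_diff_le[of "t n" "t n - 1"] tK[of n]
          by (auto simp: diff_mem abs_le_iff)
        ultimately have "(\<lambda>n. r (t n) - 1) \<longlonglongrightarrow> 0"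
          by (rule_tac Lim_null_comparison[OF always_eventually]) auto
        hence "(\<lambda>n. r (t n)) \<longlonglongrightarrow> 1" by (rule LIM_zero_cancel)
        from tendsto_mult[OF this tendsto_const[of "r z"]] show ?thesis
          using tK z by (simp add: r.v_mult)
      qed
      have "\<forall>\<^sub>F n in sequentially. v (t n * z) > 1"
        using lim[OF v.valued_field_axioms y(2)] z(3) by (rule order_tendstoD)
      moreover have "\<forall>\<^sub>F n in sequentially. u (t n * z) < 1"
        using lim[OF u.valued_field_axioms] False z(2) by (intro order_tendstoD) auto
      ultimately have "\<forall>\<^sub>F n in sequentially. v (t n * z) > 1 \<and> (\<forall>s\<in>insert u S. s (t n * z) < 1)"
        using small by eventually_elim auto
      then obtain n where "v (t n * z) > 1 \<and> (\<forall>s\<in>insert u S. s (t n * z) < 1)"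
        by (auto simp: eventually_sequentially)
      thus ?thesis using tK z by (intro bexI[of _ "t n * z"]) auto
    qed
  qed
qed

text \<open>The switch is applied to a high power of an element that dominates at \<open>v\<close>.\<close>

lemma approximate_idempotent:
  assumes v: "v \<in> T" and e: "\<epsilon> > 0"
  shows "\<exists>y\<in>K. v (y - 1) < \<epsilon> \<and> (\<forall>u\<in>T - {v}. u y < \<epsilon>)"
proof -
  interpret v: valued_field K v using T_valued v .
  obtain y where y: "y \<in> K" "v y > 1" "\<forall>u\<in>T - {v}. u y < 1"
    using dominant_element[OF v order_refl] by auto
  let ?t = "\<lambda>n. y ^ n / (1 + y ^ n)"
  have "\<forall>\<^sub>F n in sequentially. \<forall>u\<in>T - {v}. u (?t n) < \<epsilon>"
  proof (intro eventually_ball_finite ballI)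
    fix u assume u: "u \<in> T - {v}"
    then interpret u: valued_field K u using T_valued by auto
    show "\<forall>\<^sub>F n in sequentially. u (?t n) < \<epsilon>"
      using u.switch_small y u e by (intro order_tendstoD(2)) auto
  qed (use finite_T in auto)
  moreover have "\<forall>\<^sub>F n in sequentially. v (?t n - 1) < \<epsilon>"
    using v.switch_large y e by (intro order_tendstoD(2)) auto
  ultimately have "\<forall>\<^sub>F n in sequentially. v (?t n - 1) < \<epsilon> \<and> (\<forall>u\<in>T - {v}. u (?t n) < \<epsilon>)"
    by eventually_elim auto
  then obtain n where "v (?t n - 1) < \<epsilon> \<and> (\<forall>u\<in>T - {v}. u (?t n) < \<epsilon>)"
    by (auto simp: eventually_sequentially)
  moreover have "?t n \<in> K" using y by auto
  ultimately show ?thesis by blast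
qed

text \<open>The element is a multiple of \<open>b\<close> by a sufficiently accurate approximate idempotent.\<close>

lemma weak_approximation:
  assumes v: "v \<in> T" and e: "\<epsilon> > 0" and b: "b \<in> K"
  shows "\<exists>y\<in>K. v (y - b) < \<epsilon> \<and> (\<forall>u\<in>T - {v}. u y < \<epsilon>)"
proof -
  interpret v: valued_field K v using T_valued v .
  define C where "C = 1 + (\<Sum>u\<in>T. u b)"
  have le: "u b < C" if "u \<in> T" for u
  proof -
    have "u b \<le> (\<Sum>u\<in>T. u b)"
      using b T_valued valued_field.v_nonneg finite_T that by (intro member_le_sum) auto
    thus ?thesis by (simp add: C_def)
  qed
  have C: "C > 0" using le[OF v] b v.v_nonneg[of b] by linarith
  obtain y where y: "y \<in> K" "v (y - 1) < \<epsilon> / C" "\<forall>u\<in>T - {v}. u y < \<epsilon> / C"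
    using approximate_idempotent[OF v, of "\<epsilon> / C"] C e by auto
  have bound: "u (z * b) < \<epsilon>" if "u \<in> T" "z \<in> K" "u z < \<epsilon> / C" for u z
  proof -
    interpret u: valued_field K u using T_valued that by auto
    have "u (z * b) = u z * u b" using that b by (simp add: u.v_mult)
    also have "\<dots> \<le> u z * C" using le[OF that(1)] that by (intro mult_left_mono) auto
    also have "\<dots> < \<epsilon>" using that C by (simp add: field_simps)
    finally show ?thesis .
  qed
  have "v (y * b - b) < \<epsilon>"
    using bound[OF v, of "y - 1"] y by (auto simp: algebra_simps diff_mem)
  thus ?thesis using bound y b by (intro bexI[of _ "y * b"]) auto
qed

end

section \<open>Cauchy sequences and null sequences\<close>

context valued_field
begin

abbreviation "Cau \<equiv> carrier (cauchy_ring K v)"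
abbreviation "Nul \<equiv> null_ideal K v"

lemma Cau_iff: "s \<in> Cau \<longleftrightarrow> range s \<subseteq> K \<and> (\<forall>e>0. \<exists>N. \<forall>m\<ge>N. \<forall>n\<ge>N. v (s m - s n) < e)"
  by (simp add: cauchy_ring_def)

lemma CauI:
  assumes "\<And>n. s n \<in> K" "\<And>e. e > 0 \<Longrightarrow> \<exists>N. \<forall>m\<ge>N. \<forall>n\<ge>N. v (s m - s n) < e"
  shows "s \<in> Cau"
  using assms by (auto simp: Cau_iff)

lemma CauD: "s \<in> Cau \<Longrightarrow> e > 0 \<Longrightarrow> \<exists>N. \<forall>m\<ge>N. \<forall>n\<ge>N. v (s m - s n) < e"
  by (auto simp: Cau_iff)

lemma Cau_mem: "s \<in> Cau \<Longrightarrow> s n \<in> K"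
  by (auto simp: Cau_iff)

lemma Nul_iff: "s \<in> Nul \<longleftrightarrow> (\<forall>n. s n \<in> K) \<and> (\<lambda>n. v (s n)) \<longlonglongrightarrow> 0"
  by (auto simp: null_ideal_def)

lemma Nul_mem: "s \<in> Nul \<Longrightarrow> s n \<in> K"
  by (auto simp: Nul_iff)

lemma NulI:
  assumes "\<And>n. s n \<in> K" "\<And>n. v (s n) \<le> b n" "b \<longlonglongrightarrow> 0"
  shows "s \<in> Nul"
  unfolding Nul_iff
  by (intro conjI allI assms(1) tendsto_sandwich[OF always_eventually always_eventually tendsto_const assms(3)] v_nonneg assms(2))

lemma Cau_const [simp]: "x \<in> K \<Longrightarrow> (\<lambda>n. x) \<in> Cau"
  by (auto simp: Cau_iff)

lemma Nul_zero [simp]: "(\<lambda>n. 0) \<in> Nul"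
  by (auto simp: Nul_iff)

lemma Cau_add:
  assumes "s \<in> Cau" "t \<in> Cau" shows "(\<lambda>n. s n + t n) \<in> Cau"
proof (rule CauI)
  fix e :: real assume e: "e > 0"
  obtain N M where N: "\<forall>m\<ge>N. \<forall>n\<ge>N. v (s m - s n) < e/2" and M: "\<forall>m\<ge>M. \<forall>n\<ge>M. v (t m - t n) < e/2"
    using CauD[OF assms(1), of "e/2"] CauD[OF assms(2), of "e/2"] e by auto
  have "v (s m + t m - (s n + t n)) < e" if "m \<ge> max N M" "n \<ge> max N M" for m n
  proof -
    have "v (s m - s n + (t m - t n)) \<le> v (s m - s n) + v (t m - t n)"
      using assms by (intro v_add_le diff_mem Cau_mem)
    also have "\<dots> < e" using N M that by (auto simp: field_simps) (smt (verit) field_sum_of_halves)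
    finally show ?thesis by (simp add: algebra_simps)
  qed
  thus "\<exists>N. \<forall>m\<ge>N. \<forall>n\<ge>N. v (s m + t m - (s n + t n)) < e" by blast
qed (use assms in \<open>auto intro: Cau_mem\<close>)

lemma Nul_add:
  assumes "s \<in> Nul" "t \<in> Nul" shows "(\<lambda>n. s n + t n) \<in> Nul"
proof (rule NulI)
  show "(\<lambda>n. v (s n) + v (t n)) \<longlonglongrightarrow> 0"
    using tendsto_add[of "\<lambda>n. v (s n)" 0 _ "\<lambda>n. v (t n)" 0] assms by (auto simp: Nul_iff)
qed (use assms Nul_mem in \<open>auto intro!: v_add_le\<close>)

lemma Cau_bounded:
  assumes "s \<in> Cau" shows "\<exists>C>0. \<forall>n. v (s n) \<le> C"
proof -
  obtain N where N: "\<forall>m\<ge>N. \<forall>n\<ge>N. v (s m - s n) < 1" using CauD[OF assms, of 1] by auto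
  define C where "C = (\<Sum>i\<le>N. v (s i)) + 1"
  have *: "v (s n) \<le> (\<Sum>i\<le>N. v (s i))" if "n \<le> N" for n
    using that assms by (intro member_le_sum) (auto intro!: v_nonneg Cau_mem)
  have "v (s n) \<le> C" for n
  proof (cases "n \<le> N")
    case False
    have "v (s n) = v (s n - s N + s N)" by simp
    also have "\<dots> \<le> v (s n - s N) + v (s N)" using assms by (intro v_add_le diff_mem Cau_mem)
    also have "\<dots> \<le> C" using N[rule_format, of n N] False *[of N] by (simp add: C_def)
    finally show ?thesis .
  qed (use * in \<open>auto simp: C_def intro: add_increasing2\<close>)
  moreover have "C > 0" unfolding C_def using assms by (intro add_nonneg_pos sum_nonneg) (auto intro!: v_nonneg Cau_mem)
  ultimately show ?thesis by blast
qed

lemma Cau_mult: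
  assumes "s \<in> Cau" "t \<in> Cau" shows "(\<lambda>n. s n * t n) \<in> Cau"
proof (rule CauI)
  fix e :: real assume e: "e > 0"
  obtain B where B: "B > 0" "\<And>n. v (s n) \<le> B" using Cau_bounded[OF assms(1)] by auto
  obtain C where C: "C > 0" "\<And>n. v (t n) \<le> C" using Cau_bounded[OF assms(2)] by auto
  obtain N M where N: "\<forall>m\<ge>N. \<forall>n\<ge>N. v (s m - s n) < e/(2*C)"
    and M: "\<forall>m\<ge>M. \<forall>n\<ge>M. v (t m - t n) < e/(2*B)"
    using CauD[OF assms(1), of "e/(2*C)"] CauD[OF assms(2), of "e/(2*B)"] e B C by auto
  have "v (s m * t m - s n * t n) < e" if "m \<ge> max N M" "n \<ge> max N M" for m n
  proof -
    have mem: "s i \<in> K" "t i \<in> K" for i using assms Cau_mem by auto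
    have "v (s m * (t m - t n) + (s m - s n) * t n) \<le> v (s m) * v (t m - t n) + v (s m - s n) * v (t n)"
      using v_add_le[of "s m * (t m - t n)" "(s m - s n) * t n"] mem
      by (simp add: v_mult diff_mem mult_mem)
    also have "\<dots> \<le> B * v (t m - t n) + v (s m - s n) * C"
      using B C mem by (intro add_mono mult_mono) (auto simp: diff_mem)
    also have "B * v (t m - t n) < B * (e/(2*B))"
      using M that B by (intro mult_strict_left_mono) auto
    also have "v (s m - s n) * C < e/(2*C) * C"
      using N that C by (intro mult_strict_right_mono) auto
    finally show ?thesis using B C by (simp add: algebra_simps)
  qed
  thus "\<exists>N. \<forall>m\<ge>N. \<forall>n\<ge>N. v (s m * t m - s n * t n) < e" by blast
qed (use assms in \<open>auto intro: Cau_mem\<close>)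

lemma Nul_mult:
  assumes "s \<in> Cau" "t \<in> Nul" shows "(\<lambda>n. s n * t n) \<in> Nul"
proof -
  obtain B where B: "B > 0" "\<And>n. v (s n) \<le> B" using Cau_bounded[OF assms(1)] by auto
  have mem: "s i \<in> K" "t i \<in> K" for i using assms Cau_mem Nul_mem by auto
  show ?thesis
  proof (rule NulI)
    show "(\<lambda>n. B * v (t n)) \<longlonglongrightarrow> 0"
      using tendsto_mult[OF tendsto_const[of B], of "\<lambda>n. v (t n)" 0] assms by (auto simp: Nul_iff)
    show "v (s n * t n) \<le> B * v (t n)" for n
      using B mem by (auto simp: v_mult intro: mult_right_mono)
  qed (use mem in auto)
qed

lemma Cau_uminus: "s \<in> Cau \<Longrightarrow> (\<lambda>n. - s n) \<in> Cau"
  using Cau_mult[OF Cau_const[of "-1"], of s] by (simp add: uminus_mem)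

lemma Nul_uminus: "s \<in> Nul \<Longrightarrow> (\<lambda>n. - s n) \<in> Nul"
  using Nul_mult[OF Cau_const[of "-1"], of s] by (simp add: uminus_mem)

lemma Cau_diff: "s \<in> Cau \<Longrightarrow> t \<in> Cau \<Longrightarrow> (\<lambda>n. s n - t n) \<in> Cau"
  using Cau_add[OF _ Cau_uminus, of s t] by simp

lemma Nul_diff: "s \<in> Nul \<Longrightarrow> t \<in> Nul \<Longrightarrow> (\<lambda>n. s n - t n) \<in> Nul"
  using Nul_add[OF _ Nul_uminus, of s t] by simp

lemma Cau_sum: "(\<And>i. i \<in> A \<Longrightarrow> s i \<in> Cau) \<Longrightarrow> (\<lambda>n. \<Sum>i\<in>A. s i n) \<in> Cau"
  by (induction A rule: infinite_finite_induct) (auto intro: Cau_add)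

lemma Nul_sum: "(\<And>i. i \<in> A \<Longrightarrow> s i \<in> Nul) \<Longrightarrow> (\<lambda>n. \<Sum>i\<in>A. s i n) \<in> Nul"
  by (induction A rule: infinite_finite_induct) (auto intro: Nul_add)

lemma Nul_imp_Cau:
  assumes "s \<in> Nul" shows "s \<in> Cau"
proof (rule CauI)
  fix e :: real assume e: "e > 0"
  have "\<forall>\<^sub>F n in sequentially. v (s n) < e/2"
    using assms e by (intro order_tendstoD) (auto simp: Nul_iff)
  then obtain N where N: "\<And>n. n \<ge> N \<Longrightarrow> v (s n) < e/2" by (auto simp: eventually_sequentially)
  have "v (s m - s n) < e" if "m \<ge> N" "n \<ge> N" for m n
    using v_diff_le[of "s m" "s n"] Nul_mem[OF assms] N[OF that(1)] N[OF that(2)] by fastforce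
  thus "\<exists>N. \<forall>m\<ge>N. \<forall>n\<ge>N. v (s m - s n) < e" by blast
qed (use assms in \<open>auto intro: Nul_mem\<close>)

lemma Nul_cong_Cau: "s \<in> Cau \<Longrightarrow> (\<lambda>n. t n - s n) \<in> Nul \<Longrightarrow> t \<in> Cau"
  using Cau_add[of "\<lambda>n. t n - s n" s] Nul_imp_Cau by simp

lemma one_notin_Nul: "(\<lambda>n. 1) \<notin> Nul"
  by (auto simp: Nul_iff LIMSEQ_const_iff)

text \<open>Otherwise arbitrarily late small terms would force all late terms to be small.\<close>

lemma Cau_not_Nul_bounded_below:
  assumes "s \<in> Cau" "s \<notin> Nul"
  shows "\<exists>\<delta>>0. \<exists>N. \<forall>n\<ge>N. v (s n) \<ge> \<delta>"
proof -
  have mem: "s i \<in> K" for i using assms Cau_mem by auto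
  have "\<not> (\<lambda>n. v (s n)) \<longlonglongrightarrow> 0" using assms mem by (auto simp: Nul_iff)
  then obtain e where e: "e > 0" "\<And>N. \<exists>n\<ge>N. v (s n) \<ge> e"
    using mem by (auto simp: LIMSEQ_iff not_less)
  obtain N where N: "\<forall>m\<ge>N. \<forall>n\<ge>N. v (s m - s n) < e/2" using CauD[OF assms(1), of "e/2"] e by auto
  obtain m where m: "m \<ge> N" "v (s m) \<ge> e" using e by auto
  have "v (s n) \<ge> e/2" if "n \<ge> N" for n
    using v_add_le[of "s m - s n" "s n"] mem N[rule_format, OF m(1) that] m by (auto simp: diff_mem)
  thus ?thesis using e by (intro exI[of _ "e/2"]) auto
qed

text \<open>Away from its finitely many small terms, a Cauchy sequence that is not null can be
  inverted term by term.\<close>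

lemma Cau_inverse:
  assumes "s \<in> Cau" "s \<notin> Nul"
  shows "\<exists>u\<in>Cau. (\<lambda>n. u n * s n - 1) \<in> Nul"
proof -
  have mem: "s i \<in> K" for i using assms Cau_mem by auto
  obtain d N where d: "d > 0" "\<And>n. n \<ge> N \<Longrightarrow> v (s n) \<ge> d"
    using Cau_not_Nul_bounded_below[OF assms] by auto
  have nz: "s n \<noteq> 0" if "n \<ge> N" for n using d(2)[OF that] d(1) by auto
  define u where "u n = (if n \<ge> N then inverse (s n) else 0)" for n
  have uC: "u \<in> Cau"
  proof (rule CauI)
    fix e :: real assume e: "e > 0"
    obtain M where M: "\<forall>m\<ge>M. \<forall>n\<ge>M. v (s m - s n) < e * d * d"
      using CauD[OF assms(1), of "e*d*d"] e d by auto
    have "v (u m - u n) < e" if mn: "m \<ge> max N M" "n \<ge> max N M" for m n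
    proof -
      have nz': "s m \<noteq> 0" "s n \<noteq> 0" and g: "v (s m) \<ge> d" "v (s n) \<ge> d" using mn nz d by auto
      have "u m - u n = (s n - s m) / (s m * s n)" using mn nz' by (simp add: u_def field_simps)
      hence "v (u m - u n) = v (s m - s n) / (v (s m) * v (s n))"
        using mem v_diff_commute[of "s n" "s m"] by (simp add: v_divide v_mult diff_mem mult_mem)
      also have "\<dots> \<le> v (s m - s n) / (d * d)"
        using d g mem by (intro divide_left_mono mult_mono mult_pos_pos) (auto simp: diff_mem)
      also have "\<dots> < e * d * d / (d * d)" using M mn d by (intro divide_strict_right_mono) auto
      finally show ?thesis using d by simp
    qed
    thus "\<exists>N. \<forall>m\<ge>N. \<forall>n\<ge>N. v (u m - u n) < e" by blast
  qed (auto simp: u_def mem)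
  have "(\<lambda>n. u n * s n - 1) \<in> Nul"
    unfolding Nul_iff
  proof (intro conjI allI)
    have "\<forall>\<^sub>F n in sequentially. v (u n * s n - 1) = 0"
      using nz by (auto simp: u_def eventually_sequentially intro!: exI[of _ N])
    thus "(\<lambda>n. v (u n * s n - 1)) \<longlonglongrightarrow> 0" by (rule tendsto_eventually)
  qed (intro diff_mem mult_mem Cau_mem[OF uC] mem one_mem)
  thus ?thesis using uC by auto
qed

text \<open>Gaussian elimination over the field of Cauchy sequences modulo null sequences, by
  induction on the number \<open>D\<close> of equations.\<close>

lemma nontrivial_relation:
  assumes "finite I" "card I > D" "\<And>x k. x \<in> I \<Longrightarrow> k < D \<Longrightarrow> c x k \<in> Cau"
  shows "\<exists>a. (\<forall>x\<in>I. a x \<in> Cau) \<and> (\<exists>x\<in>I. a x \<notin> Nul) \<and>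
             (\<forall>k<D. (\<lambda>n. \<Sum>x\<in>I. a x n * c x k n) \<in> Nul)"
  using assms
proof (induction D arbitrary: I c)
  case 0
  hence "I \<noteq> {}" by auto
  thus ?case using one_notin_Nul by (intro exI[of _ "\<lambda>x n. 1"]) auto
next
  case (Suc D)
  show ?case
  proof (cases "\<forall>x\<in>I. c x D \<in> Nul")
    case True
    have "\<exists>a. (\<forall>x\<in>I. a x \<in> Cau) \<and> (\<exists>x\<in>I. a x \<notin> Nul) \<and>
        (\<forall>k<D. (\<lambda>n. \<Sum>x\<in>I. a x n * c x k n) \<in> Nul)"
      by (rule Suc.IH) (use Suc.prems in auto)
    then obtain a where a: "\<forall>x\<in>I. a x \<in> Cau" "\<exists>x\<in>I. a x \<notin> Nul"
      "\<forall>k<D. (\<lambda>n. \<Sum>x\<in>I. a x n * c x k n) \<in> Nul"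
      by blast
    have "(\<lambda>n. \<Sum>x\<in>I. a x n * c x D n) \<in> Nul"
      using a(1) True by (intro Nul_sum Nul_mult) auto
    hence "\<forall>k<Suc D. (\<lambda>n. \<Sum>x\<in>I. a x n * c x k n) \<in> Nul"
      using a(3) less_Suc_eq by blast
    thus ?thesis using a(1,2) by blast
  next
    case False
    then obtain x0 where x0: "x0 \<in> I" "c x0 D \<notin> Nul" by auto
    obtain u where u: "u \<in> Cau" "(\<lambda>n. u n * c x0 D n - 1) \<in> Nul"
      using Cau_inverse[of "c x0 D"] x0 Suc.prems by blast
    define Y where "Y = I - {x0}"
    have Y: "finite Y" "x0 \<notin> Y" "I = insert x0 Y" "card Y > D"
      using Suc.prems x0 by (auto simp: Y_def)
    define c' where "c' x k n = c x k n - c x D n * (u n * c x0 k n)" for x k n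
    have c: "c x k \<in> Cau" if "x \<in> I" "k \<le> D" for x k using Suc.prems that by auto
    have c': "c' x k \<in> Cau" if "x \<in> Y" "k < D" for x k
      unfolding c'_def using that Y x0 u by (intro Cau_diff Cau_mult c) auto
    have "\<exists>a. (\<forall>x\<in>Y. a x \<in> Cau) \<and> (\<exists>x\<in>Y. a x \<notin> Nul) \<and>
        (\<forall>k<D. (\<lambda>n. \<Sum>x\<in>Y. a x n * c' x k n) \<in> Nul)"
      by (rule Suc.IH) (use Y c' in auto)
    then obtain a where a: "\<forall>x\<in>Y. a x \<in> Cau" "\<exists>x\<in>Y. a x \<notin> Nul"
      "\<forall>k<D. (\<lambda>n. \<Sum>x\<in>Y. a x n * c' x k n) \<in> Nul"
      by blast
    define z where "z n = - (u n * (\<Sum>x\<in>Y. a x n * c x D n))" for n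
    have z: "z \<in> Cau"
      unfolding z_def using a Y u by (intro Cau_uminus Cau_mult Cau_sum c) auto
    have eq: "(\<Sum>x\<in>I. (a(x0 := z)) x n * c x k n) = z n * c x0 k n + (\<Sum>x\<in>Y. a x n * c x k n)" for k n
    proof -
      have "(\<Sum>x\<in>Y. (a(x0 := z)) x n * c x k n) = (\<Sum>x\<in>Y. a x n * c x k n)"
        using Y by (intro sum.cong) auto
      thus ?thesis using Y by simp
    qed
    have rel: "(\<lambda>n. z n * c x0 k n + (\<Sum>x\<in>Y. a x n * c x k n)) \<in> Nul" if k: "k < Suc D" for k
    proof (cases "k = D")
      case True
      have "(\<lambda>n. - ((\<Sum>x\<in>Y. a x n * c x D n) * (u n * c x0 D n - 1))) \<in> Nul"
        using a Y u by (intro Nul_uminus Nul_mult Cau_sum Cau_mult c) auto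
      moreover have "- ((\<Sum>x\<in>Y. a x n * c x D n) * (u n * c x0 D n - 1)) =
          z n * c x0 k n + (\<Sum>x\<in>Y. a x n * c x k n)" for n
        by (simp add: True z_def algebra_simps)
      ultimately show ?thesis by simp
    next
      case False
      hence "(\<lambda>n. \<Sum>x\<in>Y. a x n * c' x k n) \<in> Nul" using a(3) k by simp
      moreover have "(\<Sum>x\<in>Y. a x n * c' x k n) = z n * c x0 k n + (\<Sum>x\<in>Y. a x n * c x k n)" for n
      proof -
        have "(\<Sum>x\<in>Y. a x n * c' x k n) =
            (\<Sum>x\<in>Y. a x n * c x k n) - (\<Sum>x\<in>Y. a x n * c x D n) * (u n * c x0 k n)"
          by (simp add: c'_def right_diff_distrib sum_subtractf sum_distrib_right mult.assoc)
        thus ?thesis by (simp add: z_def)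
      qed
      ultimately show ?thesis by simp
    qed
    have "\<forall>k<Suc D. (\<lambda>n. \<Sum>x\<in>I. (a(x0 := z)) x n * c x k n) \<in> Nul"
      using rel by (simp only: eq) blast
    moreover have "\<exists>x\<in>I. (a(x0 := z)) x \<notin> Nul"
    proof -
      obtain x where "x \<in> Y" "a x \<notin> Nul" using a(2) by blast
      thus ?thesis using Y(2,3) by (intro bexI[of _ x]) auto
    qed
    moreover have "\<forall>x\<in>I. (a(x0 := z)) x \<in> Cau"
      using a(1) z Y(3) by simp
    ultimately show ?thesis by (intro exI[of _ "a(x0 := z)"] conjI)
  qed
qed

end

section \<open>The sum of the local dimensions\<close>

context coherent_values
begin

sublocale Q: valued_field \<rat> w
  by (rule w_valued)

lemma T_v: "v \<in> T \<Longrightarrow> x \<in> K \<Longrightarrow> 0 \<le> v x"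
  using T_valued valued_field.v_nonneg by blast

text \<open>The norm that makes \<open>K\<close> a subspace of the product of its completions at the places
  in \<open>T\<close>.\<close>

definition N :: "complex \<Rightarrow> real" where
  "N x = (\<Sum>v\<in>T. v x)"

lemma N_nonneg: "x \<in> K \<Longrightarrow> 0 \<le> N x"
  unfolding N_def by (intro sum_nonneg T_v)

lemma le_N: "v \<in> T \<Longrightarrow> x \<in> K \<Longrightarrow> v x \<le> N x"
  unfolding N_def using finite_T by (intro member_le_sum) (auto intro: T_v)

lemma N_add_le: "x \<in> K \<Longrightarrow> y \<in> K \<Longrightarrow> N (x + y) \<le> N x + N y"
  unfolding N_def sum.distrib[symmetric]
  by (intro sum_mono valued_field.v_add_le[OF T_valued])

lemma N_mult_Rats:
  assumes "q \<in> \<rat>" "x \<in> K" shows "N (q * x) = w q * N x"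
  unfolding N_def sum_distrib_left
  using assms valued_field.v_mult[OF T_valued, of _ q x] T_restrict[of _ q] Rats_mem
  by (intro sum.cong) auto

lemma N_minus: "x \<in> K \<Longrightarrow> N (- x) = N x"
  unfolding N_def using valued_field.v_minus[OF T_valued] by (intro sum.cong) auto

lemma N_diff_commute: "x \<in> K \<Longrightarrow> y \<in> K \<Longrightarrow> N (x - y) = N (y - x)"
  using N_minus[of "x - y"] by (simp add: diff_mem)

definition N_Cauchy :: "(nat \<Rightarrow> complex) \<Rightarrow> bool" where
  "N_Cauchy t \<longleftrightarrow> range t \<subseteq> K \<and> (\<forall>e>0. \<exists>M. \<forall>m\<ge>M. \<forall>n\<ge>M. N (t m - t n) < e)"

definition N_null :: "(nat \<Rightarrow> complex) \<Rightarrow> bool" where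
  "N_null t \<longleftrightarrow> range t \<subseteq> K \<and> (\<lambda>n. N (t n)) \<longlonglongrightarrow> 0"

lemma N_Cauchy_mem: "N_Cauchy t \<Longrightarrow> t n \<in> K"
  by (auto simp: N_Cauchy_def)

lemma N_null_mem: "N_null t \<Longrightarrow> t n \<in> K"
  by (auto simp: N_null_def)

lemma N_null_imp_Nul:
  assumes "N_null t" "v \<in> T" shows "t \<in> null_ideal K v"
proof -
  interpret v: valued_field K v using T_valued assms by auto
  show ?thesis
    using assms by (intro v.NulI[where b = "\<lambda>n. N (t n)"] le_N N_null_mem) (auto simp: N_null_def)
qed

lemma N_null_add:
  assumes "N_null s" "N_null t" shows "N_null (\<lambda>n. s n + t n)"
proof -
  have mem: "s n \<in> K" "t n \<in> K" for n using assms N_null_mem by auto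
  have lim: "(\<lambda>n. N (s n) + N (t n)) \<longlonglongrightarrow> 0"
    using tendsto_add[of "\<lambda>n. N (s n)" 0 _ "\<lambda>n. N (t n)" 0] assms by (auto simp: N_null_def)
  have "(\<lambda>n. N (s n + t n)) \<longlonglongrightarrow> 0"
    by (intro tendsto_sandwich[OF always_eventually always_eventually tendsto_const lim] allI
        N_nonneg N_add_le add_mem mem)
  thus ?thesis using mem by (auto simp: N_null_def)
qed

lemma N_null_sum: "(\<And>i. i \<in> A \<Longrightarrow> N_null (s i)) \<Longrightarrow> N_null (\<lambda>n. \<Sum>i\<in>A. s i n)"
proof (induction A rule: infinite_finite_induct)
  case (insert x F)
  thus ?case using N_null_add by simp
qed (auto simp: N_null_def N_def valued_field.v_0[OF T_valued])

lemma N_null_mult: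
  assumes "a \<in> Q.Cau" "N_null t" shows "N_null (\<lambda>n. a n * t n)"
proof -
  obtain B where B: "B > 0" "\<And>n. w (a n) \<le> B" using Q.Cau_bounded[OF assms(1)] by auto
  have mem: "a n \<in> \<rat>" "a n \<in> K" "t n \<in> K" for n
    using Q.Cau_mem[OF assms(1)] assms(2) N_null_mem Rats_mem by auto
  have lim: "(\<lambda>n. B * N (t n)) \<longlonglongrightarrow> 0"
    using tendsto_mult[OF tendsto_const[of B], of "\<lambda>n. N (t n)" 0] assms by (auto simp: N_null_def)
  have "N (a n * t n) \<le> B * N (t n)" for n
    using B mem N_nonneg by (auto simp: N_mult_Rats intro: mult_right_mono)
  hence "(\<lambda>n. N (a n * t n)) \<longlonglongrightarrow> 0"
    by (intro tendsto_sandwich[OF always_eventually always_eventually tendsto_const lim] allI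
        N_nonneg mult_mem mem)
  thus ?thesis using mem by (auto simp: N_null_def)
qed

lemma N_null_mult_const:
  assumes "a \<in> Q.Nul" "x \<in> K" shows "N_null (\<lambda>n. a n * x)"
proof -
  have "(\<lambda>n. w (a n) * N x) \<longlonglongrightarrow> 0"
    using tendsto_mult[OF _ tendsto_const[of "N x"], of "\<lambda>n. w (a n)" 0] assms by (auto simp: Q.Nul_iff)
  moreover have "a n \<in> \<rat>" for n using assms Q.Nul_mem by auto
  ultimately show ?thesis using assms Rats_mem by (auto simp: N_null_def N_mult_Rats)
qed

lemma N_Cauchy_diff_null:
  assumes "N_Cauchy t" "N_null (\<lambda>n. t n - s n)" "range s \<subseteq> K"
  shows "N_Cauchy s"
  unfolding N_Cauchy_def
proof (intro conjI allI impI assms(3))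
  fix e :: real assume e: "e > 0"
  obtain M where M: "\<forall>m\<ge>M. \<forall>n\<ge>M. N (t m - t n) < e/3"
    using assms(1) e unfolding N_Cauchy_def by (meson divide_pos_pos zero_less_numeral)
  have "\<forall>\<^sub>F n in sequentially. N (t n - s n) < e/3"
    using assms(2) e by (intro order_tendstoD) (auto simp: N_null_def)
  then obtain L where L: "\<And>n. n \<ge> L \<Longrightarrow> N (t n - s n) < e/3" by (auto simp: eventually_sequentially)
  have mem: "t n \<in> K" "s n \<in> K" for n using assms N_Cauchy_mem by auto
  have "N (s m - s n) < e" if "m \<ge> max M L" "n \<ge> max M L" for m n
  proof -
    have "N (s m - s n) = N ((s m - t m) + ((t m - t n) + (t n - s n)))" by simp
    also have "\<dots> \<le> N (s m - t m) + N ((t m - t n) + (t n - s n))"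
      by (intro N_add_le add_mem diff_mem mem)
    also have "N ((t m - t n) + (t n - s n)) \<le> N (t m - t n) + N (t n - s n)"
      by (intro N_add_le add_mem diff_mem mem)
    also have "N (s m - t m) = N (t m - s m)" using mem by (intro N_diff_commute) auto
    finally show ?thesis using L[of m] L[of n] M that by fastforce
  qed
  thus "\<exists>M. \<forall>m\<ge>M. \<forall>n\<ge>M. N (s m - s n) < e" by blast
qed

definition rat_span :: "(nat \<Rightarrow> complex) \<Rightarrow> nat \<Rightarrow> complex set" where
  "rat_span e D = {(\<Sum>k<D. q k * e k) | q. \<forall>k. q k \<in> \<rat>}"

lemma rat_spanI: "(\<And>k. q k \<in> \<rat>) \<Longrightarrow> (\<Sum>k<D. q k * e k) \<in> rat_span e D"
  by (auto simp: rat_span_def)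

lemma rat_spanE:
  assumes "x \<in> rat_span e D"
  obtains q where "\<And>k. q k \<in> \<rat>" "x = (\<Sum>k<D. q k * e k)"
  using assms by (auto simp: rat_span_def)

lemma rat_span_add: "x \<in> rat_span e D \<Longrightarrow> y \<in> rat_span e D \<Longrightarrow> x + y \<in> rat_span e D"
proof (elim rat_spanE)
  fix p q assume "\<And>k. p k \<in> \<rat>" "\<And>k. q k \<in> \<rat>" "x = (\<Sum>k<D. p k * e k)" "y = (\<Sum>k<D. q k * e k)"
  thus ?thesis using rat_spanI[of "\<lambda>k. p k + q k" e D] by (simp add: distrib_right sum.distrib)
qed

lemma rat_span_mult: "a \<in> \<rat> \<Longrightarrow> x \<in> rat_span e D \<Longrightarrow> a * x \<in> rat_span e D"
proof (elim rat_spanE)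
  fix q assume "\<And>k. q k \<in> \<rat>" "x = (\<Sum>k<D. q k * e k)" "a \<in> \<rat>"
  thus ?thesis using rat_spanI[of "\<lambda>k. a * q k" e D] by (simp add: sum_distrib_left mult.assoc)
qed

lemma rat_span_mem: "(\<And>k. e k \<in> K) \<Longrightarrow> x \<in> rat_span e D \<Longrightarrow> x \<in> K"
  by (elim rat_spanE) (auto intro!: sum_mem mult_mem intro: Rats_mem)

text \<open>A finite-dimensional subspace over a complete field is closed. Without completions: an
  \<open>N\<close>-Cauchy sequence in the rational span of the \<open>e k\<close> has asymptotic coordinates that are
  themselves Cauchy. If the last coordinate is not Cauchy, then a difference quotient exhibits
  the last vector as a limit of elements in the span of the others, so it can be dropped.\<close>

lemma asymptotic_coordinates:
  assumes e: "\<And>k. e k \<in> K" and t: "N_Cauchy t" "\<And>n. t n \<in> rat_span e D"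
  shows "\<exists>c. (\<forall>k<D. c k \<in> Q.Cau) \<and> N_null (\<lambda>n. t n - (\<Sum>k<D. c k n * e k))"
  using t
proof (induction D arbitrary: t)
  case 0
  hence "t = (\<lambda>n. 0)" by (auto simp: rat_span_def)
  thus ?case by (auto simp: N_null_def N_def valued_field.v_0[OF T_valued])
next
  case (Suc D)
  have tK: "t n \<in> K" for n using Suc.prems N_Cauchy_mem by auto
  have "\<exists>q. (\<forall>k. q k \<in> \<rat>) \<and> t n = (\<Sum>k<Suc D. q k * e k)" for n
    using Suc.prems(2)[of n] unfolding rat_span_def by blast
  then obtain q where q: "\<And>n k. q n k \<in> \<rat>" "\<And>n. t n = (\<Sum>k<D. q n k * e k) + q n D * e D"
    by (simp del: atLeastLessThan_iff) metis
  define p where "p n = (\<Sum>k<D. q n k * e k)" for n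
  have p: "p n \<in> rat_span e D" for n unfolding p_def using q by (intro rat_spanI) auto
  have pK: "p n \<in> K" for n using p e rat_span_mem by blast
  have t_eq: "t n = p n + q n D * e D" for n using q p_def by simp
  have qK: "q n k \<in> K" for n k using q Rats_mem by blast
  show ?case
  proof (cases "(\<lambda>n. q n D) \<in> Q.Cau")
    case True
    have "N_Cauchy p"
      unfolding N_Cauchy_def
    proof (intro conjI allI impI)
      show "range p \<subseteq> K" using pK by auto
      fix \<epsilon> :: real assume \<epsilon>: "\<epsilon> > 0"
      define B where "B = N (e D) + 1"
      have B: "B > 0" "N (e D) \<le> B" using N_nonneg[OF e, of D] by (auto simp: B_def)
      obtain M where M: "\<forall>m\<ge>M. \<forall>n\<ge>M. N (t m - t n) < \<epsilon>/2"
        using Suc.prems(1) \<epsilon> unfolding N_Cauchy_def by (meson half_gt_zero)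
      obtain L where L: "\<forall>m\<ge>L. \<forall>n\<ge>L. w (q m D - q n D) < \<epsilon>/(2*B)"
        using Q.CauD[OF True, of "\<epsilon>/(2*B)"] \<epsilon> B by auto
      have "N (p m - p n) < \<epsilon>" if mn: "m \<ge> max M L" "n \<ge> max M L" for m n
      proof -
        have "p m - p n = (t m - t n) + (q n D - q m D) * e D"
          by (simp add: t_eq algebra_simps)
        also have "N \<dots> \<le> N (t m - t n) + N ((q n D - q m D) * e D)"
          by (intro N_add_le diff_mem mult_mem tK qK e)
        also have "N ((q n D - q m D) * e D) = w (q n D - q m D) * N (e D)"
          using q e by (intro N_mult_Rats) auto
        also have "\<dots> \<le> \<epsilon>/(2*B) * B"
          using L mn B \<epsilon> q N_nonneg[OF e, of D] by (intro mult_mono) (auto simp: less_imp_le)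
        also have "N (t m - t n) < \<epsilon>/2" using M mn by auto
        finally show ?thesis using B by simp
      qed
      thus "\<exists>M. \<forall>m\<ge>M. \<forall>n\<ge>M. N (p m - p n) < \<epsilon>" by blast
    qed
    from Suc.IH[OF this p] obtain c where c: "\<forall>k<D. c k \<in> Q.Cau"
      "N_null (\<lambda>n. p n - (\<Sum>k<D. c k n * e k))" by blast
    have "(\<Sum>k<Suc D. (c(D := \<lambda>n. q n D)) k n * e k) = (\<Sum>k<D. c k n * e k) + q n D * e D" for n
      by simp
    hence "N_null (\<lambda>n. t n - (\<Sum>k<Suc D. (c(D := \<lambda>n. q n D)) k n * e k))"
      using c(2) by (simp only: t_eq) simp
    moreover have "\<forall>k<Suc D. (c(D := \<lambda>n. q n D)) k \<in> Q.Cau" using c(1) True by (simp add: less_Suc_eq)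
    ultimately show ?thesis by blast
  next
    case False
    then obtain \<epsilon> where \<epsilon>: "\<epsilon> > 0" "\<And>M. \<exists>m\<ge>M. \<exists>n\<ge>M. w (q m D - q n D) \<ge> \<epsilon>"
      using q by (auto simp: Q.Cau_iff not_less)
    \<comment> \<open>A difference of two late terms, divided by its last coordinate, is small and has last
      coordinate \<open>1\<close>.\<close>
    have approx: "\<exists>s\<in>rat_span e D. N (e D - s) < \<delta>" if \<delta>: "\<delta> > 0" for \<delta>
    proof -
      obtain M where M: "\<forall>m\<ge>M. \<forall>n\<ge>M. N (t m - t n) < \<delta> * \<epsilon>"
        using Suc.prems(1) \<epsilon>(1) \<delta> unfolding N_Cauchy_def by (meson mult_pos_pos)
      obtain m n where mn: "m \<ge> M" "n \<ge> M" "w (q m D - q n D) \<ge> \<epsilon>" using \<epsilon>(2) by blast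
      define r where "r = q m D - q n D"
      have r: "r \<in> \<rat>" "w r \<ge> \<epsilon>" using q mn by (auto simp: r_def)
      have r0: "r \<noteq> 0" using r(2) \<epsilon>(1) Q.v_0 by auto
      define s where "s = inverse r * (p n + (-1) * p m)"
      have s: "s \<in> rat_span e D"
        unfolding s_def using p r by (intro rat_span_mult rat_span_add Rats_inverse) auto
      have "e D - s = inverse r * (t m - t n)"
      proof -
        have "r * s = p n - p m" using r0 by (simp add: s_def)
        hence "r * (e D - s) = t m - t n" by (simp add: r_def t_eq algebra_simps)
        thus ?thesis using r0 by (simp add: field_simps)
      qed
      hence "N (e D - s) = w (inverse r) * N (t m - t n)"
        using r tK by (simp add: N_mult_Rats diff_mem)
      also have "\<dots> = N (t m - t n) / w r" using r by (simp add: Q.v_inverse divide_inverse)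
      also have "\<dots> \<le> N (t m - t n) / \<epsilon>"
        using r \<epsilon>(1) N_nonneg[OF diff_mem[OF tK tK]] by (intro divide_left_mono mult_pos_pos) auto
      also have "\<dots> < \<delta>" using M mn \<epsilon>(1) by (simp add: field_simps)
      finally show ?thesis using s by blast
    qed
    \<comment> \<open>The accuracy compensates for the possibly unbounded coordinates \<open>q n D\<close>.\<close>
    have "\<exists>s\<in>rat_span e D. N (e D - s) < 1 / (real (Suc n) * (1 + w (q n D)))" for n
      using Q.v_nonneg[OF q(1)[of n D]] by (intro approx) (auto intro!: divide_pos_pos mult_pos_pos)
    then obtain s where s: "\<And>n. s n \<in> rat_span e D"
      "\<And>n. N (e D - s n) < 1 / (real (Suc n) * (1 + w (q n D)))" by metis
    have sK: "s n \<in> K" for n using s e rat_span_mem by blast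
    define t' where "t' n = p n + q n D * s n" for n
    have t': "t' n \<in> rat_span e D" for n
      unfolding t'_def using p q s by (intro rat_span_add rat_span_mult)
    have t'K: "t' n \<in> K" for n using t' e rat_span_mem by blast
    have null: "N_null (\<lambda>n. t n - t' n)"
      unfolding N_null_def
    proof
      show "(\<lambda>n. N (t n - t' n)) \<longlonglongrightarrow> 0"
      proof (rule tendsto_sandwich[OF always_eventually always_eventually tendsto_const])
        show "(\<lambda>n. 1 / real (Suc n)) \<longlonglongrightarrow> 0" by real_asymp
        show "\<forall>n. N (t n - t' n) \<le> 1 / real (Suc n)"
        proof
          fix n
          have "t n - t' n = q n D * (e D - s n)" by (simp add: t_eq t'_def algebra_simps)
          hence "N (t n - t' n) = w (q n D) * N (e D - s n)"
            using q e sK by (simp add: N_mult_Rats diff_mem)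
          also have "\<dots> \<le> (1 + w (q n D)) * (1 / (real (Suc n) * (1 + w (q n D))))"
            using Q.v_nonneg[OF q(1)[of n D]] s(2)[of n] N_nonneg[OF diff_mem[OF e sK]]
            by (intro mult_mono) auto
          also have "\<dots> = 1 / real (Suc n)"
            using Q.v_nonneg[OF q(1)[of n D]] by (simp add: divide_simps)
          finally show "N (t n - t' n) \<le> 1 / real (Suc n)" .
        qed
        show "\<forall>n. 0 \<le> N (t n - t' n)" using tK t'K by (auto intro!: N_nonneg)
      qed
    qed (use tK t'K in auto)
    have "N_Cauchy t'" using N_Cauchy_diff_null[OF Suc.prems(1) null] t'K by auto
    from Suc.IH[OF this t'] obtain c where c: "\<forall>k<D. c k \<in> Q.Cau"
      "N_null (\<lambda>n. t' n - (\<Sum>k<D. c k n * e k))" by blast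
    have "(\<Sum>k<Suc D. (c(D := \<lambda>n. 0)) k n * e k) = (\<Sum>k<D. c k n * e k)" for n
      by simp
    hence "N_null (\<lambda>n. t n - (\<Sum>k<Suc D. (c(D := \<lambda>n. 0)) k n * e k))"
      using N_null_add[OF null c(2)] by simp
    moreover have "\<forall>k<Suc D. (c(D := \<lambda>n. 0)) k \<in> Q.Cau" using c(1) by (simp add: less_Suc_eq)
    ultimately show ?thesis by blast
  qed
qed

end

context coherent_values
begin

text \<open>Sequences that are independent modulo null sequences at the separate places can be moved by
  weak approximation to simultaneous Cauchy sequences in \<open>K\<close>, each of them close to the original
  one at its own place and close to \<open>0\<close> at the others. Their asymptotic coordinates are vectors of
  length \<open>D\<close>; more than \<open>D\<close> of them satisfy a relation, which descends to each single place.\<close>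

lemma sum_of_independent_families_le:
  assumes e: "\<And>k. e k \<in> K" and span: "K \<subseteq> rat_span e D"
    and b: "\<And>v j. v \<in> T \<Longrightarrow> j < m v \<Longrightarrow> b v j \<in> carrier (cauchy_ring K v)"
    and indep: "\<And>v a j. v \<in> T \<Longrightarrow> (\<And>j. j < m v \<Longrightarrow> a j \<in> Q.Cau) \<Longrightarrow>
       (\<lambda>n. \<Sum>j<m v. a j n * b v j n) \<in> null_ideal K v \<Longrightarrow> j < m v \<Longrightarrow> a j \<in> Q.Nul"
  shows "(\<Sum>v\<in>T. m v) \<le> D"
proof (rule ccontr)
  assume more: "\<not> (\<Sum>v\<in>T. m v) \<le> D"
  define I where "I = (SIGMA v:T. {..<m v})"
  have card: "finite I" "card I > D" using more finite_T by (auto simp: I_def)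
  have bK: "b v j n \<in> K" if "(v, j) \<in> I" for v j n
    using that valued_field.Cau_mem[OF T_valued b] by (auto simp: I_def)
  have "\<exists>y\<in>K. v (y - b v j n) < 1 / real (Suc n) \<and> (\<forall>u\<in>T - {v}. u y < 1 / real (Suc n))"
    if "(v, j) \<in> I" for v j n
    using that bK by (intro weak_approximation) (auto simp: I_def)
  hence "\<forall>v j n. \<exists>y. (v, j) \<in> I \<longrightarrow> y \<in> K \<and> v (y - b v j n) < 1 / real (Suc n) \<and>
      (\<forall>u\<in>T - {v}. u y < 1 / real (Suc n))"
    by blast
  then obtain y' where y': "\<And>v j n. (v, j) \<in> I \<Longrightarrow> y' v j n \<in> K \<and>
      v (y' v j n - b v j n) < 1 / real (Suc n) \<and> (\<forall>u\<in>T - {v}. u (y' v j n) < 1 / real (Suc n))"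
    by metis
  define y where "y x = y' (fst x) (snd x)" for x
  have y: "\<And>x n. x \<in> I \<Longrightarrow> y x n \<in> K"
      "\<And>x n. x \<in> I \<Longrightarrow> fst x (y x n - b (fst x) (snd x) n) < 1 / real (Suc n)"
      "\<And>x u n. x \<in> I \<Longrightarrow> u \<in> T \<Longrightarrow> u \<noteq> fst x \<Longrightarrow> u (y x n) < 1 / real (Suc n)"
    using y' by (auto simp: y_def)
  have lim: "(\<lambda>n. 1 / real (Suc n)) \<longlonglongrightarrow> 0" by real_asymp
  have near: "(\<lambda>n. y x n - b (fst x) (snd x) n) \<in> null_ideal K (fst x)" if x: "x \<in> I" for x
  proof -
    have "fst x \<in> T" using x by (auto simp: I_def)
    then interpret v: valued_field K "fst x" by (rule T_valued)
    show ?thesis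
      using y(1,2)[OF x] bK[of "fst x" "snd x"] x
      by (intro v.NulI[OF _ _ lim]) (auto intro!: diff_mem less_imp_le)
  qed
  have far: "y x \<in> null_ideal K u" if x: "x \<in> I" "u \<in> T" "u \<noteq> fst x" for x u
  proof -
    interpret u: valued_field K u using T_valued x by auto
    show ?thesis using y(1)[OF x(1)] y(3)[OF x] by (intro u.NulI[OF _ _ lim]) (auto intro: less_imp_le)
  qed
  have yC: "y x \<in> carrier (cauchy_ring K u)" if x: "x \<in> I" "u \<in> T" for x u
  proof -
    interpret u: valued_field K u using T_valued x by auto
    show ?thesis
    proof (cases "u = fst x")
      case True
      have "snd x < m u" using x(1) True by (auto simp: I_def)
      hence "b u (snd x) \<in> u.Cau" using b x(2) by blast
      moreover have "(\<lambda>n. y x n - b u (snd x) n) \<in> u.Nul"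
        using near[OF x(1)] unfolding True[symmetric] .
      ultimately show ?thesis by (rule u.Nul_cong_Cau)
    next
      case False
      thus ?thesis using far x u.Nul_imp_Cau by blast
    qed
  qed
  have "N_Cauchy (y x)" if x: "x \<in> I" for x
    unfolding N_Cauchy_def
  proof (intro conjI allI impI)
    fix \<epsilon> :: real assume \<epsilon>: "\<epsilon> > 0"
    define \<delta> where "\<delta> = \<epsilon> / (real (card T) + 1)"
    have \<delta>: "\<delta> > 0" using \<epsilon> by (simp add: \<delta>_def add_nonneg_pos)
    have "\<exists>M. \<forall>m\<ge>M. \<forall>n\<ge>M. u (y x m - y x n) < \<delta>" if "u \<in> T" for u
      using valued_field.CauD[OF T_valued[OF that] yC[OF x that] \<delta>] .
    then obtain M where M: "\<And>u m n. u \<in> T \<Longrightarrow> m \<ge> M u \<Longrightarrow> n \<ge> M u \<Longrightarrow> u (y x m - y x n) < \<delta>"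
      by metis
    have "N (y x m - y x n) < \<epsilon>" if mn: "m \<ge> Max (insert 0 (M ` T))" "n \<ge> Max (insert 0 (M ` T))" for m n
    proof -
      have "N (y x m - y x n) \<le> (\<Sum>u\<in>T. \<delta>)"
        unfolding N_def using finite_T mn by (intro sum_mono less_imp_le[OF M]) auto
      also have "\<dots> = real (card T) * \<delta>" by simp
      also have "\<dots> < (real (card T) + 1) * \<delta>" using \<delta> by simp
      also have "\<dots> = \<epsilon>" by (simp add: \<delta>_def add_nonneg_eq_0_iff)
      finally show ?thesis .
    qed
    thus "\<exists>M. \<forall>m\<ge>M. \<forall>n\<ge>M. N (y x m - y x n) < \<epsilon>" by blast
  qed (use y(1)[OF x] in auto)
  hence ex: "\<exists>c. (\<forall>k<D. c k \<in> Q.Cau) \<and> N_null (\<lambda>n. y x n - (\<Sum>k<D. c k n * e k))" if x: "x \<in> I" for x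
    using x by (intro asymptotic_coordinates e) (use y(1)[OF x] span in blast)+
  define c where "c x = (SOME c. (\<forall>k<D. c k \<in> Q.Cau) \<and> N_null (\<lambda>n. y x n - (\<Sum>k<D. c k n * e k)))" for x
  have c: "c x k \<in> Q.Cau" if "x \<in> I" "k < D" for x k
    using someI_ex[OF ex[OF that(1)]] that(2) unfolding c_def by blast
  have c_null: "N_null (\<lambda>n. y x n - (\<Sum>k<D. c x k n * e k))" if "x \<in> I" for x
    using someI_ex[OF ex[OF that]] unfolding c_def by blast
  have "\<exists>a. (\<forall>x\<in>I. a x \<in> Q.Cau) \<and> (\<exists>x\<in>I. a x \<notin> Q.Nul) \<and>
      (\<forall>k<D. (\<lambda>n. \<Sum>x\<in>I. a x n * c x k n) \<in> Q.Nul)"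
    by (rule Q.nontrivial_relation[OF card c])
  then obtain a where a: "\<And>x. x \<in> I \<Longrightarrow> a x \<in> Q.Cau" "\<exists>x\<in>I. a x \<notin> Q.Nul"
      "\<And>k. k < D \<Longrightarrow> (\<lambda>n. \<Sum>x\<in>I. a x n * c x k n) \<in> Q.Nul"
    by blast
  have aK: "a x n \<in> K" if "x \<in> I" for x n using Q.Cau_mem[OF a(1)[OF that]] Rats_mem by auto
  have "N_null (\<lambda>n. (\<Sum>x\<in>I. a x n * (y x n - (\<Sum>k<D. c x k n * e k))) +
                    (\<Sum>k<D. (\<Sum>x\<in>I. a x n * c x k n) * e k))"
    by (intro N_null_add N_null_sum N_null_mult N_null_mult_const a(1,3) c_null e) auto
  moreover have "(\<Sum>x\<in>I. a x n * (y x n - (\<Sum>k<D. c x k n * e k))) +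
      (\<Sum>k<D. (\<Sum>x\<in>I. a x n * c x k n) * e k) = (\<Sum>x\<in>I. a x n * y x n)" for n
  proof -
    have "(\<Sum>k<D. (\<Sum>x\<in>I. a x n * c x k n) * e k) = (\<Sum>x\<in>I. a x n * (\<Sum>k<D. c x k n * e k))"
      unfolding sum_distrib_left sum_distrib_right by (subst sum.swap) (simp add: mult.assoc)
    thus ?thesis by (simp add: right_diff_distrib sum_subtractf)
  qed
  ultimately have rel: "N_null (\<lambda>n. \<Sum>x\<in>I. a x n * y x n)" by simp
  have "a (v, j) \<in> Q.Nul" if v: "v \<in> T" and j: "j < m v" for v j
  proof -
    interpret v: valued_field K v using T_valued v .
    have aC: "a x \<in> v.Cau" if "x \<in> I" for x
    proof -
      have "v (a x m - a x n) = w (a x m - a x n)" for m n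
        using Q.Cau_mem[OF a(1)[OF that]] by (intro T_restrict[OF v]) auto
      thus ?thesis using a(1)[OF that] Rats_mem by (auto simp: v.Cau_iff Q.Cau_iff)
    qed
    have inI: "(v, j) \<in> I" if "j < m v" for j using that v by (auto simp: I_def)
    have split: "I = Pair v ` {..<m v} \<union> {x\<in>I. fst x \<noteq> v}" using v by (auto simp: I_def)
    have "(\<Sum>x\<in>I. a x n * y x n) =
        (\<Sum>j<m v. a (v, j) n * y (v, j) n) + (\<Sum>x\<in>{x\<in>I. fst x \<noteq> v}. a x n * y x n)" for n
      by (subst split, subst sum.union_disjoint) (use card in \<open>auto simp: sum.reindex inj_on_def\<close>)
    hence "(\<Sum>j<m v. a (v, j) n * b v j n) = (\<Sum>x\<in>I. a x n * y x n)
       - (\<Sum>x\<in>{x\<in>I. fst x \<noteq> v}. a x n * y x n) - (\<Sum>j<m v. a (v, j) n * (y (v, j) n - b v j n))" for n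
      by (simp add: right_diff_distrib sum_subtractf)
    moreover have "(\<lambda>n. \<Sum>x\<in>{x\<in>I. fst x \<noteq> v}. a x n * y x n) \<in> v.Nul"
      by (intro v.Nul_sum v.Nul_mult aC far v) auto
    moreover have "(\<lambda>n. \<Sum>j<m v. a (v, j) n * (y (v, j) n - b v j n)) \<in> v.Nul"
    proof (intro v.Nul_sum v.Nul_mult aC inI)
      fix j assume "j \<in> {..<m v}"
      thus "(\<lambda>n. y (v, j) n - b v j n) \<in> v.Nul" using near[OF inI, of j] by simp
    qed auto
    ultimately have "(\<lambda>n. \<Sum>j<m v. a (v, j) n * b v j n) \<in> v.Nul"
      using v.Nul_diff[OF v.Nul_diff[OF N_null_imp_Nul[OF rel v]]] by simp
    thus ?thesis using indep[OF v, of "\<lambda>j. a (v, j)"] a(1) inI j by auto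
  qed
  thus False using a(2) by (auto simp: I_def)
qed

end

section \<open>The completion as a vector space\<close>

locale completed_field = valued_field K v for K v
begin

abbreviation "CR \<equiv> cauchy_ring K v"
abbreviation "Kv \<equiv> completion K v"

lemma CR_simps [simp]:
  "s \<otimes>\<^bsub>CR\<^esub> t = (\<lambda>n. s n * t n)" "s \<oplus>\<^bsub>CR\<^esub> t = (\<lambda>n. s n + t n)"
  "\<one>\<^bsub>CR\<^esub> = (\<lambda>n. 1)" "\<zero>\<^bsub>CR\<^esub> = (\<lambda>n. 0)"
  by (simp_all add: cauchy_ring_def)

lemma cring_CR: "cring CR"
proof (rule cringI)
  show "abelian_group CR"
  proof (rule abelian_groupI)
    fix s assume "s \<in> Cau"
    thus "\<exists>t\<in>Cau. t \<oplus>\<^bsub>CR\<^esub> s = \<zero>\<^bsub>CR\<^esub>" using Cau_uminus[of s] by (intro bexI[of _ "\<lambda>n. - s n"]) auto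
  qed (auto intro: Cau_add simp: algebra_simps)
  show "Group.comm_monoid CR"
    by (rule comm_monoidI) (auto intro: Cau_mult simp: algebra_simps)
qed (auto simp: algebra_simps)

sublocale CR: cring CR
  by (rule cring_CR)

lemma Nul_mult_right: "t \<in> Nul \<Longrightarrow> s \<in> Cau \<Longrightarrow> (\<lambda>n. t n * s n) \<in> Nul"
  using Nul_mult[of s t] by (subst mult.commute)

lemma ideal_Nul: "ideal Nul CR"
proof (rule idealI)
  show "ring CR" by (rule CR.ring_axioms)
  have minus: "\<exists>t\<in>Nul. (\<lambda>n. t n + s n) = (\<lambda>n. 0)" if "s \<in> Nul" for s
    using Nul_uminus[OF that] by (intro bexI[of _ "\<lambda>n. - s n"]) auto
  show "subgroup Nul (add_monoid CR)"
  proof (rule CR.add.subgroupI)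
    show "Nul \<noteq> {}" using Nul_zero by blast
    fix s assume s: "s \<in> Nul"
    have "\<ominus>\<^bsub>CR\<^esub> s = (\<lambda>n. - s n)"
      using s Nul_imp_Cau Cau_uminus by (intro CR.minus_equality) auto
    thus "\<ominus>\<^bsub>CR\<^esub> s \<in> Nul" using Nul_uminus[OF s] by simp
  qed (auto intro: Nul_imp_Cau Nul_add)
qed (auto intro: Nul_mult Nul_mult_right)

sublocale Nul: ideal Nul CR
  by (rule ideal_Nul)

sublocale Kv: cring Kv
  unfolding completion_def by (rule Nul.quotient_is_cring[OF cring_CR])

definition proj :: "(nat \<Rightarrow> complex) \<Rightarrow> (nat \<Rightarrow> complex) set" where
  "proj s = Nul +>\<^bsub>CR\<^esub> s"

lemma proj_hom: "proj \<in> Ring.ring_hom CR Kv"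
  using Nul.rcos_ring_hom unfolding completion_def proj_def[abs_def] .

lemma proj_closed [simp]: "s \<in> Cau \<Longrightarrow> proj s \<in> carrier Kv"
  and proj_mult: "s \<in> Cau \<Longrightarrow> t \<in> Cau \<Longrightarrow> proj (\<lambda>n. s n * t n) = proj s \<otimes>\<^bsub>Kv\<^esub> proj t"
  and proj_add: "s \<in> Cau \<Longrightarrow> t \<in> Cau \<Longrightarrow> proj (\<lambda>n. s n + t n) = proj s \<oplus>\<^bsub>Kv\<^esub> proj t"
  and proj_one: "proj (\<lambda>n. 1) = \<one>\<^bsub>Kv\<^esub>"
  using ring_hom_memE[OF proj_hom] by auto

lemma proj_eq_zero_iff: "s \<in> Cau \<Longrightarrow> proj s = \<zero>\<^bsub>Kv\<^esub> \<longleftrightarrow> s \<in> Nul"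
  using Nul.rcos_const_imp_mem[of s] Nul.a_rcos_const[of s]
  by (auto simp: proj_def completion_def FactRing_def)

lemma carrier_Kv: "carrier Kv = proj ` Cau"
  by (auto simp: completion_def FactRing_def A_RCOSETS_def' proj_def)

lemma proj_uminus: "s \<in> Cau \<Longrightarrow> proj (\<lambda>n. - s n) = \<ominus>\<^bsub>Kv\<^esub> proj s"
  using proj_add[OF Cau_uminus[of s], of s] proj_eq_zero_iff[of "\<lambda>n. 0"] Cau_uminus[of s]
  by (intro Kv.minus_equality[symmetric]) auto

lemma proj_eq_iff:
  assumes "s \<in> Cau" "t \<in> Cau"
  shows "proj s = proj t \<longleftrightarrow> (\<lambda>n. s n - t n) \<in> Nul"
proof -
  have "proj (\<lambda>n. s n - t n) = proj s \<ominus>\<^bsub>Kv\<^esub> proj t"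
    using proj_add[OF assms(1) Cau_uminus[OF assms(2)]] assms
    by (simp add: proj_uminus a_minus_def)
  thus ?thesis
    using proj_eq_zero_iff[OF Cau_diff[OF assms]] assms by simp
qed

end

lemma (in valued_field) valued_field_Rats: "valued_field \<rat> v"
  using abs_val Rats_mem
  by unfold_locales (auto simp: absolute_value_on_def subset_iff)

context completed_field
begin

sublocale Qv: valued_field \<rat> v
  by (rule valued_field_Rats)

lemma Qv_Cau_iff: "s \<in> Qv.Cau \<longleftrightarrow> s \<in> Cau \<and> range s \<subseteq> \<rat>"
  using Rats_mem by (auto simp: Cau_iff Qv.Cau_iff)

lemma Qv_Nul_iff: "s \<in> Qv.Nul \<longleftrightarrow> s \<in> Nul \<and> range s \<subseteq> \<rat>"
  using Rats_mem by (auto simp: Nul_iff Qv.Nul_iff)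

abbreviation "Qc \<equiv> rat_completion K v"

lemma rat_completion_eq: "Qc = proj ` Qv.Cau"
  by (auto simp: rat_completion_def proj_def Qv_Cau_iff)

text \<open>Closure under inverses holds because the termwise inverse of a rational Cauchy sequence that
  is not null is again a rational Cauchy sequence.\<close>

lemma subfield_rat_completion: "subfield Qc Kv"
proof (rule Kv.subfieldI)
  have "subring Qc Kv"
  proof (rule Kv.subringI)
    show "Qc \<subseteq> carrier Kv" by (auto simp: rat_completion_eq Qv_Cau_iff)
    show "\<one>\<^bsub>Kv\<^esub> \<in> Qc"
      unfolding rat_completion_eq proj_one[symmetric] by (intro imageI Qv.Cau_const) auto
    fix x assume "x \<in> Qc"
    then obtain s where s: "s \<in> Qv.Cau" "x = proj s" by (auto simp: rat_completion_eq)
    thus "\<ominus>\<^bsub>Kv\<^esub> x \<in> Qc"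
      using proj_uminus[of s] Qv.Cau_uminus[OF s(1)] by (auto simp: rat_completion_eq Qv_Cau_iff)
    fix y assume "y \<in> Qc"
    then obtain t where t: "t \<in> Qv.Cau" "y = proj t" by (auto simp: rat_completion_eq)
    have st: "s \<in> Cau" "t \<in> Cau" using s t by (auto simp: Qv_Cau_iff)
    show "x \<otimes>\<^bsub>Kv\<^esub> y \<in> Qc"
      unfolding rat_completion_eq s t proj_mult[OF st, symmetric] using s t by (intro imageI Qv.Cau_mult)
    show "x \<oplus>\<^bsub>Kv\<^esub> y \<in> Qc"
      unfolding rat_completion_eq s t proj_add[OF st, symmetric] using s t by (intro imageI Qv.Cau_add)
  qed
  thus "subcring Qc Kv" by (rule Kv.subcringI')
  show "Units (Kv\<lparr>carrier := Qc\<rparr>) = Qc - {\<zero>\<^bsub>Kv\<^esub>}"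
  proof
    have "\<one>\<^bsub>Kv\<^esub> \<noteq> \<zero>\<^bsub>Kv\<^esub>"
      using one_notin_Nul proj_eq_zero_iff[OF Cau_const[OF one_mem]] by (simp add: proj_one)
    thus "Units (Kv\<lparr>carrier := Qc\<rparr>) \<subseteq> Qc - {\<zero>\<^bsub>Kv\<^esub>}"
      using \<open>subring Qc Kv\<close> subringE(1) by (fastforce simp: Units_def)
    show "Qc - {\<zero>\<^bsub>Kv\<^esub>} \<subseteq> Units (Kv\<lparr>carrier := Qc\<rparr>)"
    proof
      fix x assume x: "x \<in> Qc - {\<zero>\<^bsub>Kv\<^esub>}"
      then obtain s where s: "s \<in> Qv.Cau" "x = proj s" by (auto simp: rat_completion_eq)
      have "s \<notin> Qv.Nul" using x s proj_eq_zero_iff[of s] by (auto simp: Qv_Nul_iff Qv_Cau_iff)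
      then obtain u where u: "u \<in> Qv.Cau" "(\<lambda>n. u n * s n - 1) \<in> Qv.Nul"
        using Qv.Cau_inverse[OF s(1)] by auto
      have us: "u \<in> Cau" "s \<in> Cau" using u s by (auto simp: Qv_Cau_iff)
      have "proj (\<lambda>n. u n * s n) = proj (\<lambda>n. 1)"
        using u(2) us by (subst proj_eq_iff) (auto intro: Cau_mult simp: Qv_Nul_iff)
      hence "proj u \<otimes>\<^bsub>Kv\<^esub> x = \<one>\<^bsub>Kv\<^esub>" using us s by (simp add: proj_mult proj_one)
      moreover have "x \<otimes>\<^bsub>Kv\<^esub> proj u = proj u \<otimes>\<^bsub>Kv\<^esub> x" using us s by (intro Kv.m_comm) auto
      moreover have "proj u \<in> Qc" using u by (auto simp: rat_completion_eq)
      ultimately show "x \<in> Units (Kv\<lparr>carrier := Qc\<rparr>)" using x by (auto simp: Units_def)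
    qed
  qed
qed

lemma combine_proj:
  assumes "length as = length bs" "set as \<subseteq> Cau" "set bs \<subseteq> Cau"
  shows "Kv.combine (map proj as) (map proj bs) = proj (\<lambda>n. \<Sum>j<length bs. (as ! j) n * (bs ! j) n)"
  using assms
proof (induction as bs rule: list_induct2)
  case Nil
  have "proj (\<lambda>n. 0) = \<zero>\<^bsub>Kv\<^esub>" by (subst proj_eq_zero_iff) auto
  thus ?case by simp
next
  case (Cons a as b bs)
  have ab: "a \<in> Cau" "b \<in> Cau" and mem: "as ! j \<in> Cau" "bs ! j \<in> Cau" if "j < length bs" for j
    using Cons that by (auto simp: subset_iff)
  have "(\<lambda>n. \<Sum>j<length bs. (as ! j) n * (bs ! j) n) \<in> Cau"
    using mem by (intro Cau_sum Cau_mult) auto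
  moreover have "a \<in> Cau" "b \<in> Cau" using Cons by auto
  ultimately show ?case
    using Cons by (simp add: sum.lessThan_Suc_shift proj_add Cau_mult proj_mult del: sum.lessThan_Suc)
qed

end

text \<open>A basis of the completion over the closure of \<open>\<rat>\<close>, represented by Cauchy sequences. The
  completion is finite-dimensional since the elements \<open>e k\<close> still span it.\<close>

lemma (in completed_field) local_basis:
  fixes e :: "nat \<Rightarrow> complex" and D :: nat
  assumes nontriv: "q0 \<in> \<rat>" "v q0 > 1"
    and e: "\<And>k. e k \<in> K" and span: "\<And>x. x \<in> K \<Longrightarrow> \<exists>q. (\<forall>k. q k \<in> \<rat>) \<and> x = (\<Sum>k<D. q k * e k)"
  shows "\<exists>b. (\<forall>j<local_degree K v. b j \<in> Cau) \<and>
     (\<forall>a. (\<forall>j<local_degree K v. a j \<in> Qv.Cau) \<longrightarrow>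
          (\<lambda>n. \<Sum>j<local_degree K v. a j n * b j n) \<in> Nul \<longrightarrow>
          (\<forall>j<local_degree K v. a j \<in> Qv.Nul))"
proof -
  interpret S: coherent_values K v q0 "{v}"
    by unfold_locales (use nontriv valued_field_axioms Qv.valued_field_axioms Qv.abs_val abs_val in auto)
  define es where "es = map (\<lambda>k. proj (\<lambda>n. e k)) [0..<D]"
  have es: "set es \<subseteq> carrier Kv" using e by (auto simp: es_def)
  have "carrier Kv \<subseteq> Kv.Span Qc es"
  proof
    fix x assume "x \<in> carrier Kv"
    then obtain t where t: "t \<in> Cau" "x = proj t" by (auto simp: carrier_Kv)
    have "S.N_Cauchy t" using t(1) by (auto simp: S.N_Cauchy_def S.N_def Cau_iff)
    moreover have "t n \<in> S.rat_span e D" for n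
      using span[OF Cau_mem[OF t(1)], of n] by (auto simp: S.rat_span_def)
    ultimately have "\<exists>c. (\<forall>k<D. c k \<in> Qv.Cau) \<and> S.N_null (\<lambda>n. t n - (\<Sum>k<D. c k n * e k))"
      by (rule S.asymptotic_coordinates[OF e])
    then obtain c where c: "\<forall>k<D. c k \<in> Qv.Cau"
        "S.N_null (\<lambda>n. t n - (\<Sum>k<D. c k n * e k))" by blast
    define cs where "cs = map c [0..<D]"
    have cs: "set cs \<subseteq> Qv.Cau" using c(1) by (auto simp: cs_def)
    have cC: "c k \<in> Cau" if "k < D" for k using c(1) that by (auto simp: Qv_Cau_iff)
    have sC: "(\<lambda>n. \<Sum>k<D. c k n * e k) \<in> Cau"
      using cC e by (intro Cau_sum Cau_mult Cau_const) auto
    have "(\<lambda>n. t n - (\<Sum>k<D. c k n * e k)) \<in> Nul"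
      using S.N_null_imp_Nul[OF c(2)] by simp
    hence "x = proj (\<lambda>n. \<Sum>k<D. c k n * e k)"
      using t sC by (simp add: proj_eq_iff)
    also have "\<dots> = Kv.combine (map proj cs) (map proj (map (\<lambda>k n. e k) [0..<D]))"
      using cC e by (subst combine_proj) (auto simp: cs_def intro!: arg_cong[where f = proj] sum.cong)
    also have "map proj (map (\<lambda>k n. e k) [0..<D]) = es" by (simp add: es_def)
    finally have "x = Kv.combine (map proj cs) es" .
    moreover have "set (map proj cs) \<subseteq> Qc" using cs by (auto simp: rat_completion_eq)
    ultimately show "x \<in> Kv.Span Qc es"
      unfolding Kv.Span_eq_combine_set[OF subfield_rat_completion es] by blast
  qed
  moreover have "Kv.Span Qc es \<subseteq> carrier Kv"
    using Kv.Span_in_carrier[OF subringE(1)[OF subfieldE(1)[OF subfield_rat_completion]] es] .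
  ultimately have "Kv.Span Qc es = carrier Kv" by auto
  hence "Kv.finite_dimension Qc (carrier Kv)"
    using Kv.Span_finite_dimension[OF subfield_rat_completion es] by simp
  hence "Kv.dimension (local_degree K v) Qc (carrier Kv)"
    using Kv.finite_dimensionE[OF subfield_rat_completion] by (simp add: local_degree_def over_def)
  then obtain Vs where Vs: "set Vs \<subseteq> carrier Kv" "Kv.independent Qc Vs" "length Vs = local_degree K v"
    using Kv.exists_base[OF subfield_rat_completion] by blast
  have "\<forall>x\<in>set Vs. \<exists>s\<in>Cau. x = proj s" using Vs(1) by (auto simp: carrier_Kv)
  then obtain r where r: "\<And>x. x \<in> set Vs \<Longrightarrow> r x \<in> Cau \<and> x = proj (r x)" by metis
  define b where "b j = r (Vs ! j)" for j
  have b: "b j \<in> Cau" "Vs ! j = proj (b j)" if "j < local_degree K v" for j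
    using r[of "Vs ! j"] that Vs(3) by (auto simp: b_def)
  have "a j \<in> Qv.Nul"
    if a: "\<forall>j<local_degree K v. a j \<in> Qv.Cau"
      and z: "(\<lambda>n. \<Sum>j<local_degree K v. a j n * b j n) \<in> Nul" and j: "j < local_degree K v" for a j
  proof -
    let ?as = "map a [0..<local_degree K v]" and ?bs = "map b [0..<local_degree K v]"
    have aC: "a j \<in> Cau" if "j < local_degree K v" for j using a that by (auto simp: Qv_Cau_iff)
    have "Vs = map proj ?bs" using Vs(3) b by (intro nth_equalityI) auto
    hence "Kv.combine (map proj ?as) Vs = Kv.combine (map proj ?as) (map proj ?bs)" by simp
    also have "\<dots> = proj (\<lambda>n. \<Sum>j<local_degree K v. a j n * b j n)"
      using aC b by (subst combine_proj) (auto intro!: arg_cong[where f = proj] sum.cong)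
    also have "\<dots> = \<zero>\<^bsub>Kv\<^esub>"
      using z Nul_imp_Cau[OF z] by (simp add: proj_eq_zero_iff)
    finally have "set (take (length Vs) (map proj ?as)) \<subseteq> {\<zero>\<^bsub>Kv\<^esub>}"
      using a by (intro Kv.independent_imp_trivial_combine[OF subfield_rat_completion Vs(2)])
        (auto simp: rat_completion_eq)
    moreover have "proj (a j) \<in> set (take (length Vs) (map proj ?as))" using j Vs(3) by simp
    ultimately have "proj (a j) = \<zero>\<^bsub>Kv\<^esub>" by blast
    thus ?thesis using aC[OF j] a j by (auto simp: proj_eq_zero_iff Qv_Nul_iff Qv_Cau_iff)
  qed
  thus ?thesis using b by blast
qed

text \<open>One half of the formula for the sum of the local degrees. The absolute values \<open>v\<close> and \<open>w\<close>
  agree on \<open>\<rat>\<close>, so the coefficients of the local bases live in the same ring of Cauchy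
  sequences for all places.\<close>

theorem (in coherent_values) sum_local_degree_le:
  fixes e :: "nat \<Rightarrow> complex" and D :: nat
  assumes e: "\<And>k. e k \<in> K" and span: "\<And>x. x \<in> K \<Longrightarrow> \<exists>q. (\<forall>k. q k \<in> \<rat>) \<and> x = (\<Sum>k<D. q k * e k)"
  shows "(\<Sum>v\<in>T. local_degree K v) \<le> D"
proof -
  have same: "carrier (cauchy_ring \<rat> v) = Q.Cau" "null_ideal \<rat> v = Q.Nul" if v: "v \<in> T" for v
  proof -
    interpret v: completed_field K v using T_valued[OF v] by (rule completed_field.intro)
    have "v (s m - s n) = w (s m - s n)" "v (s m) = w (s m)" if "range s \<subseteq> \<rat>" for s m n
      using that by (auto intro!: T_restrict[OF v] Rats_diff)
    note agree = this
    have "s \<in> v.Qv.Cau \<longleftrightarrow> s \<in> Q.Cau" "s \<in> v.Qv.Nul \<longleftrightarrow> s \<in> Q.Nul" for s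
      using agree[of s] by (cases "range s \<subseteq> \<rat>"; simp add: v.Qv.Cau_iff Q.Cau_iff null_ideal_def)+
    thus "carrier (cauchy_ring \<rat> v) = Q.Cau" "null_ideal \<rat> v = Q.Nul" by blast+
  qed
  define P where "P v b \<longleftrightarrow> (\<forall>j<local_degree K v. b j \<in> carrier (cauchy_ring K v)) \<and>
     (\<forall>a. (\<forall>j<local_degree K v. a j \<in> Q.Cau) \<longrightarrow>
          (\<lambda>n. \<Sum>j<local_degree K v. a j n * b j n) \<in> null_ideal K v \<longrightarrow>
          (\<forall>j<local_degree K v. a j \<in> Q.Nul))" for v b
  have "\<exists>b. P v b" if v: "v \<in> T" for v
  proof -
    interpret v: completed_field K v using T_valued[OF v] by (rule completed_field.intro)
    show ?thesis
      using v.local_basis[OF nontrivial(1) _ e span] nontrivial T_restrict[OF v]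
      unfolding same[OF v] P_def by simp
  qed
  then obtain b where b: "P v (b v)" if "v \<in> T" for v by metis
  show ?thesis
  proof (rule sum_of_independent_families_le[of e D "local_degree K" b])
    show "K \<subseteq> rat_span e D" using span unfolding rat_span_def by fast
  qed (use e b in \<open>unfold P_def, blast+\<close>)
qed

section \<open>Number fields\<close>

interpretation CF: cring complex_ring
  by (rule cring_from_type_algebra)

lemma complex_ring_simps [simp]:
  "carrier complex_ring = UNIV" "x \<otimes>\<^bsub>complex_ring\<^esub> y = x * y" "x \<oplus>\<^bsub>complex_ring\<^esub> y = x + y"
  "\<one>\<^bsub>complex_ring\<^esub> = 1" "\<zero>\<^bsub>complex_ring\<^esub> = 0"
  by (simp_all add: ring_of_type_algebra_def)

lemma complex_ring_uminus [simp]: "\<ominus>\<^bsub>complex_ring\<^esub> x = - x"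
  by (rule CF.minus_equality) auto

lemma subfield_imp_complex_subfield:
  assumes "subfield K complex_ring" shows "complex_subfield K"
proof
  note E = subringE[OF subfieldE(1)[OF assms]]
  show "0 \<in> K" "1 \<in> K" using E(2,3) by simp_all
  fix x y assume xy: "x \<in> K" "y \<in> K"
  show "x + y \<in> K" "x * y \<in> K" using E(6,7)[OF xy] by simp_all
next
  fix x assume x: "x \<in> K"
  show "- x \<in> K" using subringE(5)[OF subfieldE(1)[OF assms] x] by simp
  show "inverse x \<in> K"
  proof (cases "x = 0")
    case False
    hence "x \<in> Units (complex_ring\<lparr>carrier := K\<rparr>)"
      using x assms by (simp add: subfield_def subfield_axioms_def)
    then obtain y where "y \<in> K" "x * y = 1" by (auto simp: Units_def)
    thus ?thesis by (metis inverse_unique)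
  qed (use x in auto)
qed

lemma subfield_Rats: "subfield \<rat> complex_ring"
proof (rule field.subfieldI'[OF field_from_type_algebra])
  show "subring \<rat> complex_ring" by (rule CF.subringI) auto
  fix k :: complex assume k: "k \<in> \<rat> - {\<zero>\<^bsub>complex_ring\<^esub>}"
  have "inv\<^bsub>complex_ring\<^esub> k = inverse k"
    using k by (intro CF.comm_inv_char) auto
  thus "inv\<^bsub>complex_ring\<^esub> k \<in> \<rat>" using k by auto
qed

lemma combine_complex_ring:
  "length as = length bs \<Longrightarrow> CF.combine as bs = (\<Sum>j<length bs. as ! j * bs ! j)"
  by (induction as bs rule: list_induct2)
    (simp_all add: sum.lessThan_Suc_shift del: sum.lessThan_Suc)

lemma number_field_basis:
  assumes "number_field K"
  obtains e :: "nat \<Rightarrow> complex" where "\<And>k. e k \<in> K"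
    "\<And>x. x \<in> K \<Longrightarrow> \<exists>q. (\<forall>k. q k \<in> \<rat>) \<and> x = (\<Sum>k<field_degree K. q k * e k)"
proof -
  have K: "subfield K complex_ring" "CF.finite_dimension \<rat> K"
    using assms by (auto simp: number_field_def)
  interpret complex_subfield K by (rule subfield_imp_complex_subfield[OF K(1)])
  have "CF.dimension (field_degree K) \<rat> K"
    using CF.finite_dimensionE[OF subfield_Rats K(2)] by (simp add: field_degree_def over_def)
  then obtain Vs where Vs: "length Vs = field_degree K" "CF.Span \<rat> Vs = K"
    using CF.exists_base[OF subfield_Rats] by blast
  define e where "e k = (if k < length Vs then Vs ! k else 0)" for k
  have "set Vs \<subseteq> K" using CF.Span_base_incl[OF subfield_Rats, of Vs] Vs(2) by simp
  hence "e k \<in> K" for k by (auto simp: e_def)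
  moreover have "\<exists>q. (\<forall>k. q k \<in> \<rat>) \<and> x = (\<Sum>k<field_degree K. q k * e k)" if "x \<in> K" for x
  proof -
    have "set Vs \<subseteq> carrier complex_ring" by simp
    hence "x \<in> CF.Span \<rat> Vs \<longleftrightarrow> (\<exists>Ks. set Ks \<subseteq> \<rat> \<and> length Ks = length Vs \<and> x = CF.combine Ks Vs)"
      by (rule CF.Span_mem_iff_length_version[OF subfield_Rats])
    hence "\<exists>Ks. set Ks \<subseteq> \<rat> \<and> length Ks = length Vs \<and> x = CF.combine Ks Vs"
      using that unfolding Vs(2) by (rule iffD1)
    then obtain Ks where Ks: "set Ks \<subseteq> \<rat>" "length Ks = length Vs" "x = CF.combine Ks Vs"
      by (elim exE conjE)
    define q where "q k = (if k < length Vs then Ks ! k else 0)" for k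
    have "\<forall>k. q k \<in> \<rat>" using Ks(1,2) nth_mem by (fastforce simp: q_def)
    moreover have "x = (\<Sum>k<field_degree K. q k * e k)"
      using Ks(2,3) Vs(1) by (simp add: combine_complex_ring q_def e_def)
    ultimately show ?thesis by blast
  qed
  ultimately show ?thesis using that by blast
qed

lemma place_valued_field:
  assumes "number_field K" "v \<in> places K" shows "valued_field K v"
proof -
  interpret complex_subfield K
    using assms(1) by (intro subfield_imp_complex_subfield) (auto simp: number_field_def)
  show ?thesis using assms(2) by unfold_locales (auto simp: places_def)
qed

lemma sum_local_degrees_le_degree:
  assumes K: "number_field K" and T: "finite T" "T \<subseteq> places K"
    and w: "\<And>v q. v \<in> T \<Longrightarrow> v (of_rat q) = w q" and nontriv: "w q0 > 1"
  shows "(\<Sum>v\<in>T. local_degree K v) \<le> field_degree K"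
proof (cases "T = {}")
  case False
  then obtain v0 where v0: "v0 \<in> T" by auto
  interpret v0: valued_field K v0 using place_valued_field[OF K] v0 T by auto
  interpret coherent_values K v0 "of_rat q0" T
  proof (intro coherent_values.intro coherent_values_axioms.intro)
    show "complex_subfield K" by (rule v0.complex_subfield_axioms)
    show "finite T" by (rule T(1))
    show "valued_field \<rat> v0" by (rule v0.valued_field_Rats)
    show "v0 (of_rat q0) > 1" using w[OF v0] nontriv by simp
    show "valued_field K v" if "v \<in> T" for v using place_valued_field[OF K] that T by auto
    show "v q = v0 q" if "v \<in> T" "q \<in> \<rat>" for v q
      using that(2) w[OF that(1)] w[OF v0] by (auto elim!: Rats_cases)
    fix u v assume uv: "u \<in> T" "v \<in> T" "u \<noteq> v"
    hence "u \<in> extensional K" "v \<in> extensional K" using T by (auto simp: places_def)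
    thus "\<exists>x\<in>K. u x \<noteq> v x" using uv(3) extensionalityI by blast
  qed auto
  obtain e :: "nat \<Rightarrow> complex" where e: "\<And>k. e k \<in> K"
    "\<And>x. x \<in> K \<Longrightarrow> \<exists>q. (\<forall>k. q k \<in> \<rat>) \<and> x = (\<Sum>k<field_degree K. q k * e k)"
    using number_field_basis[OF K] by blast
  show ?thesis by (rule sum_local_degree_le[OF e])
qed auto

section \<open>Archimedean absolute values\<close>

lemma Rats_fps_inverse:
  fixes F :: "complex fps"
  assumes "\<And>n. F $ n \<in> \<rat>" shows "inverse F $ n \<in> \<rat>"
proof (induction n rule: less_induct)
  case (less n)
  show ?case
  proof (cases "n = 0")
    case False
    hence "inverse F $ n = - inverse (F $ 0) * (\<Sum>i=1..n. F $ i * inverse F $ (n - i))"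
      by (cases n) (simp_all add: fps_inverse_def)
    thus ?thesis using assms less False by (auto intro!: Rats_mult Rats_sum)
  qed (use assms in auto)
qed

lemma norm_of_rat_complex: "norm (of_rat r :: complex) = \<bar>of_rat r :: real\<bar>"
proof (cases r)
  case (Fract a b)
  have "norm (of_rat r :: complex) = \<bar>of_int a\<bar> / \<bar>of_int b\<bar>"
    using Fract by (simp add: of_rat_rat norm_divide)
  also have "\<dots> = \<bar>of_int a / of_int b\<bar>" by simp
  also have "of_int a / of_int b = (of_rat r :: real)" using Fract by (simp add: of_rat_rat)
  finally show ?thesis .
qed

text \<open>If \<open>p\<close> has its roots in the disc of radius \<open>\<rho>\<close>, then the power series inverse of its
  reversed polynomial has rational coefficients and converges for arguments smaller than
  \<open>1 / \<rho>\<close>. If \<open>v x > \<rho>\<close> held, then its partial sums at \<open>1 / x\<close> would be a \<open>v\<close>-Cauchy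
  sequence, and their product with the value \<open>0\<close> of the reversed polynomial would tend to \<open>1\<close>.\<close>

lemma (in valued_field) archimedean_le_root_bound:
  fixes p :: "complex poly"
  assumes arch: "\<And>q. v (of_rat q) = \<bar>of_rat q\<bar>"
    and p: "\<And>i. coeff p i \<in> \<rat>" "p \<noteq> 0" and x: "x \<in> K" "poly p x = 0"
    and roots: "\<And>z. poly p z = 0 \<Longrightarrow> norm z \<le> \<rho>"
  shows "v x \<le> \<rho>"
proof (rule ccontr)
  assume "\<not> v x \<le> \<rho>"
  hence vx: "v x > \<rho>" by simp
  have \<rho>: "\<rho> \<ge> 0" using roots[OF x(2)] norm_ge_zero order_trans by blast
  have x0: "x \<noteq> 0" using vx \<rho> by auto
  define y where "y = inverse x"
  have y: "y \<in> K" "y \<noteq> 0" "v y = inverse (v x)" using x x0 by (auto simp: y_def v_inverse)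
  define P where "P = reflect_poly p"
  have P0: "coeff P 0 \<noteq> 0" using p(2) by (simp add: P_def)
  have Py: "poly P y = 0" using x x0 by (simp add: P_def poly_reflect_poly_nz y_def)
  have PQ: "coeff P i \<in> \<rat>" for i using p(1) by (auto simp: P_def coeff_reflect_poly)
  define H where "H = inverse (fps_of_poly P)"
  have HQ: "H $ n \<in> \<rat>" for n unfolding H_def using PQ by (intro Rats_fps_inverse) simp
  have PH: "fps_of_poly P * H = 1" unfolding H_def 
    using inverse_mult_eq_1[of "fps_of_poly P"] P0 by (simp add: mult.commute)
  have vQ: "v q = norm q" if "q \<in> \<rat>" for q
    using that arch norm_of_rat_complex by (metis Rats_cases)
  have "summable (\<lambda>n. norm (H $ n * of_real (v y) ^ n))"
  proof -
    define r where "r = (if \<rho> = 0 then \<infinity> else ereal (inverse \<rho>))"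
    have nz: "eval_fps (fps_of_poly P) z \<noteq> 0" if "ereal (norm z) < r" for z
    proof
      assume "eval_fps (fps_of_poly P) z = 0"
      hence z: "poly P z = 0" by (simp add: eval_fps_of_poly)
      hence "z \<noteq> 0" using P0 by (auto simp: poly_0_coeff_0)
      hence "poly p (inverse z) = 0" using z by (simp add: P_def poly_reflect_poly_nz)
      hence le: "norm (inverse z) \<le> \<rho>" by (rule roots)
      hence "\<rho> > 0" using \<open>z \<noteq> 0\<close> by (metis inverse_nonzero_iff_nonzero order_less_le_trans zero_less_norm_iff)
      thus False using le that \<open>z \<noteq> 0\<close> by (simp add: r_def norm_inverse field_simps norm_divide)
    qed
    have "fps_conv_radius H \<ge> min r \<infinity>"
      using fps_conv_radius_inverse[OF nz] by (simp add: H_def)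
    moreover have "ereal (v y) < r"
      using vx \<rho> by (auto simp: r_def y field_simps)
    ultimately have "ereal (norm (of_real (v y) :: complex)) < fps_conv_radius H"
      using y(1) by (simp add: min_def split: if_splits)
    thus ?thesis by (intro abs_summable_in_conv_radius) (simp add: fps_conv_radius_def)
  qed
  hence "summable (\<lambda>n. norm (H $ n) * v y ^ n)" using y(1) by (simp add: norm_mult norm_power)
  moreover have "norm (H $ n) * v y ^ n = v (H $ n * y ^ n)" for n
    using HQ[of n] Rats_mem y(1) by (simp add: v_mult v_power vQ power_mem)
  ultimately have summ: "summable (\<lambda>n. v (H $ n * y ^ n))" by simp
  define s where "s n = (\<Sum>k<n. H $ k * y ^ k)" for n
  have HK: "H $ k * y ^ k \<in> K" for k using HQ[of k] Rats_mem y(1) by auto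
  have sK: "s n \<in> K" for n unfolding s_def by (intro sum_mem HK)
  have sC: "s \<in> Cau"
  proof (rule CauI)
    fix e :: real assume e: "e > 0"
    obtain N where N: "\<And>m n. m \<ge> N \<Longrightarrow> norm (\<Sum>k=m..<n. v (H $ k * y ^ k)) < e"
      using summ e unfolding summable_Cauchy by blast
    have *: "v (s n - s m) < e" if "m \<ge> N" "n \<ge> m" for m n
    proof -
      have "s n - s m = (\<Sum>k=m..<n. H $ k * y ^ k)"
        unfolding s_def using that(2) sum_diff_nat_ivl[of 0 m n "\<lambda>k. H $ k * y ^ k"]
        by (simp add: atLeast0LessThan)
      hence "v (s n - s m) \<le> (\<Sum>k=m..<n. v (H $ k * y ^ k))"
        using v_sum_le[of "{m..<n}" "\<lambda>k. H $ k * y ^ k"] HK by simp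
      also have "\<dots> < e" using N[OF that(1), of n] by simp
      finally show ?thesis .
    qed
    have "v (s m - s n) < e" if "m \<ge> N" "n \<ge> N" for m n
      using *[of m n] *[of n m] that v_diff_commute[OF sK[of m] sK[of n]] by (cases "m \<le> n") auto
    thus "\<exists>N. \<forall>m\<ge>N. \<forall>n\<ge>N. v (s m - s n) < e" by blast
  qed (rule sK)
  define D where "D = degree P"
  have CK: "coeff P i * y ^ i \<in> K" for i using PQ[of i] Rats_mem y(1) by auto
  \<comment> \<open>Subtracting \<open>poly P y * s (n + D) = 0\<close> turns the Cauchy product, whose partial sum is \<open>1\<close>,
    into a combination of differences of late partial sums.\<close>
  have eq: "(\<Sum>i\<le>D. (coeff P i * y ^ i) * (s (n + D - i) - s (n + D))) = 1" if "n > 0" for n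
  proof -
    have "(\<Sum>i\<le>D. (coeff P i * y ^ i) * s (n + D)) = poly P y * s (n + D)"
      by (simp add: poly_altdef D_def sum_distrib_right)
    hence "(\<Sum>i\<le>D. (coeff P i * y ^ i) * (s (n + D - i) - s (n + D))) =
        (\<Sum>i\<le>D. (coeff P i * y ^ i) * s (n + D - i))"
      using Py by (simp add: right_diff_distrib sum_subtractf)
    also have "\<dots> = (\<Sum>i<n + D. (coeff P i * y ^ i) * s (n + D - i))"
      using that by (intro sum.mono_neutral_left) (auto simp: D_def coeff_eq_0)
    also have "\<dots> = (\<Sum>i<n + D. \<Sum>j<n + D - i. coeff P i * H $ j * y ^ (i + j))"
      unfolding s_def sum_distrib_left by (intro sum.cong) (auto simp: power_add mult_ac)
    also have "\<dots> = (\<Sum>(i, j)\<in>{(i, j). i + j < n + D}. coeff P i * H $ j * y ^ (i + j))"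
      by (subst sum.Sigma) (auto intro!: sum.cong)
    also have "\<dots> = (\<Sum>k<n + D. \<Sum>i\<le>k. coeff P i * H $ (k - i) * y ^ (i + (k - i)))"
      by (rule sum.triangle_reindex)
    also have "\<dots> = (\<Sum>k<n + D. (fps_of_poly P * H) $ k * y ^ k)"
      by (intro sum.cong) (auto simp: fps_mult_nth sum_distrib_right atLeast0AtMost)
    also have "\<dots> = (\<Sum>k<n + D. if k = 0 then 1 else 0)"
      unfolding PH by (intro sum.cong) auto
    also have "\<dots> = 1" using that by simp
    finally show ?thesis .
  qed
  define t where "t n = (\<Sum>i\<le>D. (coeff P i * y ^ i) * (s (n + D - i) - s (n + D)))" for n
  have "t \<in> Nul"
    unfolding t_def
  proof (intro Nul_sum Nul_mult Cau_const CK)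
    fix i assume i: "i \<in> {..D}"
    show "(\<lambda>n. s (n + D - i) - s (n + D)) \<in> Nul"
      unfolding Nul_iff
    proof (intro conjI allI)
      show "(\<lambda>n. v (s (n + D - i) - s (n + D))) \<longlonglongrightarrow> 0"
      proof (rule LIMSEQ_I)
        fix e :: real assume "e > 0"
        then obtain N where "\<forall>m\<ge>N. \<forall>n\<ge>N. v (s m - s n) < e" using CauD[OF sC] by blast
        thus "\<exists>N. \<forall>n\<ge>N. norm (v (s (n + D - i) - s (n + D)) - 0) < e"
          using i sK by (intro exI[of _ N]) (auto simp: diff_mem)
      qed
    qed (intro diff_mem sK)
  qed
  hence "(\<lambda>n. v (t n)) \<longlonglongrightarrow> 0" by (simp add: Nul_iff)
  moreover have "\<forall>\<^sub>F n in sequentially. v (t n) = 1"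
    using eventually_gt_at_top[of 0] by eventually_elim (simp add: t_def eq)
  ultimately have "(\<lambda>n::nat. 1::real) \<longlonglongrightarrow> 0" using tendsto_cong by fast
  thus False by (simp add: LIMSEQ_const_iff)
qed

section \<open>Ultrametric absolute values\<close>

text \<open>The binomial theorem bounds \<open>v (x + y) ^ n\<close> by \<open>n + 1\<close> times the \<open>n\<close>-th power of the
  maximum; the factor disappears for large \<open>n\<close>.\<close>

lemma (in valued_field) v_add_le_max:
  assumes nat: "\<And>n. v (of_nat n) \<le> 1" and xy: "x \<in> K" "y \<in> K"
  shows "v (x + y) \<le> max (v x) (v y)"
proof (rule ccontr)
  define M where "M = max (v x) (v y)"
  assume "\<not> v (x + y) \<le> max (v x) (v y)"
  hence gt: "v (x + y) > M" unfolding M_def by (rule not_le_imp_less)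
  have M: "v x \<le> M" "v y \<le> M" by (simp_all add: M_def)
  moreover have "M \<ge> 0" using M(1) v_nonneg[OF xy(1)] by linarith
  ultimately have M: "v x \<le> M" "v y \<le> M" "M \<ge> 0" by auto
  have "M \<noteq> 0"
  proof
    assume "M = 0"
    hence "v x = 0" "v y = 0" using M(1,2) v_nonneg[OF xy(1)] v_nonneg[OF xy(2)] by linarith+
    hence "x = 0" "y = 0" using v_eq_0_iff xy by blast+
    thus False using gt M(3) by simp
  qed
  hence M0: "M > 0" using M by simp
  define r where "r = v (x + y) / M"
  have r: "r > 1" using gt M0 by (simp add: r_def)
  have le: "r ^ n \<le> real n + 1" for n
  proof -
    have "v (x + y) ^ n = v (\<Sum>k\<le>n. of_nat (n choose k) * x ^ k * y ^ (n - k))"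
      using xy by (simp add: add_mem flip: v_power binomial_ring)
    also have "\<dots> \<le> (\<Sum>k\<le>n. v (of_nat (n choose k) * x ^ k * y ^ (n - k)))"
      using xy by (intro v_sum_le) auto
    also have "\<dots> \<le> (\<Sum>k\<le>n. M ^ n)"
    proof (rule sum_mono)
      fix k assume k: "k \<in> {..n}"
      have "v (of_nat (n choose k) * x ^ k * y ^ (n - k)) = v (of_nat (n choose k)) * v x ^ k * v y ^ (n - k)"
        using xy by (simp add: v_mult v_power power_mem mult_mem)
      also have "\<dots> \<le> 1 * M ^ k * M ^ (n - k)"
        using M xy nat by (intro mult_mono power_mono mult_nonneg_nonneg) auto
      also have "\<dots> = M ^ n" using k by (simp flip: power_add)
      finally show "v (of_nat (n choose k) * x ^ k * y ^ (n - k)) \<le> M ^ n" .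
    qed
    also have "\<dots> = (real n + 1) * M ^ n" by simp
    finally show ?thesis using M0 by (simp add: r_def power_divide pos_divide_le_eq)
  qed
  have "\<forall>\<^sub>F n in sequentially. r ^ n > real n + 1" using r by real_asymp
  then obtain n where "r ^ n > real n + 1" using eventually_happens'[OF sequentially_bot] by blast
  thus False using le[of n] by simp
qed

locale ultrametric_field = valued_field K v for K v +
  assumes nat_le_1: "v (of_nat n) \<le> 1"
begin

lemma v_add_max: "x \<in> K \<Longrightarrow> y \<in> K \<Longrightarrow> v (x + y) \<le> max (v x) (v y)"
  by (rule v_add_le_max[OF nat_le_1])

definition integers :: "complex set" where "integers = {x \<in> K. v x \<le> 1}"
definition max_ideal :: "complex set" where "max_ideal = {x \<in> K. v x < 1}"

lemma max_ideal_subset: "x \<in> max_ideal \<Longrightarrow> x \<in> integers"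
  by (auto simp: integers_def max_ideal_def)

lemma integers_simps [simp]: "0 \<in> integers" "1 \<in> integers" "0 \<in> max_ideal"
  by (auto simp: integers_def max_ideal_def)

lemma max_ideal_add: "x \<in> max_ideal \<Longrightarrow> y \<in> max_ideal \<Longrightarrow> x + y \<in> max_ideal"
  using v_add_max[of x y] by (auto simp: max_ideal_def)

lemma integers_mult: "x \<in> integers \<Longrightarrow> y \<in> integers \<Longrightarrow> x * y \<in> integers"
  by (auto simp: integers_def v_mult intro: mult_le_one)

lemma max_ideal_mult:
  assumes "x \<in> max_ideal" "y \<in> integers" shows "x * y \<in> max_ideal"
proof -
  have "v x * v y \<le> v x * 1" using assms by (intro mult_left_mono) (auto simp: integers_def max_ideal_def)
  thus ?thesis using assms by (auto simp: integers_def max_ideal_def v_mult)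
qed

lemma integers_power: "x \<in> integers \<Longrightarrow> x ^ n \<in> integers"
  by (induction n) (auto intro: integers_mult)

lemma integers_uminus: "x \<in> integers \<Longrightarrow> - x \<in> integers"
  and max_ideal_uminus: "x \<in> max_ideal \<Longrightarrow> - x \<in> max_ideal"
  by (auto simp: integers_def max_ideal_def v_minus)

lemma inverse_one_minus:
  assumes "x \<in> max_ideal" shows "1 - x \<noteq> 0" "inverse (1 - x) \<in> integers"
proof -
  have x: "x \<in> K" "v x < 1" using assms by (auto simp: max_ideal_def)
  have "1 \<le> max (v (1 - x)) (v x)" using v_add_max[of "1 - x" x] x by (simp add: diff_mem)
  hence ge: "v (1 - x) \<ge> 1" using x by (auto simp: le_max_iff_disj)
  thus "1 - x \<noteq> 0" by auto
  show "inverse (1 - x) \<in> integers"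
    using ge x by (auto simp: integers_def v_inverse diff_mem inverse_le_1_iff)
qed

text \<open>Nakayama's lemma for the finitely generated module spanned by the complex numbers \<open>g i\<close>
  over the valuation ring, by eliminating the generators one at a time.\<close>

lemma nakayama:
  assumes "finite I" "\<And>i j. i \<in> I \<Longrightarrow> j \<in> I \<Longrightarrow> m i j \<in> max_ideal"
    and "\<And>i. i \<in> I \<Longrightarrow> g i = (\<Sum>j\<in>I. m i j * g j)"
  shows "i \<in> I \<Longrightarrow> g i = 0"
  using assms
proof (induction I arbitrary: m i)
  case (insert k I)
  have mkk: "m k k \<in> max_ideal" using insert.prems by auto
  note unit = inverse_one_minus[OF mkk]
  define m' where "m' i j = m i j + m i k * (inverse (1 - m k k) * m k j)" for i j
  have "g k = m k k * g k + (\<Sum>j\<in>I. m k j * g j)"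
    using insert.prems(3)[of k] insert.hyps by simp
  hence "(1 - m k k) * g k = (\<Sum>j\<in>I. m k j * g j)" by (simp add: algebra_simps)
  hence gk: "g k = inverse (1 - m k k) * (\<Sum>j\<in>I. m k j * g j)" using unit(1) by (simp add: field_simps)
  have "g i = 0" if "i \<in> I" for i
  proof (rule insert.IH[OF that, of m'])
    show "m' i j \<in> max_ideal" if "i \<in> I" "j \<in> I" for i j
      unfolding m'_def using insert.prems(2) that unit(2)
      by (intro max_ideal_add max_ideal_mult[of "m i k"] integers_mult max_ideal_subset[of "m k j"]) auto
    fix i assume i: "i \<in> I"
    have "g i = m i k * g k + (\<Sum>j\<in>I. m i j * g j)"
      using insert.prems(3)[of i] insert.hyps i by simp
    also have "m i k * g k = (\<Sum>j\<in>I. m i k * (inverse (1 - m k k) * m k j) * g j)"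
      unfolding gk by (simp add: sum_distrib_left mult_ac)
    finally show "g i = (\<Sum>j\<in>I. m' i j * g j)"
      by (simp add: m'_def distrib_right sum.distrib add.commute)
  qed
  moreover from this have "g k = 0" using gk by simp
  ultimately show ?case using insert.prems(1) by auto
qed auto

end

section \<open>A bound at the non-archimedean places\<close>

text \<open>For a periodic orbit \<open>\<alpha>\<close> of \<open>z \<mapsto> z\<^sup>d + \<gamma>\<close> with \<open>v \<gamma> > 1\<close>, the quotients \<open>\<delta> = \<alpha> / \<gamma>\<close>
  satisfy \<open>\<delta> i ^ d = \<epsilon> (\<delta> (i + 1) - 1)\<close> with \<open>\<epsilon> = 1 / \<gamma> ^ (d - 1)\<close> in the maximal ideal.\<close>

locale contracted_cycle = ultrametric_field K v for K v +
  fixes d m :: nat and \<delta> :: "nat \<Rightarrow> complex" and \<epsilon> :: complex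
  assumes d: "d \<ge> 2" and m: "m > 0"
    and eps: "\<epsilon> \<in> max_ideal"
    and cycle: "i < m \<Longrightarrow> \<delta> i ^ d = \<epsilon> * (\<delta> (Suc i mod m) - 1)"
begin

definition mon :: "(nat \<Rightarrow> nat) \<Rightarrow> complex" where
  "mon a = (\<Prod>i<m. \<delta> i ^ a i)"

lemma mon_mult: "mon a * mon b = mon (\<lambda>i. a i + b i)"
  by (simp add: mon_def power_add prod.distrib)

lemma mon_upd:
  assumes i: "i < m" shows "mon (a(i := a i + n)) = \<delta> i ^ n * mon a"
proof -
  have eq: "mon b = \<delta> i ^ b i * (\<Prod>j\<in>{..<m} - {i}. \<delta> j ^ b j)" for b
    unfolding mon_def using i by (simp add: prod.remove)
  have "mon (a(i := a i + n)) = \<delta> i ^ (a i + n) * (\<Prod>j\<in>{..<m} - {i}. \<delta> j ^ (a(i := a i + n)) j)"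
    unfolding eq[of "a(i := a i + n)"] fun_upd_same ..
  also have "(\<Prod>j\<in>{..<m} - {i}. \<delta> j ^ (a(i := a i + n)) j) = (\<Prod>j\<in>{..<m} - {i}. \<delta> j ^ a j)"
    by (intro prod.cong) auto
  also have "\<delta> i ^ (a i + n) * \<dots> = \<delta> i ^ n * mon a"
    unfolding eq[of a] power_add by (simp only: mult_ac)
  finally show ?thesis .
qed

definition total :: "(nat \<Rightarrow> nat) \<Rightarrow> nat" where
  "total a = (\<Sum>i<m. a i)"

lemma total_upd:
  assumes i: "i < m" shows "total (a(i := a i + n)) = total a + n"
proof -
  have eq: "total b = b i + (\<Sum>j\<in>{..<m} - {i}. b j)" for b
    unfolding total_def using i by (simp add: sum.remove)
  have "total (a(i := a i + n)) = a i + n + (\<Sum>j\<in>{..<m} - {i}. (a(i := a i + n)) j)"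
    unfolding eq[of "a(i := a i + n)"] fun_upd_same ..
  also have "(\<Sum>j\<in>{..<m} - {i}. (a(i := a i + n)) j) = (\<Sum>j\<in>{..<m} - {i}. a j)"
    by (intro sum.cong) auto
  also have "a i + n + \<dots> = total a + n" unfolding eq[of a] by simp
  finally show ?thesis .
qed

text \<open>The finitely many monomials with all exponents below \<open>d\<close> generate the ring of all
  polynomial expressions in the \<open>\<delta> i\<close> as a module over the valuation ring; \<open>span J\<close> collects the
  combinations with coefficients in \<open>J\<close>, which is the valuation ring or its maximal ideal.\<close>

definition exponents :: "(nat \<Rightarrow> nat) set" where
  "exponents = PiE {..<m} (\<lambda>_. {..<d})"

lemma finite_exponents [simp]: "finite exponents"
  unfolding exponents_def by (intro finite_PiE) auto

definition span :: "complex set \<Rightarrow> complex set" where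
  "span J = {(\<Sum>a\<in>exponents. c a * mon a) | c. \<forall>a. c a \<in> J}"

lemma spanI: "(\<And>a. c a \<in> J) \<Longrightarrow> (\<Sum>a\<in>exponents. c a * mon a) \<in> span J"
  by (auto simp: span_def)

lemma span_add:
  assumes J: "\<And>x y. x \<in> J \<Longrightarrow> y \<in> J \<Longrightarrow> x + y \<in> J" and "x \<in> span J" "y \<in> span J"
  shows "x + y \<in> span J"
proof -
  obtain b c where "x = (\<Sum>a\<in>exponents. b a * mon a)" "\<forall>a. b a \<in> J"
      "y = (\<Sum>a\<in>exponents. c a * mon a)" "\<forall>a. c a \<in> J"
    using assms(2,3) unfolding span_def by blast
  thus ?thesis using spanI[of "\<lambda>a. b a + c a" J] J by (simp add: distrib_right sum.distrib)
qed

lemma span_mult: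
  assumes J: "\<And>y. y \<in> J \<Longrightarrow> x * y \<in> J'" and "y \<in> span J"
  shows "x * y \<in> span J'"
proof -
  obtain c where "y = (\<Sum>a\<in>exponents. c a * mon a)" "\<forall>a. c a \<in> J"
    using assms(2) unfolding span_def by blast
  thus ?thesis using spanI[of "\<lambda>a. x * c a" J'] J by (simp add: sum_distrib_left mult.assoc)
qed

lemma span_zero: "0 \<in> J \<Longrightarrow> 0 \<in> span J"
  using spanI[of "\<lambda>_. 0" J] by simp

lemma span_sum:
  assumes J: "0 \<in> J" "\<And>x y. x \<in> J \<Longrightarrow> y \<in> J \<Longrightarrow> x + y \<in> J" and "\<And>i. i \<in> S \<Longrightarrow> f i \<in> span J"
  shows "sum f S \<in> span J"
  using assms(3) by (induction S rule: infinite_finite_induct) (auto intro: span_zero J span_add)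

lemma span_subset: "x \<in> span max_ideal \<Longrightarrow> x \<in> span integers"
  using max_ideal_subset unfolding span_def by blast

lemma mon_in_span_basis: "a \<in> exponents \<Longrightarrow> mon a \<in> span integers"
  using spanI[of "\<lambda>b. if b = a then 1 else 0" integers]
  by (simp add: if_distrib[of "\<lambda>c. c * _"] sum.delta cong: if_cong)

text \<open>Rewriting with the relation of the cycle lowers the total degree, so every monomial is an
  integral combination of the monomials with all exponents below \<open>d\<close>; one rewriting step
  already contributes a factor \<open>\<epsilon>\<close>.\<close>

lemma mon_in_span:
  "mon a \<in> span integers \<and> ((\<exists>i<m. a i \<ge> d) \<longrightarrow> mon a \<in> span max_ideal)"
proof (induction "total a" arbitrary: a rule: less_induct)
  case less
  show ?case
  proof (cases "\<exists>i<m. a i \<ge> d")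
    case False
    have "mon a = mon (restrict a {..<m})" by (simp add: mon_def)
    moreover have "restrict a {..<m} \<in> exponents"
      using False by (auto simp: exponents_def not_le)
    ultimately show ?thesis using mon_in_span_basis False by auto
  next
    case True
    then obtain i where i: "i < m" "a i \<ge> d" by auto
    define b where "b = a(i := a i - d)"
    have a_eq: "a = b(i := b i + d)" using i by (auto simp: b_def)
    define i' where "i' = Suc i mod m"
    have i': "i' < m" using m by (simp add: i'_def)
    define b' where "b' = b(i' := b i' + 1)"
    have tot: "total a = total b + d" "total b' = total b + 1"
      using total_upd[OF i(1), of b d] total_upd[OF i', of b 1] a_eq by (auto simp: b'_def)
    have IH: "mon b \<in> span integers" "mon b' \<in> span integers"
      using less[of b] less[of b'] tot d by auto
    have "mon a = \<epsilon> * (\<delta> i' - 1) * mon b"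
      using mon_upd[OF i(1), of b d] a_eq cycle[OF i(1)] by (simp add: i'_def)
    also have "\<dots> = \<epsilon> * mon b' + (- \<epsilon>) * mon b"
      using mon_upd[OF i', of b 1] by (simp add: b'_def algebra_simps)
    also have "\<dots> \<in> span max_ideal"
      using IH eps
      by (intro span_add[OF max_ideal_add] span_mult[of integers] max_ideal_mult max_ideal_uminus) auto
    finally show ?thesis using span_subset by blast
  qed
qed

text \<open>The powers of the ideal generated by the \<open>\<delta> i\<close>.\<close>

inductive_set filtration :: "nat \<Rightarrow> complex set" for k where
  monomial: "c \<in> integers \<Longrightarrow> k \<le> total a \<Longrightarrow> c * mon a \<in> filtration k"
| add: "x \<in> filtration k \<Longrightarrow> y \<in> filtration k \<Longrightarrow> x + y \<in> filtration k"

lemma filtration_mult_integer: "x \<in> filtration k \<Longrightarrow> c \<in> integers \<Longrightarrow> c * x \<in> filtration k"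
proof (induction rule: filtration.induct)
  case (monomial b a)
  thus ?case using filtration.monomial[of "c * b" k a] by (simp add: integers_mult mult.assoc)
qed (auto simp: distrib_left intro: filtration.add)

lemma filtration_antimono: "x \<in> filtration k \<Longrightarrow> l \<le> k \<Longrightarrow> x \<in> filtration l"
  by (induction rule: filtration.induct) (auto intro: filtration.intros)

lemma filtration_mult:
  assumes "x \<in> filtration k" "y \<in> filtration l" shows "x * y \<in> filtration (k + l)"
  using assms
proof (induction rule: filtration.induct)
  case (monomial c a)
  from monomial(3) show ?case
  proof (induction rule: filtration.induct)
    case (monomial b a')
    have "total (\<lambda>i. a i + a' i) = total a + total a'" by (simp add: total_def sum.distrib)
    hence "(c * b) * mon (\<lambda>i. a i + a' i) \<in> filtration (k + l)"
      using monomial \<open>c \<in> integers\<close> \<open>k \<le> total a\<close>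
      by (intro filtration.monomial integers_mult) auto
    thus ?case by (simp add: mon_mult[symmetric] mult_ac)
  qed (auto simp: distrib_left intro: filtration.add)
qed (auto simp: distrib_right intro: filtration.add)

lemma filtration_power: "x \<in> filtration 1 \<Longrightarrow> x ^ k \<in> filtration k"
proof (induction k)
  case 0
  show ?case using filtration.monomial[of 1 0 "\<lambda>_. 0"] by (simp add: mon_def)
next
  case (Suc k)
  thus ?case using filtration_mult[of x 1 "x ^ k" k] by simp
qed

lemma filtration_one_minus_mult:
  assumes "1 - x \<in> filtration 1" "1 - y \<in> filtration 1" shows "1 - x * y \<in> filtration 1"
proof -
  have "(-1) * ((1 - x) * (1 - y)) \<in> filtration 1"
    using filtration_antimono[OF filtration_mult[OF assms], of 1]
    by (intro filtration_mult_integer[where x = "(1 - x) * (1 - y)"] integers_uminus) auto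
  hence "(1 - x) + (1 - y) + (-1) * ((1 - x) * (1 - y)) \<in> filtration 1"
    using assms by (intro filtration.add)
  thus ?thesis by (simp add: algebra_simps)
qed

lemma delta_in_filtration: "i < m \<Longrightarrow> \<delta> i \<in> filtration 1"
  using filtration.monomial[of 1 1 "(\<lambda>_. 0)(i := 0 + 1)"] mon_upd[of i "\<lambda>_. 0" 1]
    total_upd[of i "\<lambda>_. 0" 1]
  by (simp add: mon_def total_def)

text \<open>By the pigeonhole principle a monomial of total degree at least \<open>m * d\<close> has an exponent
  that is at least \<open>d\<close>.\<close>

lemma filtration_subset_span:
  assumes "x \<in> filtration (m * d)" shows "x \<in> span max_ideal"
  using assms
proof (induction rule: filtration.induct)
  case (monomial c a)
  have "\<exists>i<m. a i \<ge> d"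
  proof (rule ccontr)
    assume "\<not> ?thesis"
    hence "total a < (\<Sum>i<m. d)" unfolding total_def using m by (intro sum_strict_mono) auto
    thus False using monomial by simp
  qed
  hence "mon a \<in> span max_ideal" using mon_in_span by blast
  thus ?case using monomial
    by (intro span_mult[of max_ideal c]) (auto simp: mult.commute[of c] intro: max_ideal_mult)
qed (auto intro: span_add max_ideal_add)

text \<open>All \<open>\<delta> i\<close> are nilpotent modulo the maximal ideal, so the product is a unit modulo the
  maximal ideal. If it were an element of the maximal ideal, then the module spanned by the
  monomials would be equal to its multiple by the maximal ideal, hence zero by Nakayama's
  lemma, although it contains \<open>1\<close>.\<close>

lemma prod_one_minus_notin_max_ideal:
  "(\<Prod>i<m. (1 - \<delta> i) ^ n) \<notin> max_ideal"
proof
  define \<mu> where "\<mu> = (\<Prod>i<m. (1 - \<delta> i) ^ n)"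
  assume "(\<Prod>i<m. (1 - \<delta> i) ^ n) \<in> max_ideal"
  hence \<mu>: "\<mu> \<in> max_ideal" by (simp add: \<mu>_def)
  have zero: "0 \<in> filtration 1"
    using filtration.monomial[of 0 1 "(\<lambda>_. 0)(0 := 0 + 1)"] total_upd[OF m, of "\<lambda>_. 0" 1] by simp
  have pow: "1 - (1 - \<delta> i) ^ n \<in> filtration 1" if "i < m" for i n
  proof (induction n)
    case (Suc n)
    thus ?case using delta_in_filtration[OF that] filtration_one_minus_mult[of "1 - \<delta> i"] by simp
  qed (use zero in auto)
  have "1 - (\<Prod>i\<in>S. (1 - \<delta> i) ^ n) \<in> filtration 1" if "S \<subseteq> {..<m}" for S
    using finite_subset[OF that finite_lessThan] that
  proof (induction S)
    case (insert i S)
    thus ?case using pow[of i n] filtration_one_minus_mult by simp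
  qed (use zero in auto)
  hence "1 - \<mu> \<in> filtration 1" by (simp add: \<mu>_def)
  hence "(1 - \<mu>) ^ (m * d) \<in> span max_ideal"
    by (intro filtration_subset_span filtration_power)
  hence "inverse (1 - \<mu>) ^ (m * d) * (1 - \<mu>) ^ (m * d) \<in> span max_ideal"
    using inverse_one_minus(2)[OF \<mu>]
    by (intro span_mult[of max_ideal])
      (auto simp: mult.commute[of "inverse _ ^ _"] intro: max_ideal_mult integers_power)
  hence "1 \<in> span max_ideal"
    using inverse_one_minus(1)[OF \<mu>] by (simp flip: power_mult_distrib)
  then obtain c where c: "1 = (\<Sum>a\<in>exponents. c a * mon a)" "\<And>a. c a \<in> max_ideal"
    unfolding span_def by blast
  have "mon b \<in> span max_ideal" for b
  proof -
    have "mon b = (\<Sum>a\<in>exponents. c a * mon (\<lambda>i. a i + b i))"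
      using arg_cong[OF c(1), of "\<lambda>x. x * mon b"]
      by (simp add: sum_distrib_right mult.assoc mon_mult)
    also have "\<dots> \<in> span max_ideal"
      using c(2) mon_in_span
      by (intro span_sum max_ideal_add span_mult[of integers] max_ideal_mult) auto
    finally show ?thesis .
  qed
  hence "\<exists>c. (\<forall>a. c a \<in> max_ideal) \<and> mon b = (\<Sum>a\<in>exponents. c a * mon a)" for b
    unfolding span_def by blast
  then obtain M where M: "\<And>b a. M b a \<in> max_ideal" "\<And>b. mon b = (\<Sum>a\<in>exponents. M b a * mon a)"
    by metis
  have "mon b = 0" if "b \<in> exponents" for b
    by (rule nakayama[OF finite_exponents M that])
  moreover have "restrict (\<lambda>_. 0) {..<m} \<in> exponents" using d by (auto simp: exponents_def)
  ultimately have "mon (restrict (\<lambda>_. 0) {..<m}) = 0" by blast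
  thus False by (simp add: mon_def)
qed

end

text \<open>The \<open>d\<close>-th power of the multiplier \<open>1\<close> is \<open>M\<close> times the product of the \<open>(1 - \<delta> i) ^ (d - 1)\<close>,
  where \<open>v M\<close> is the \<open>m\<close>-th power of the left-hand side. If that were larger than \<open>1\<close>, then
  also \<open>v \<gamma> > 1\<close>, and the product would be an element of the maximal ideal, contrary to \<open>prod_one_minus_notin_max_ideal\<close>.\<close>

lemma (in ultrametric_field) parabolic_bound:
  assumes d: "d \<ge> 2" and m: "m > 0" and \<gamma>: "\<gamma> \<in> K"
    and step: "\<And>i. \<alpha> (Suc i) = \<alpha> i ^ d + \<gamma>" and per: "\<alpha> m = \<alpha> 0"
    and mult: "(\<Prod>i<m. of_nat d * \<alpha> i ^ (d - 1)) = 1"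
  shows "v \<gamma> ^ (d - 1) * v (of_nat d) ^ d \<le> 1"
proof (rule ccontr)
  assume "\<not> ?thesis"
  hence gt: "v \<gamma> ^ (d - 1) * v (of_nat d) ^ d > 1" by simp
  have "v \<gamma> ^ (d - 1) * v (of_nat d) ^ d \<le> v \<gamma> ^ (d - 1) * 1"
    using \<gamma> nat_le_1 by (intro mult_left_mono power_le_one) auto
  hence big: "v \<gamma> ^ (d - 1) > 1" using gt by simp
  hence \<gamma>0: "\<gamma> \<noteq> 0" using d by (auto simp: power_0_left)
  define \<delta> where "\<delta> i = \<alpha> i / \<gamma>" for i
  define \<epsilon> where "\<epsilon> = 1 / \<gamma> ^ (d - 1)"
  define M where "M = (of_nat d ^ d * (- \<gamma>) ^ (d - 1)) ^ m"
  have pd: "\<gamma> ^ d = \<gamma> * \<gamma> ^ (d - 1)" using d by (cases d) auto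
  have rel: "\<delta> i ^ d = \<epsilon> * (\<delta> (Suc i) - 1)" for i
    using \<gamma>0 step[of i] by (simp add: \<delta>_def \<epsilon>_def power_divide pd field_simps)
  have mod: "\<delta> (Suc i) = \<delta> (Suc i mod m)" if "i < m" for i
    using that per m by (cases "Suc i = m") (auto simp: \<delta>_def)
  interpret contracted_cycle K v d m \<delta> \<epsilon>
  proof
    show "\<epsilon> \<in> max_ideal"
      using \<gamma> big by (auto simp: \<epsilon>_def max_ideal_def v_divide v_power power_mem)
    show "\<delta> i ^ d = \<epsilon> * (\<delta> (Suc i mod m) - 1)" if "i < m" for i
      using rel[of i] mod[OF that] by simp
  qed (use d m in auto)
  have shift: "(\<Prod>i<m. f (Suc i)) = (\<Prod>i<m. f i)" if "f m = f 0" for f :: "nat \<Rightarrow> complex"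
  proof -
    obtain k where k: "m = Suc k" using m by (cases m) auto
    have "(\<Prod>i<m. f (Suc i)) = (\<Prod>i<k. f (Suc i)) * f 0" using that k by simp
    also have "\<dots> = (\<Prod>i<m. f i)" unfolding k by (simp add: prod.lessThan_Suc_shift mult.commute del: prod.lessThan_Suc)
    finally show ?thesis .
  qed
  have "1 = (\<Prod>i<m. (of_nat d * \<alpha> i ^ (d - 1)) ^ d)"
    using mult by (simp add: prod_power_distrib[symmetric])
  also have "\<dots> = (\<Prod>i<m. (of_nat d ^ d * (- \<gamma>) ^ (d - 1)) * (1 - \<delta> (Suc i)) ^ (d - 1))"
  proof (intro prod.cong refl)
    fix i
    have "\<alpha> i ^ d = (- \<gamma>) * (1 - \<delta> (Suc i))"
      using \<gamma>0 step[of i] by (simp add: \<delta>_def field_simps)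
    moreover have "(\<alpha> i ^ (d - 1)) ^ d = (\<alpha> i ^ d) ^ (d - 1)"
      unfolding power_mult[symmetric] by (simp only: mult.commute)
    ultimately have "(\<alpha> i ^ (d - 1)) ^ d = ((- \<gamma>) * (1 - \<delta> (Suc i))) ^ (d - 1)"
      by (simp only:)
    thus "(of_nat d * \<alpha> i ^ (d - 1)) ^ d = (of_nat d ^ d * (- \<gamma>) ^ (d - 1)) * (1 - \<delta> (Suc i)) ^ (d - 1)"
      by (simp only: power_mult_distrib mult.assoc)
  qed
  also have "\<dots> = M * (\<Prod>i<m. (1 - \<delta> (Suc i)) ^ (d - 1))"
    by (simp add: prod.distrib M_def power_mult_distrib)
  also have "(\<Prod>i<m. (1 - \<delta> (Suc i)) ^ (d - 1)) = (\<Prod>i<m. (1 - \<delta> i) ^ (d - 1))"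
    by (rule shift) (simp add: \<delta>_def per)
  finally have one: "M * (\<Prod>i<m. (1 - \<delta> i) ^ (d - 1)) = 1" by simp
  have MK: "M \<in> K" using \<gamma> by (auto simp: M_def)
  have "v M = (v \<gamma> ^ (d - 1) * v (of_nat d) ^ d) ^ m"
    using \<gamma> by (simp add: M_def v_power v_mult v_minus power_mem mult_mem uminus_mem mult.commute)
  hence "v M > 1" using gt m by (simp add: one_less_power)
  moreover have "M \<noteq> 0" using one by auto
  ultimately have "inverse M \<in> max_ideal"
    using MK by (auto simp: max_ideal_def v_inverse inverse_less_1_iff)
  moreover have "inverse M = (\<Prod>i<m. (1 - \<delta> i) ^ (d - 1))"
    using one by (rule inverse_unique)
  ultimately show False using prod_one_minus_notin_max_ideal by simp
qed

section \<open>Cycles of the unicritical family\<close>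

lemma unicritical_orbit_Suc: "(unicritical d c ^^ Suc i) z = ((unicritical d c ^^ i) z) ^ d + c"
  by (simp add: unicritical_def)

lemma has_field_derivative_unicritical_iterate:
  "((unicritical d c ^^ m) has_field_derivative
     (\<Prod>i<m. of_nat d * ((unicritical d c ^^ i) z) ^ (d - 1))) (at z)"
proof (induction m)
  case 0
  have "((\<lambda>z. z) has_field_derivative 1) (at z)" by simp
  thus ?case by (simp add: id_def)
next
  case (Suc m)
  have "((\<lambda>z. ((unicritical d c ^^ m) z) ^ d + c) has_field_derivative
     of_nat d * ((unicritical d c ^^ m) z) ^ (d - 1) *
     (\<Prod>i<m. of_nat d * ((unicritical d c ^^ i) z) ^ (d - 1))) (at z)"
    using Suc by (auto intro!: derivative_eq_intros)
  moreover have "(unicritical d c ^^ Suc m) = (\<lambda>z. ((unicritical d c ^^ m) z) ^ d + c)"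
    by (rule ext) (rule unicritical_orbit_Suc)
  ultimately show ?case by (simp add: mult.commute)
qed

lemma multiplier_unicritical:
  "multiplier (unicritical d c) m z = (\<Prod>i<m. of_nat d * ((unicritical d c ^^ i) z) ^ (d - 1))"
  unfolding multiplier_def by (rule DERIV_imp_deriv[OF has_field_derivative_unicritical_iterate])

lemma funpow_mult_period: "(f ^^ m) z = z \<Longrightarrow> (f ^^ (m * n)) z = z"
  by (induction n) (simp_all add: funpow_add)

lemma prod_periodic:
  fixes g :: "nat \<Rightarrow> 'a :: comm_monoid_mult"
  assumes "\<And>i. g (m + i) = g i"
  shows "(\<Prod>i<m * n. g i) = (\<Prod>i<m. g i) ^ n"
proof (induction n)
  case (Suc n)
  have split: "(\<Prod>i<a + b. g i) = (\<Prod>i<a. g i) * (\<Prod>i<b. g (a + i))" for a b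
    by (induction b) (simp_all add: mult.assoc)
  have shift: "g (m * k + i) = g i" for k i
  proof (induction k)
    case (Suc k)
    have "m * Suc k + i = m + (m * k + i)" by simp
    thus ?case using assms Suc by (simp only:)
  qed auto
  have "m * Suc n = m * n + m" by simp
  hence "(\<Prod>i<m * Suc n. g i) = (\<Prod>i<m * n. g i) * (\<Prod>i<m. g (m * n + i))"
    by (simp only: split)
  also have "\<dots> = (\<Prod>i<m. g i) ^ Suc n"
    by (simp only: shift Suc.IH power_Suc2)
  finally show ?case .
qed auto

text \<open>A cycle whose multiplier is an \<open>n\<close>-th root of unity is traversed \<open>n\<close> times to reach multiplier \<open>1\<close>.\<close>

lemma parabolic_parameter_multiplier_one:
  assumes "parabolic_parameter d c"
  obtains m \<alpha> where "m > 0" "(unicritical d c ^^ m) \<alpha> = \<alpha>"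
    "(\<Prod>i<m. of_nat d * ((unicritical d c ^^ i) \<alpha>) ^ (d - 1)) = 1"
proof -
  obtain m \<alpha> n where m: "m > 0" and per: "(unicritical d c ^^ m) \<alpha> = \<alpha>" and n: "n > 0"
    and one: "(multiplier (unicritical d c) m \<alpha>) ^ n = 1"
    using assms unfolding parabolic_parameter_def periodic_point_def root_of_unity_def by auto
  have "(unicritical d c ^^ (m + i)) \<alpha> = (unicritical d c ^^ i) \<alpha>" for i
    using per by (simp add: add.commute[of m] funpow_add)
  hence "(\<Prod>i<m * n. of_nat d * ((unicritical d c ^^ i) \<alpha>) ^ (d - 1)) = 1"
    using one unfolding multiplier_unicritical by (subst prod_periodic) auto
  thus ?thesis using m n per by (intro that[of "m * n" \<alpha>] funpow_mult_period) auto
qed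

text \<open>The derivatives of the iterates of \<open>g\<close> at the fixed point are the powers of its derivative,
  and Cauchy's inequality bounds all of them.\<close>

lemma fixed_point_derivative_le_1:
  assumes hol: "g holomorphic_on ball 0 R" and img: "g ` ball 0 R \<subseteq> ball 0 R"
    and z: "z \<in> ball 0 R" "g z = z"
  shows "norm (deriv g z) \<le> 1"
proof -
  have "(g ^^ n) holomorphic_on ball 0 R \<and> (g ^^ n) ` ball 0 R \<subseteq> ball 0 R \<and> (g ^^ n) z = z \<and>
      deriv (g ^^ n) z = deriv g z ^ n" for n
  proof (induction n)
    case 0
    have "(id :: complex \<Rightarrow> complex) = (\<lambda>z. z)" by auto
    thus ?case by (simp add: holomorphic_on_ident)
  next
    case (Suc n)
    have "(g \<circ> (g ^^ n)) holomorphic_on ball 0 R"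
      using Suc by (intro holomorphic_on_compose_gen[OF _ hol]) auto
    moreover have "deriv (g \<circ> (g ^^ n)) z = deriv g ((g ^^ n) z) * deriv (g ^^ n) z"
      using Suc hol z by (intro deriv_chain) (auto intro: holomorphic_on_imp_differentiable_at)
    moreover have "(g \<circ> (g ^^ n)) ` ball 0 R \<subseteq> ball 0 R" "(g \<circ> (g ^^ n)) z = z"
      using Suc img z by (auto simp: image_subset_iff)
    ultimately show ?case using Suc z by (simp only: funpow.simps power_Suc)
  qed
  note it = this
  define r where "r = (R - norm z) / 2"
  have r: "r > 0" and sub: "cball z r \<subseteq> ball 0 R"
    using z unfolding r_def
    by (auto simp: dist_norm intro!: order_le_less_trans[OF norm_triangle_sub[of _ z]])
       (auto simp: norm_minus_commute field_simps)
  have le: "norm (deriv g z) ^ n \<le> R / r" for n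
  proof -
    have hol': "(g ^^ n) holomorphic_on cball z r" using it sub holomorphic_on_subset by blast
    have "norm ((deriv ^^ 1) (g ^^ n) z) \<le> fact 1 * R / r ^ 1"
    proof (rule Cauchy_inequality[OF _ _ r])
      show "(g ^^ n) holomorphic_on ball z r" using hol' holomorphic_on_subset ball_subset_cball by blast
      show "continuous_on (cball z r) (g ^^ n)" by (rule holomorphic_on_imp_continuous_on[OF hol'])
      fix x assume "norm (z - x) = r"
      hence "x \<in> ball 0 R" using sub by (auto simp: dist_norm)
      hence "(g ^^ n) x \<in> ball 0 R" using it by blast
      thus "norm ((g ^^ n) x) \<le> R" by simp
    qed
    thus ?thesis using it by (simp add: norm_power)
  qed
  show ?thesis
  proof (rule ccontr)
    assume "\<not> ?thesis"
    hence "norm (deriv g z) > 1" by simp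
    then obtain n where "R / r < norm (deriv g z) ^ n" using real_arch_pow by blast
    thus False using le[of n] by simp
  qed
qed

text \<open>An expansion of \<open>g\<close> around its fixed point by a factor \<open>t\<close> slightly larger than \<open>1\<close>
  still maps the disc into itself.\<close>

lemma fixed_point_derivative_less_1:
  assumes R: "0 < R'" "R' < R" and hol: "g holomorphic_on ball 0 R"
    and img: "g ` ball 0 R \<subseteq> cball 0 R'" and z: "z \<in> ball 0 R" "g z = z"
  shows "norm (deriv g z) < 1"
proof -
  define t where "t = 1 + (R - R') / (4 * R')"
  have t: "t > 1" using R by (simp add: t_def)
  define h where "h w = z + of_real t * (g w - z)" for w
  have "h holomorphic_on ball 0 R" unfolding h_def by (intro holomorphic_intros hol)
  moreover have "h ` ball 0 R \<subseteq> ball 0 R"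
  proof (rule image_subsetI)
    fix w :: complex assume w: "w \<in> ball 0 R"
    have le: "norm (g w) \<le> R'" "norm z \<le> R'" using img w z by (force simp: image_subset_iff)+
    define u where "u = of_real (t - 1) * (g w - z)"
    have "norm u = (t - 1) * norm (g w - z)"
      unfolding u_def using t by (simp add: norm_mult del: of_real_diff)
    also have "\<dots> \<le> (t - 1) * (R' + R')"
      using t le norm_triangle_ineq4[of "g w" z] by (intro mult_left_mono) auto
    also have "\<dots> = (R - R') / 2" using R by (simp add: t_def field_simps)
    finally have "norm u \<le> (R - R') / 2" .
    moreover have "h w = g w + u" by (simp add: h_def u_def algebra_simps)
    ultimately have "norm (h w) < R"
      using norm_triangle_ineq[of "g w" u] le R by (simp add: field_simps)
    thus "h w \<in> ball 0 R" by simp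
  qed
  moreover have "h z = z" using z by (simp add: h_def)
  ultimately have "norm (deriv h z) \<le> 1" using fixed_point_derivative_le_1 z(1) by blast
  moreover have "deriv h z = of_real t * deriv g z"
  proof -
    have "(g has_field_derivative deriv g z) (at z)"
      using hol z by (auto intro!: holomorphic_derivI[of _ "ball 0 R"])
    hence "(h has_field_derivative of_real t * deriv g z) (at z)"
      unfolding h_def by (auto intro!: derivative_eq_intros)
    thus ?thesis by (rule DERIV_imp_deriv)
  qed
  ultimately have "t * norm (deriv g z) \<le> 1" using t by (simp add: norm_mult)
  thus ?thesis using t
    by (cases "norm (deriv g z) < 1") (auto dest: mult_less_le_imp_less[of 1 t 1 "norm (deriv g z)"])
qed

text \<open>Outside the open disc of radius \<open>\<bar>c\<bar>\<close> the modulus increases along the orbit.\<close>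

lemma periodic_point_norm_less:
  assumes d: "d \<ge> 2" and c: "norm c ^ (d - 1) > 2"
    and m: "m > 0" "(unicritical d c ^^ m) \<alpha> = \<alpha>"
  shows "norm ((unicritical d c ^^ i) \<alpha>) < norm c"
proof -
  define z where "z i = (unicritical d c ^^ i) \<alpha>" for i
  have step: "z (Suc i) = z i ^ d + c" for i unfolding z_def by (rule unicritical_orbit_Suc)
  have grow: "norm (z (Suc i)) > norm (z i)" "norm (z (Suc i)) \<ge> norm c" if "norm (z i) \<ge> norm c" for i
  proof -
    have "norm c > 0" using c d by (cases "c = 0") (auto simp: power_0_left)
    hence z0: "norm (z i) > 0" using that by linarith
    have "2 < norm (z i) ^ (d - 1)"
      using c power_mono[OF that, of "d - 1"] by simp
    hence "2 * norm (z i) < norm (z i) ^ (d - 1) * norm (z i)" using z0 by simp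
    also have "\<dots> = norm (z i ^ d)" using d by (cases d) (auto simp: norm_power norm_mult mult.commute)
    also have "\<dots> = norm (z (Suc i) - c)" by (simp add: step)
    also have "\<dots> \<le> norm (z (Suc i)) + norm c" by (rule norm_triangle_ineq4)
    finally show "norm (z (Suc i)) > norm (z i)" using that by simp
    thus "norm (z (Suc i)) \<ge> norm c" using that by simp
  qed
  show ?thesis
  proof (rule ccontr)
    assume "\<not> ?thesis"
    hence ge: "norm (z i) \<ge> norm c" by (simp add: z_def)
    have "norm (z (i + n)) \<ge> norm c \<and> (n > 0 \<longrightarrow> norm (z (i + n)) > norm (z i))" for n
      by (induction n) (use ge grow in \<open>auto simp: less_imp_le intro: order.strict_trans\<close>)
    moreover have "z (i + m) = z i" using m(2) by (simp add: z_def funpow_add)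
    ultimately show False using m(1) by (metis less_irrefl)
  qed
qed

text \<open>If \<open>\<bar>c\<bar> ^ (d - 1) > 2\<close>, then the disc of radius \<open>\<bar>c\<bar>\<close> does not contain the critical value
  and its preimage lies in a smaller disc, so the inverse branches along a cycle compose to a map
  of the disc to the smaller one that fixes a point of the cycle. Its derivative there is the
  inverse of the multiplier.\<close>

lemma repelling_if_large:
  assumes d: "d \<ge> 2" and c: "norm c ^ (d - 1) > 2"
    and m: "m > 0" "(unicritical d c ^^ m) \<alpha> = \<alpha>"
  shows "norm (\<Prod>i<m. of_nat d * ((unicritical d c ^^ i) \<alpha>) ^ (d - 1)) > 1"
proof -
  define f where "f = unicritical d c"
  define z where "z i = (f ^^ i) \<alpha>" for i
  define R where "R = norm c"
  have zR: "norm (z i) < R" for i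
    using periodic_point_norm_less[OF d c m] by (simp add: z_def f_def R_def)
  have R: "R > 0" using zR[of 0] norm_ge_zero[of "z 0"] by linarith
  have c0: "c \<noteq> 0" using R by (auto simp: R_def)
  have step: "z (Suc i) = z i ^ d + c" for i unfolding z_def f_def by (rule unicritical_orbit_Suc)
  have "R ^ d = R ^ (d - 1) * R" using d by (cases d) auto
  hence Rd: "2 * R < R ^ d" using c R by (simp add: R_def)
  define R' where "R' = root d (2 * R)"
  have R': "0 < R'" "R' < R" "R' ^ d = 2 * R"
    using R d Rd real_root_less_mono[of d "2 * R" "R ^ d"]
    by (auto simp: R'_def real_root_power_cancel real_root_gt_zero)
  define e where "e w = exp (Ln (1 - w / c) / of_nat d)" for w
  have pos: "Re (1 - w / c) > 0" if "norm w < R" for w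
  proof -
    have "norm (w / c) < 1" using that R by (simp add: norm_divide R_def)
    thus ?thesis using complex_Re_le_cmod[of "w / c"] by simp
  qed
  have e_pow: "e w ^ d = 1 - w / c" and e0: "e w \<noteq> 0" if "norm w < R" for w
  proof -
    have "1 - w / c \<noteq> 0" using pos[OF that] by auto
    moreover have "e w ^ d = exp (of_nat d * (Ln (1 - w / c) / of_nat d))"
      unfolding e_def by (rule exp_of_nat_mult[symmetric])
    ultimately show "e w ^ d = 1 - w / c" using d by simp
    show "e w \<noteq> 0" by (simp add: e_def)
  qed
  have e_hol: "e holomorphic_on ball 0 R"
    unfolding e_def using pos c0 d
    by (intro holomorphic_intros) (auto simp: complex_nonpos_Reals_iff not_le)
  \<comment> \<open>The inverse branch that maps \<open>z (Suc i)\<close> back to \<open>z i\<close>; the constant in front is a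
    \<open>d\<close>-th root of \<open>- c\<close>.\<close>
  define h where "h i w = z i / e (z (Suc i)) * e w" for i w
  have h_hol: "h i holomorphic_on ball 0 R" for i
    unfolding h_def by (intro holomorphic_intros e_hol)
  have h_pow: "h i w ^ d = w - c" if "norm w < R" for i w
  proof -
    have ne: "z (Suc i) \<noteq> c" using zR[of "Suc i"] by (auto simp: R_def)
    have "h i w ^ d = z i ^ d / (1 - z (Suc i) / c) * (1 - w / c)"
      using that zR by (simp add: h_def power_mult_distrib power_divide e_pow)
    also have "z i ^ d = z (Suc i) - c" using step by simp
    also have "(z (Suc i) - c) / (1 - z (Suc i) / c) * (1 - w / c) = w - c"
      using ne c0 by (simp add: divide_simps) (simp add: algebra_simps)
    finally show ?thesis .
  qed
  have h_z: "h i (z (Suc i)) = z i" for i using e0[OF zR] by (simp add: h_def)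
  have h_img: "norm (h i w) \<le> R'" if "norm w < R" for i w
  proof -
    have "norm (h i w) ^ d = norm (w - c)" using h_pow[OF that] by (simp flip: norm_power)
    also have "\<dots> \<le> R' ^ d" using that norm_triangle_ineq4[of w c] R' by (simp add: R_def)
    finally show ?thesis using R' d by (subst (asm) power_mono_iff) auto
  qed
  define G where "G k = rec_nat (\<lambda>w. w) (\<lambda>k g w. g (h k w)) k" for k
  have G_simps: "G 0 = (\<lambda>w. w)" "G (Suc k) = (\<lambda>w. G k (h k w))" for k by (simp_all add: G_def)
  have hD: "h i w \<in> ball 0 R" if "w \<in> ball 0 R" for i w
    using h_img[of w i] that R' by simp
  have G: "G k holomorphic_on ball 0 R \<and> G k (z k) = z 0 \<and> (\<forall>w\<in>ball 0 R. (f ^^ k) (G k w) = w) \<and>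
      (k > 0 \<longrightarrow> G k ` ball 0 R \<subseteq> cball 0 R')" for k
  proof (induction k)
    case (Suc k)
    have "(G k \<circ> h k) holomorphic_on ball 0 R"
      using Suc h_hol hD by (intro holomorphic_on_compose_gen[of _ _ _ "ball 0 R"]) auto
    moreover have "(f ^^ Suc k) (G (Suc k) w) = w" if w: "w \<in> ball 0 R" for w
    proof -
      have "(f ^^ Suc k) (G (Suc k) w) = f ((f ^^ k) (G k (h k w)))" by (simp add: G_simps)
      also have "(f ^^ k) (G k (h k w)) = h k w" using Suc hD[OF w] by blast
      also have "f (h k w) = w" using h_pow[of w k] w by (simp add: f_def unicritical_def)
      finally show ?thesis .
    qed
    moreover have "G (Suc k) ` ball 0 R \<subseteq> cball 0 R'"
    proof (cases "k = 0")
      case True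
      thus ?thesis using h_img by (auto simp: G_simps)
    next
      case False
      thus ?thesis using Suc hD by (force simp: G_simps)
    qed
    ultimately show ?case using Suc h_z by (simp add: G_simps o_def)
  qed (auto simp: G_simps)
  have zm: "z m = z 0" using m(2) by (simp add: z_def f_def)
  have z0: "z 0 \<in> ball 0 R" using zR by simp
  have Gm: "G m holomorphic_on ball 0 R" "G m (z 0) = z 0" "G m ` ball 0 R \<subseteq> cball 0 R'"
    "\<And>w. w \<in> ball 0 R \<Longrightarrow> (f ^^ m) (G m w) = w"
    using G[of m] zm m(1) by auto
  have less: "norm (deriv (G m) (z 0)) < 1"
    using fixed_point_derivative_less_1[OF R'(1,2) Gm(1,3) z0 Gm(2)] .
  define \<mu> where "\<mu> = (\<Prod>i<m. of_nat d * ((unicritical d c ^^ i) \<alpha>) ^ (d - 1))"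
  have "((f ^^ m) has_field_derivative \<mu>) (at (G m (z 0)))"
    using has_field_derivative_unicritical_iterate[where d = d and c = c and m = m and z = \<alpha>] Gm(2)
    by (simp add: \<mu>_def f_def z_def)
  moreover have "(G m has_field_derivative deriv (G m) (z 0)) (at (z 0))"
    using Gm(1) z0 by (auto intro!: holomorphic_derivI[of _ "ball 0 R"])
  ultimately have "((\<lambda>w. (f ^^ m) (G m w)) has_field_derivative \<mu> * deriv (G m) (z 0)) (at (z 0))"
    by (rule DERIV_chain2)
  hence "((\<lambda>w. w) has_field_derivative \<mu> * deriv (G m) (z 0)) (at (z 0))"
    by (rule has_field_derivative_transform_within_open[OF _ open_ball z0]) (use Gm(4) in auto)
  hence "\<mu> * deriv (G m) (z 0) = 1" using DERIV_unique DERIV_ident by blast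
  hence one: "norm \<mu> * norm (deriv (G m) (z 0)) = 1" by (simp flip: norm_mult)
  have "norm \<mu> > 1"
  proof (rule ccontr)
    assume "\<not> norm \<mu> > 1"
    hence "norm \<mu> * norm (deriv (G m) (z 0)) \<le> 1 * norm (deriv (G m) (z 0))"
      by (intro mult_right_mono) auto
    thus False using less one by simp
  qed
  thus ?thesis by (simp add: \<mu>_def)
qed

section \<open>Elimination\<close>

lemma monic_division:
  fixes F G :: "'a :: idom poly"
  assumes "lead_coeff F = 1" "degree F > 0"
  shows "\<exists>q r. G = F * q + r \<and> degree r < degree F"
proof -
  obtain q r where qr: "pseudo_divmod G F = (q, r)" by fastforce
  have "F \<noteq> 0" using assms by auto
  from pseudo_divmod[OF this qr] assms have "G = F * q + r" "r = 0 \<or> degree r < degree F" by auto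
  thus ?thesis using assms(2) by (intro exI[of _ q] exI[of _ r]) auto
qed

text \<open>The determinant of multiplication by \<open>G\<close> on the free module of polynomials modulo a monic
  polynomial \<open>F\<close> commutes with every specialization \<open>h\<close> of the coefficients. After the
  specialization it vanishes iff multiplication by \<open>G\<close> has a kernel, that is, iff \<open>F\<close> and \<open>G\<close>
  have a common root.\<close>

lemma eliminant:
  fixes F G :: "'a :: idom poly"
  assumes F: "lead_coeff F = 1" "degree F > 0"
  shows "\<exists>R. \<forall>h :: 'a \<Rightarrow> complex. comm_ring_hom h \<longrightarrow>
    (h R = 0 \<longleftrightarrow> (\<exists>x. poly (map_poly h F) x = 0 \<and> poly (map_poly h G) x = 0))"
proof -
  define n where "n = degree F"
  have "\<forall>j. \<exists>q r. G * monom 1 j = F * q + r \<and> degree r < degree F"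
    using monic_division[OF F] by blast
  then obtain q r where qr: "\<And>j. G * monom 1 j = F * q j + r j" "\<And>j. degree (r j) < n"
    unfolding n_def by metis
  define M where "M = mat n n (\<lambda>(i, j). coeff (r j) i)"
  have "h (Determinant.det M) = 0 \<longleftrightarrow> (\<exists>x. poly (map_poly h F) x = 0 \<and> poly (map_poly h G) x = 0)"
    if "comm_ring_hom h" for h :: "'a \<Rightarrow> complex"
  proof -
    interpret h: comm_ring_hom h by fact
    interpret H: map_poly_comm_ring_hom h ..
    define F' where "F' = map_poly h F"
    define G' where "G' = map_poly h G"
    define q' where "q' j = map_poly h (q j)" for j
    define r' where "r' j = map_poly h (r j)" for j
    have coeffs: "coeff F' n = 1" "\<And>i. i > n \<Longrightarrow> coeff F' i = 0" "\<And>i j. i \<ge> n \<Longrightarrow> coeff (r' j) i = 0"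
      using F less_le_trans[OF qr(2)] by (auto simp: F'_def r'_def n_def coeff_map_poly coeff_eq_0)
    have F'0: "F' \<noteq> 0" using coeffs(1) by (metis coeff_0 zero_neq_one)
    have "degree F' \<le> n" using coeffs(2) by (intro degree_le) simp
    moreover have "n \<le> degree F'" using coeffs(1) by (intro le_degree) simp
    ultimately have F': "degree F' = n" "F' \<noteq> 0" using F'0 by simp_all
    have eq: "G' * monom 1 j = F' * q' j + r' j" for j
      using arg_cong[OF qr(1)[of j], of "map_poly h"]
      by (simp add: F'_def G'_def q'_def r'_def H.hom_mult H.hom_add map_poly_monom)
    have M: "map_mat h M \<in> carrier_mat n n" by (simp add: M_def)
    \<comment> \<open>The matrix applied to the coefficients of \<open>P\<close> gives the remainder of \<open>G P\<close>.\<close>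
    have mv: "(map_mat h M *\<^sub>v v) $ i = coeff (\<Sum>j<n. smult (v $ j) (r' j)) i"
      if "i < n" "v \<in> carrier_vec n" for v i
      using that by (simp add: M_def scalar_prod_def r'_def coeff_sum coeff_map_poly
          atLeast0LessThan mult.commute)
    have rem0: "map_mat h M *\<^sub>v v = 0\<^sub>v n \<longleftrightarrow> (\<Sum>j<n. smult (v $ j) (r' j)) = 0"
      if v: "v \<in> carrier_vec n" for v
    proof
      assume z: "map_mat h M *\<^sub>v v = 0\<^sub>v n"
      have "coeff (\<Sum>j<n. smult (v $ j) (r' j)) i = 0" for i
      proof (cases "i < n")
        case True
        thus ?thesis using mv[OF True v] z by simp
      next
        case False
        thus ?thesis using coeffs(3) by (simp add: coeff_sum)
      qed
      thus "(\<Sum>j<n. smult (v $ j) (r' j)) = 0" by (intro poly_eqI) simp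
    next
      assume "(\<Sum>j<n. smult (v $ j) (r' j)) = 0"
      thus "map_mat h M *\<^sub>v v = 0\<^sub>v n" using mv v M by (intro eq_vecI) auto
    qed
    define P where "P v = (\<Sum>j<n. smult (v $ j) (monom 1 j))" for v :: "complex vec"
    have GP: "G' * P v = F' * (\<Sum>j<n. smult (v $ j) (q' j)) + (\<Sum>j<n. smult (v $ j) (r' j))" for v
      unfolding P_def sum_distrib_left mult_smult_right eq smult_add_right sum.distrib ..
    have P_coeff: "coeff (P v) i = (if i < n then v $ i else 0)" for v i
      by (simp add: P_def coeff_sum if_distrib[of "(*) _"] sum.delta cong: if_cong)
    have P_deg: "degree (P v) < n" for v
      using F(2) by (intro degree_lessI) (auto simp: P_coeff n_def)
    have "h (Determinant.det M) = 0 \<longleftrightarrow> (\<exists>v. v \<in> carrier_vec n \<and> v \<noteq> 0\<^sub>v n \<and> map_mat h M *\<^sub>v v = 0\<^sub>v n)"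
      using det_0_iff_vec_prod_zero_field[OF M] h.hom_det[of M] by simp
    also have "\<dots> \<longleftrightarrow> (\<exists>x. poly F' x = 0 \<and> poly G' x = 0)"
    proof
      assume "\<exists>v. v \<in> carrier_vec n \<and> v \<noteq> 0\<^sub>v n \<and> map_mat h M *\<^sub>v v = 0\<^sub>v n"
      then obtain v where v: "v \<in> carrier_vec n" "v \<noteq> 0\<^sub>v n" "map_mat h M *\<^sub>v v = 0\<^sub>v n" by blast
      have "G' * P v = F' * (\<Sum>j<n. smult (v $ j) (q' j))" using GP[of v] rem0[OF v(1)] v(3) by simp
      hence dvd: "F' dvd G' * P v" by simp
      obtain i where "i < n" "v $ i \<noteq> 0" using v(1,2) by (metis carrier_vecD eq_vecI index_zero_vec)
      hence P0: "P v \<noteq> 0" using P_coeff[of v i] by auto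
      show "\<exists>x. poly F' x = 0 \<and> poly G' x = 0"
      proof (rule ccontr)
        assume none: "\<not> ?thesis"
        have "coprime F' G'"
        proof (rule coprimeI)
          fix c assume c: "c dvd F'" "c dvd G'"
          show "is_unit c"
          proof (rule ccontr)
            assume "\<not> is_unit c"
            hence "degree c \<noteq> 0" using c(1) F'(2) by (auto simp: is_unit_iff_degree)
            then obtain x where "poly c x = 0"
              using Fundamental_Theorem_Algebra.fundamental_theorem_of_algebra[of c]
              by (auto simp: constant_degree)
            thus False using none c by (meson dvdE poly_eq_0_iff_dvd dvd_trans)
          qed
        qed
        hence "F' dvd P v" using dvd by (simp add: coprime_dvd_mult_right_iff)
        thus False using dvd_imp_degree_le[OF _ P0] P_deg[of v] F'(1) by fastforce
      qed
    next
      assume "\<exists>x. poly F' x = 0 \<and> poly G' x = 0"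
      then obtain x where x: "poly F' x = 0" "poly G' x = 0" by blast
      obtain K L where K: "F' = [:-x, 1:] * K" and L: "G' = [:-x, 1:] * L"
        using x by (metis dvdE poly_eq_0_iff_dvd)
      have K0: "K \<noteq> 0" using K F'(2) by auto
      have "degree F' = 1 + degree K" unfolding K using K0 by (subst degree_mult_eq) auto
      hence degK: "degree K < n" using F'(1) by simp
      define v where "v = vec n (coeff K)"
      have v: "v \<in> carrier_vec n" by (simp add: v_def)
      have PK: "P v = K"
        using degK by (intro poly_eqI) (auto simp: P_coeff v_def coeff_eq_0)
      have "F' dvd (\<Sum>j<n. smult (v $ j) (r' j))"
      proof -
        have "(\<Sum>j<n. smult (v $ j) (r' j)) = F' * (L - (\<Sum>j<n. smult (v $ j) (q' j)))"
          using GP[of v] unfolding PK by (simp add: K L algebra_simps)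
        thus ?thesis by simp
      qed
      moreover have "degree (\<Sum>j<n. smult (v $ j) (r' j)) < n"
        using F(2) coeffs(3) by (intro degree_lessI) (auto simp: coeff_sum n_def)
      ultimately have "(\<Sum>j<n. smult (v $ j) (r' j)) = 0"
        using dvd_imp_degree_le F'(1) by (metis not_le)
      hence "map_mat h M *\<^sub>v v = 0\<^sub>v n" using rem0[OF v] by simp
      moreover have "v \<noteq> 0\<^sub>v n"
      proof
        assume "v = 0\<^sub>v n"
        hence "K = 0" unfolding PK[symmetric] by (intro poly_eqI) (simp add: P_coeff)
        thus False using K0 by simp
      qed
      ultimately show "\<exists>v. v \<in> carrier_vec n \<and> v \<noteq> 0\<^sub>v n \<and> map_mat h M *\<^sub>v v = 0\<^sub>v n" using v by blast
    qed
    finally show ?thesis by (simp add: F'_def G'_def)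
  qed
  thus ?thesis by blast
qed

text \<open>The iterates of \<open>z \<mapsto> z\<^sup>d + c\<close> as polynomials in \<open>z\<close> over the polynomial ring in \<open>c\<close>.\<close>

fun iterate_poly :: "nat \<Rightarrow> nat \<Rightarrow> rat poly poly" where
  "iterate_poly d 0 = [:0, 1:]"
| "iterate_poly d (Suc m) = iterate_poly d m ^ d + [:[:0, 1:]:]"

lemma iterate_poly_monic:
  assumes "d \<ge> 2"
  shows "degree (iterate_poly d m) = d ^ m \<and> lead_coeff (iterate_poly d m) = 1"
proof (induction m)
  case (Suc m)
  define P where "P = iterate_poly d m ^ d"
  have "iterate_poly d m \<noteq> 0" using Suc by auto
  hence "degree P = d ^ Suc m" using Suc by (simp add: P_def degree_power_eq)
  moreover have "lead_coeff P = 1" unfolding P_def lead_coeff_power using Suc.IH by (metis power_one)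
  ultimately have P: "degree P = d ^ Suc m" "lead_coeff P = 1" by blast+
  have "degree ([:[:0, 1:]:] :: rat poly poly) < degree P" using P assms by simp
  hence "degree (P + [:[:0, 1:]:]) = degree P" "lead_coeff ([:[:0, 1:]:] + P) = lead_coeff P"
    by (rule degree_add_eq_left, rule lead_coeff_add_le)
  hence "degree (P + [:[:0, 1:]:]) = d ^ Suc m" "lead_coeff (P + [:[:0, 1:]:]) = 1"
    using P by (simp_all only: add.commute)
  thus ?case by (simp only: P_def iterate_poly.simps)
qed auto

definition specialize :: "complex \<Rightarrow> rat poly \<Rightarrow> complex" where
  "specialize c p = poly (map_poly of_rat p) c"

lemma comm_ring_hom_specialize: "comm_ring_hom (specialize c)"
proof -
  interpret R: map_poly_comm_ring_hom "of_rat :: rat \<Rightarrow> complex" ..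
  show ?thesis
    by unfold_locales (simp_all add: specialize_def R.hom_mult R.hom_add)
qed

lemma poly_specialize_iterate:
  "poly (map_poly (specialize c) (iterate_poly d m)) z = (unicritical d c ^^ m) z"
proof -
  interpret h: comm_ring_hom "specialize c" by (rule comm_ring_hom_specialize)
  interpret H: map_poly_comm_ring_hom "specialize c" ..
  show ?thesis
  proof (induction m)
    case (Suc m)
    have "specialize c [:0, 1:] = c" by (simp add: specialize_def)
    thus ?case using Suc by (simp add: H.hom_add H.hom_power unicritical_def)
  qed simp
qed

text \<open>A point on a cycle of multiplier \<open>1\<close> is a common root of \<open>f\<^sup>m(z) - z\<close> and its derivative
  in \<open>z\<close>. Their eliminant is nonzero since all cycles are repelling for \<open>c = 3\<close>. Its roots are
  exactly the parameters with such a cycle, so a bound for these parameters holds in particular for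
  all conjugates of one of them.\<close>

lemma parabolic_polynomial:
  assumes d: "d \<ge> 2" and m: "m > 0"
  obtains p :: "complex poly" where "p \<noteq> 0" "\<And>i. coeff p i \<in> \<rat>"
    "\<And>c. poly p c = 0 \<longleftrightarrow> (\<exists>\<alpha>. (unicritical d c ^^ m) \<alpha> = \<alpha> \<and>
        (\<Prod>i<m. of_nat d * ((unicritical d c ^^ i) \<alpha>) ^ (d - 1)) = 1)"
proof -
  define F where "F = iterate_poly d m - [:0, 1:]"
  have "d ^ 1 \<le> d ^ m" using d m by (intro power_increasing) auto
  hence "degree ([:0, 1:] :: rat poly poly) < degree (iterate_poly d m)"
    using iterate_poly_monic[OF d, of m] d by simp
  hence deg: "degree (- [:0, 1:] :: rat poly poly) < degree (iterate_poly d m)" by simp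
  have "degree F = degree (iterate_poly d m)"
    unfolding F_def diff_conv_add_uminus by (rule degree_add_eq_left[OF deg])
  moreover have "lead_coeff F = lead_coeff (iterate_poly d m)"
    unfolding F_def diff_conv_add_uminus add.commute[of "iterate_poly d m"]
    by (rule lead_coeff_add_le[OF deg])
  ultimately have F: "lead_coeff F = 1" "degree F > 0"
    using iterate_poly_monic[OF d, of m] d by auto
  obtain R where R: "\<And>h :: rat poly \<Rightarrow> complex. comm_ring_hom h \<Longrightarrow>
      h R = 0 \<longleftrightarrow> (\<exists>x. poly (map_poly h F) x = 0 \<and> poly (map_poly h (pderiv F)) x = 0)"
    using eliminant[OF F, of "pderiv F"] by blast
  define p :: "complex poly" where "p = map_poly of_rat R"
  have iff: "poly p c = 0 \<longleftrightarrow> (\<exists>\<alpha>. (unicritical d c ^^ m) \<alpha> = \<alpha> \<and>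
        (\<Prod>i<m. of_nat d * ((unicritical d c ^^ i) \<alpha>) ^ (d - 1)) = 1)" for c
  proof -
    interpret h: comm_ring_hom "specialize c" by (rule comm_ring_hom_specialize)
    interpret H: map_poly_comm_ring_hom "specialize c" ..
    define F' where "F' = map_poly (specialize c) F"
    have val: "poly F' z = (unicritical d c ^^ m) z - z" for z
      by (simp add: F'_def F_def H.hom_minus poly_specialize_iterate)
    have "map_poly (specialize c) (pderiv F) = pderiv F'"
      by (intro poly_eqI)
        (simp add: F'_def coeff_pderiv coeff_map_poly h.hom_mult h.hom_add h.hom_of_nat)
    moreover have "poly (pderiv F') z = (\<Prod>i<m. of_nat d * ((unicritical d c ^^ i) z) ^ (d - 1)) - 1" for z
    proof (rule DERIV_unique)
      show "(poly F' has_field_derivative poly (pderiv F') z) (at z)" by (rule poly_DERIV)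
      have "((\<lambda>z. (unicritical d c ^^ m) z - z) has_field_derivative
          (\<Prod>i<m. of_nat d * ((unicritical d c ^^ i) z) ^ (d - 1)) - 1) (at z)"
        using has_field_derivative_unicritical_iterate by (intro derivative_intros)
      thus "(poly F' has_field_derivative
          (\<Prod>i<m. of_nat d * ((unicritical d c ^^ i) z) ^ (d - 1)) - 1) (at z)"
        unfolding val[abs_def] by simp
    qed
    ultimately show ?thesis
      using R[OF comm_ring_hom_specialize, of c] val by (simp add: p_def F'_def specialize_def[of c R])
  qed
  have "p \<noteq> 0"
  proof
    assume "p = 0"
    hence "poly p 3 = 0" by simp
    then obtain \<alpha> where \<alpha>: "(unicritical d 3 ^^ m) \<alpha> = \<alpha>"
        "(\<Prod>i<m. of_nat d * ((unicritical d 3 ^^ i) \<alpha>) ^ (d - 1)) = 1"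
      using iff by blast
    have "(3::real) ^ 1 \<le> 3 ^ (d - 1)" using d by (intro power_increasing) auto
    hence "norm (3 :: complex) ^ (d - 1) > 2" by simp
    from repelling_if_large[OF d this m \<alpha>(1)] show False unfolding \<alpha>(2) by simp
  qed
  moreover have "coeff p i \<in> \<rat>" for i by (simp add: p_def coeff_map_poly)
  ultimately show ?thesis using that iff by blast
qed

section \<open>The height of a parabolic parameter\<close>

text \<open>All roots of the polynomial for cycles of multiplier \<open>1\<close> lie in the disc of radius
  \<open>2 powr (1 / (d - 1))\<close>, and \<open>v\<close> respects root bounds.\<close>

lemma parabolic_archimedean_bound:
  assumes v: "valued_field K v" and arch: "\<And>q. v (of_rat q) = \<bar>of_rat q\<bar>"
    and d: "d \<ge> 2" and par: "parabolic_parameter d \<gamma>" and \<gamma>: "\<gamma> \<in> K"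
  shows "v \<gamma> ^ (d - 1) \<le> 2"
proof -
  interpret valued_field K v by fact
  obtain m \<alpha> where m: "m > 0" and \<alpha>: "(unicritical d \<gamma> ^^ m) \<alpha> = \<alpha>"
    "(\<Prod>i<m. of_nat d * ((unicritical d \<gamma> ^^ i) \<alpha>) ^ (d - 1)) = 1"
    using parabolic_parameter_multiplier_one[OF par] by blast
  obtain p :: "complex poly" where p: "p \<noteq> 0" "\<And>i. coeff p i \<in> \<rat>"
    "\<And>c. poly p c = 0 \<longleftrightarrow> (\<exists>\<alpha>. (unicritical d c ^^ m) \<alpha> = \<alpha> \<and>
        (\<Prod>i<m. of_nat d * ((unicritical d c ^^ i) \<alpha>) ^ (d - 1)) = 1)"
    using parabolic_polynomial[OF d m] by blast
  have d1: "d - 1 > 0" using d by simp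
  have "v \<gamma> \<le> root (d - 1) 2"
  proof (rule archimedean_le_root_bound[OF arch p(2,1) \<gamma>])
    show "poly p \<gamma> = 0" using p(3) \<alpha> by blast
    fix z assume "poly p z = 0"
    then obtain \<beta> where \<beta>: "(unicritical d z ^^ m) \<beta> = \<beta>"
        "(\<Prod>i<m. of_nat d * ((unicritical d z ^^ i) \<beta>) ^ (d - 1)) = 1"
      using p(3) by blast
    have "norm z ^ (d - 1) \<le> 2"
    proof (rule ccontr)
      assume "\<not> ?thesis"
      hence "norm z ^ (d - 1) > 2" by simp
      from repelling_if_large[OF d this m \<beta>(1)] show False unfolding \<beta>(2) by simp
    qed
    hence "root (d - 1) (norm z ^ (d - 1)) \<le> root (d - 1) 2"
      using d1 by (intro real_root_le_mono)
    thus "norm z \<le> root (d - 1) 2" using d1 by (simp add: real_root_power_cancel)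
  qed
  hence "v \<gamma> ^ (d - 1) \<le> root (d - 1) 2 ^ (d - 1)" using \<gamma> by (intro power_mono) auto
  thus ?thesis using d1 by (simp add: real_root_pow_pos2)
qed

lemma parabolic_parameter_algebraic:
  assumes d: "d \<ge> 2" and par: "parabolic_parameter d \<gamma>" shows "algebraic \<gamma>"
proof -
  obtain m \<alpha> where m: "m > 0" and \<alpha>: "(unicritical d \<gamma> ^^ m) \<alpha> = \<alpha>"
    "(\<Prod>i<m. of_nat d * ((unicritical d \<gamma> ^^ i) \<alpha>) ^ (d - 1)) = 1"
    using parabolic_parameter_multiplier_one[OF par] by blast
  obtain p :: "complex poly" where p: "p \<noteq> 0" "\<And>i. coeff p i \<in> \<rat>"
    "\<And>c. poly p c = 0 \<longleftrightarrow> (\<exists>\<alpha>. (unicritical d c ^^ m) \<alpha> = \<alpha> \<and>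
        (\<Prod>i<m. of_nat d * ((unicritical d c ^^ i) \<alpha>) ^ (d - 1)) = 1)"
    using parabolic_polynomial[OF d m] by blast
  moreover have "poly p \<gamma> = 0" using p(3) \<alpha> by blast
  ultimately show ?thesis unfolding algebraic_altdef by blast
qed

lemma multiplicity_of_nat: "multiplicity (int p) (int n) = multiplicity p n"
proof -
  have "int p ^ k dvd int n \<longleftrightarrow> p ^ k dvd n" for k
    by (simp flip: of_nat_power)
  thus ?thesis by (simp add: multiplicity_def)
qed

lemma padic_abs_of_nat:
  assumes "n > 0" shows "padic_abs p (of_nat n) = 1 / real p ^ multiplicity p n"
proof -
  have "quotient_of (of_nat n) = (int n, 1)"
    using quotient_of_int[of "int n"] by simp
  moreover have "multiplicity (int p) (int n) = multiplicity p n" by (rule multiplicity_of_nat)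
  ultimately show ?thesis using assms
    by (simp add: padic_abs_def power_int_minus divide_inverse)
qed

lemma padic_abs_inverse_prime:
  assumes "prime p" shows "padic_abs p (1 / of_nat p) = real p"
proof -
  have p0: "p > 0" "p > 1" using assms prime_gt_0_nat prime_gt_1_nat by auto
  have "quotient_of (1 / of_nat p) = (1, int p)"
    using p0 quotient_of_Fract[of 1 "int p"] by (simp add: Fract_of_int_quotient normalize_def)
  moreover have "multiplicity (int p) (int p) = 1"
    using p0 multiplicity_self[of p] by (simp add: multiplicity_of_nat)
  ultimately show ?thesis using p0 by (simp add: padic_abs_def)
qed

lemma padic_ultrametric:
  assumes v: "valued_field K v" and p: "prime p" and padic: "\<And>q. v (of_rat q) = padic_abs p q"
  shows "ultrametric_field K v"
proof -
  interpret valued_field K v by fact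
  show ?thesis
  proof
    fix n
    show "v (of_nat n) \<le> 1"
    proof (cases "n = 0")
      case False
      have "real p \<ge> 1" using prime_gt_0_nat[OF p] by simp
      moreover have "v (of_nat n) = padic_abs p (of_nat n)" using padic[of "of_nat n"] by simp
      ultimately show ?thesis using False by (simp add: padic_abs_of_nat)
    qed auto
  qed
qed

lemma parabolic_padic_bound:
  assumes v: "valued_field K v" and p: "prime p" and padic: "\<And>q. v (of_rat q) = padic_abs p q"
    and d: "d \<ge> 2" and par: "parabolic_parameter d \<gamma>" and \<gamma>: "\<gamma> \<in> K"
  shows "v \<gamma> ^ (d - 1) \<le> (real p ^ multiplicity p d) ^ d"
proof -
  interpret ultrametric_field K v by (rule padic_ultrametric[OF v p padic])
  obtain m \<alpha> where m: "m > 0" and \<alpha>: "(unicritical d \<gamma> ^^ m) \<alpha> = \<alpha>"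
    "(\<Prod>i<m. of_nat d * ((unicritical d \<gamma> ^^ i) \<alpha>) ^ (d - 1)) = 1"
    using parabolic_parameter_multiplier_one[OF par] by blast
  have "v \<gamma> ^ (d - 1) * v (of_nat d) ^ d \<le> 1"
    using \<alpha> by (intro parabolic_bound[OF d m \<gamma>, of "\<lambda>i. (unicritical d \<gamma> ^^ i) \<alpha>"])
      (auto simp: unicritical_def)
  moreover have "v (of_nat d) = 1 / real p ^ multiplicity p d"
    using padic[of "of_nat d"] d by (simp add: padic_abs_of_nat)
  ultimately show ?thesis
    using prime_gt_0_nat[OF p] by (simp add: power_one_over field_simps)
qed

text \<open>The local bounds are multiplied over the places above one place of \<open>\<rat>\<close>.\<close>

lemma prod_places_le:
  assumes K: "number_field K" and T: "finite T" "T \<subseteq> places K"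
    and w: "\<And>v q. v \<in> T \<Longrightarrow> v (of_rat q) = w q" "w q0 > 1"
    and \<gamma>: "\<gamma> \<in> K" and B: "B \<ge> 1" "\<And>v. v \<in> T \<Longrightarrow> v \<gamma> ^ k \<le> B"
  shows "(\<Prod>v\<in>T. normalized_abs K v \<gamma>) ^ k \<le> B ^ field_degree K"
proof -
  have nonneg: "0 \<le> v \<gamma>" if "v \<in> T" for v
    using valued_field.v_nonneg[OF place_valued_field[OF K] \<gamma>] that T by auto
  have "(\<Prod>v\<in>T. normalized_abs K v \<gamma>) ^ k = (\<Prod>v\<in>T. (v \<gamma> ^ k) ^ local_degree K v)"
    by (simp add: normalized_abs_def prod_power_distrib power_mult[symmetric] mult.commute)
  also have "\<dots> \<le> (\<Prod>v\<in>T. B ^ local_degree K v)"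
    using B nonneg by (intro prod_mono) (auto intro!: power_mono)
  also have "\<dots> = B ^ (\<Sum>v\<in>T. local_degree K v)" by (simp add: power_sum)
  also have "\<dots> \<le> B ^ field_degree K"
  proof (rule power_increasing[OF _ B(1)])
    show "(\<Sum>v\<in>T. local_degree K v) \<le> field_degree K"
      by (rule sum_local_degrees_le_degree[where w = w, OF K T _ w(2)]) (rule w(1))
  qed
  finally show ?thesis .
qed

theorem theorem1p4:
  fixes d :: nat and \<gamma> :: complex
  assumes "d \<ge> 2"
    and "parabolic_parameter d \<gamma>"
  shows "algebraic \<gamma> \<and>
         (\<forall>K. number_field K \<and> \<gamma> \<in> K \<longrightarrow>
              mult_height K \<gamma> \<le> (2 * real d ^ d) powr (1 / (real d - 1)))"
proof (intro conjI allI impI)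
  show "algebraic \<gamma>" using assms by (rule parabolic_parameter_algebraic)
  fix K assume "number_field K \<and> \<gamma> \<in> K"
  hence K: "number_field K" and \<gamma>: "\<gamma> \<in> K" by auto
  define S where "S = {v \<in> places K. max 1 (normalized_abs K v \<gamma>) \<noteq> 1}"
  define D where "D = field_degree K"
  define C where "C = 2 * real d ^ d"
  have C: "C \<ge> 1"
    using assms(1) one_le_power[of "real d" d] unfolding C_def by linarith
  have d1: "d - 1 > 0" "real (d - 1) = real d - 1" using assms(1) by auto
  have "(\<Prod>v\<in>S. max 1 (normalized_abs K v \<gamma>)) ^ (d - 1) \<le> C ^ D"
  proof (cases "finite S")
    \<comment> \<open>By convention a product over an infinite set is \<open>1\<close>.\<close>
    case False
    thus ?thesis using C by simp
  next
    case fin: True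
    have gt: "normalized_abs K v \<gamma> > 1" if "v \<in> S" for v
      using that by (auto simp: S_def max_def split: if_splits)
    have nn: "0 \<le> normalized_abs K v \<gamma>" if "v \<in> S" for v using gt[OF that] by simp
    have V: "valued_field K v" if "v \<in> S" for v
      using place_valued_field[OF K] that by (auto simp: S_def)
    have v_gt: "v \<gamma> > 1" if "v \<in> S" for v
    proof (rule ccontr)
      assume "\<not> v \<gamma> > 1"
      hence "v \<gamma> ^ local_degree K v \<le> 1"
        using valued_field.v_nonneg[OF V[OF that] \<gamma>] by (intro power_le_one) auto
      thus False using gt[OF that] by (simp add: normalized_abs_def)
    qed
    \<comment> \<open>Outside \<open>A\<close> only the places above prime divisors of \<open>d\<close> contribute.\<close>
    define A where "A = {v \<in> S. \<forall>q. v (of_rat q) = \<bar>of_rat q\<bar>}"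
    define T where "T p = {v \<in> S. \<forall>q. v (of_rat q) = padic_abs p q}" for p
    have sub: "A \<subseteq> S" "T p \<subseteq> S" "S \<subseteq> places K" for p by (auto simp: A_def T_def S_def)
    have finA: "finite A" "finite (T p)" for p using fin sub finite_subset by blast+
    have padic_bound: "v \<gamma> ^ (d - 1) \<le> (real p ^ multiplicity p d) ^ d" if "v \<in> T p" "prime p" for v p
      using that assms \<gamma> V sub by (intro parabolic_padic_bound) (auto simp: T_def)
    have "v \<in> A \<union> (\<Union>p\<in>prime_factors d. T p)" if v: "v \<in> S" for v
    proof (cases "v \<in> A")
      case False
      then obtain p where p: "prime p" "v \<in> T p" using v by (auto simp: A_def T_def S_def places_def)
      have "p \<in> prime_factors d"
      proof (rule ccontr)
        assume "p \<notin> prime_factors d"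
        hence "multiplicity p d = 0"
          using p(1) assms(1) by (auto simp: in_prime_factors_iff not_dvd_imp_multiplicity_0)
        hence "v \<gamma> ^ (d - 1) \<le> 1" using padic_bound[OF p(2,1)] by simp
        moreover have "v \<gamma> ^ (d - 1) > 1" using v_gt[OF v] d1 by (intro one_less_power) auto
        ultimately show False by simp
      qed
      thus ?thesis using p by auto
    qed auto
    hence S_eq: "S = A \<union> (\<Union>p\<in>prime_factors d. T p)" using sub by blast
    have disjA: "A \<inter> (\<Union>p\<in>prime_factors d. T p) = {}"
    proof -
      have False if v: "v \<in> A" "v \<in> T p" and p: "p \<in> prime_factors d" for v p
      proof -
        have "\<bar>of_rat (1 / of_nat p)\<bar> = v (of_rat (1 / of_nat p))" using v(1) by (simp add: A_def)
        also have "\<dots> = padic_abs p (1 / of_nat p)" using v(2) unfolding T_def by blast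
        finally have "\<bar>of_rat (1 / of_nat p) :: real\<bar> = padic_abs p (1 / of_nat p)" .
        hence "1 / real p = real p" using p by (simp add: padic_abs_inverse_prime of_rat_divide in_prime_factors_iff)
        moreover have "real p > 1" using p prime_gt_1_nat by (auto simp: in_prime_factors_iff)
        moreover from this have "1 / real p < 1" by simp
        ultimately show False by linarith
      qed
      thus ?thesis by blast
    qed
    have disjT: "T p \<inter> T p' = {}" if p: "p \<in> prime_factors d" "p' \<in> prime_factors d" "p \<noteq> p'" for p p'
    proof -
      have False if v: "v \<in> T p" "v \<in> T p'" for v
      proof -
        have "padic_abs p (of_nat p) = padic_abs p' (of_nat p)"
          using v by (auto simp: T_def)
        moreover have pp: "prime p" "prime p'" using p by (auto simp: in_prime_factors_iff)
        moreover have "multiplicity p' p = 0"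
          using pp p(3) by (intro prime_multiplicity_other) auto
        moreover have "multiplicity p p = 1" using pp prime_gt_1_nat[of p] by simp
        moreover have "p > 1" using pp prime_gt_1_nat by blast
        ultimately show False by (simp add: padic_abs_of_nat)
      qed
      thus ?thesis by blast
    qed
    have "(\<Prod>v\<in>S. max 1 (normalized_abs K v \<gamma>)) = (\<Prod>v\<in>S. normalized_abs K v \<gamma>)"
      using gt by (intro prod.cong) (auto simp: max_def less_imp_le)
    also have "\<dots> = (\<Prod>v\<in>A. normalized_abs K v \<gamma>) * (\<Prod>p\<in>prime_factors d. \<Prod>v\<in>T p. normalized_abs K v \<gamma>)"
    proof (subst S_eq, subst prod.union_disjoint)
      show "finite (\<Union>p\<in>prime_factors d. T p)" using finA by auto
      show "(\<Prod>v\<in>A. normalized_abs K v \<gamma>) * (\<Prod>v\<in>(\<Union>p\<in>prime_factors d. T p). normalized_abs K v \<gamma>) =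
         (\<Prod>v\<in>A. normalized_abs K v \<gamma>) * (\<Prod>p\<in>prime_factors d. \<Prod>v\<in>T p. normalized_abs K v \<gamma>)"
        using finA disjT by (subst prod.UNION_disjoint) auto
    qed (use finA disjA in auto)
    finally have "(\<Prod>v\<in>S. max 1 (normalized_abs K v \<gamma>)) ^ (d - 1) =
       (\<Prod>v\<in>A. normalized_abs K v \<gamma>) ^ (d - 1) *
       (\<Prod>p\<in>prime_factors d. (\<Prod>v\<in>T p. normalized_abs K v \<gamma>) ^ (d - 1))"
      by (simp add: power_mult_distrib prod_power_distrib)
    also have "\<dots> \<le> 2 ^ D * (\<Prod>p\<in>prime_factors d. ((real p ^ multiplicity p d) ^ d) ^ D)"
    proof (intro mult_mono prod_mono conjI)
      show "(\<Prod>v\<in>A. normalized_abs K v \<gamma>) ^ (d - 1) \<le> 2 ^ D"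
        unfolding D_def
      proof (rule prod_places_le[OF K finA(1), where w = "\<lambda>q. \<bar>of_rat q\<bar>" and ?q0.0 = 2])
        show "v \<gamma> ^ (d - 1) \<le> 2" if "v \<in> A" for v
          using that V sub assms \<gamma> by (intro parabolic_archimedean_bound) (auto simp: A_def)
      qed (use sub \<gamma> in \<open>auto simp: A_def\<close>)
      fix p assume "p \<in> prime_factors d"
      hence p: "prime p" by (auto simp: in_prime_factors_iff)
      show "(\<Prod>v\<in>T p. normalized_abs K v \<gamma>) ^ (d - 1) \<le> ((real p ^ multiplicity p d) ^ d) ^ D"
        unfolding D_def
      proof (rule prod_places_le[OF K finA(2), where w = "padic_abs p" and ?q0.0 = "1 / of_nat p"])
        show "padic_abs p (1 / of_nat p) > 1"
          using p prime_gt_1_nat[OF p] by (simp add: padic_abs_inverse_prime)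
        show "1 \<le> (real p ^ multiplicity p d) ^ d"
          using prime_gt_0_nat[OF p] by (intro one_le_power) auto
      qed (use sub \<gamma> padic_bound p in \<open>auto simp: T_def\<close>)
      show "0 \<le> (\<Prod>v\<in>T p. normalized_abs K v \<gamma>) ^ (d - 1)"
        using nn sub by (intro zero_le_power prod_nonneg) auto
    next
      show "0 \<le> (\<Prod>p\<in>prime_factors d. (\<Prod>v\<in>T p. normalized_abs K v \<gamma>) ^ (d - 1))"
        using nn sub(2) by (intro prod_nonneg zero_le_power ballI) blast
    qed auto
    also have "(\<Prod>p\<in>prime_factors d. ((real p ^ multiplicity p d) ^ d) ^ D) =
        (real (\<Prod>p\<in>prime_factors d. p ^ multiplicity p d) ^ d) ^ D"
      by (simp add: prod_power_distrib)
    also have "(\<Prod>p\<in>prime_factors d. p ^ multiplicity p d) = d"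
      using prod_prime_factors[of d] assms(1) by simp
    also have "2 ^ D * (real d ^ d) ^ D = C ^ D" by (simp add: C_def power_mult_distrib)
    finally show ?thesis .
  qed
  moreover define P where "P = (\<Prod>v\<in>S. max 1 (normalized_abs K v \<gamma>))"
  ultimately have P: "P ^ (d - 1) \<le> C ^ D" by simp
  have P1: "P \<ge> 1" unfolding P_def by (intro prod_ge_1) auto
  have height: "mult_height K \<gamma> = P powr (1 / real D)"
    by (simp add: mult_height_def P_def S_def D_def)
  show "mult_height K \<gamma> \<le> (2 * real d ^ d) powr (1 / (real d - 1))"
  proof (cases "D = 0")
    case True
    have "1 \<le> C powr (1 / (real d - 1))" using C d1 by (intro ge_one_powr_ge_zero) auto
    thus ?thesis using True P1 by (simp add: height C_def)
  next
    case False
    have "P = (P ^ (d - 1)) powr (1 / real (d - 1))"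
      using P1 d1(1) by (simp add: powr_powr flip: powr_realpow)
    also have "\<dots> \<le> (C ^ D) powr (1 / real (d - 1))"
      using P P1 by (intro powr_mono2) auto
    also have "\<dots> = (C powr (1 / real (d - 1))) powr real D"
      using C by (simp add: powr_powr mult.commute flip: powr_realpow)
    finally have "P powr (1 / real D) \<le> ((C powr (1 / real (d - 1))) powr real D) powr (1 / real D)"
      using P1 by (intro powr_mono2) auto
    also have "\<dots> = C powr (1 / real (d - 1))" using False C by (simp add: powr_powr)
    finally show ?thesis unfolding height C_def d1(2) .
  qed
qed

end
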